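(* Assume that $K:\Omega\times[0,T]\times[0,+\infty)\to\mathcal L(E,F)$ satisfies: (i) for every $e\in E$, the map $(\omega,t,\theta)\mapsto K(\omega,t,\theta)e$ is jointly measurable; (ii) for each $(t,\theta)$, the random operator $K(t,\theta)$ is $\mathcal F_t$-measurable; (iii) there exist deterministic constants $M_0,M<\infty$ such that, almost surely, $$\sup_{t\in[0,T]}\int_0^{+\infty}\|K(t,\theta)\|_{\mathcal L(E,F)}|\alpha|(d\theta)\leqslant M_0,\qquad \sup_{u\in(-\infty,T]}\int_0^{+\infty}\|K(u+\theta,\theta)\|_{\mathcal L(E,F)}\mathbf 1_{[0,T]}(u+\theta)|\alpha|(d\theta)\leqslant M.$$ Let $Z\in\mathcal M^2_{\mathcal F}(-\infty,T;E)$ and $Q\in\mathcal M^2_{\mathcal F}(0,T;F)$, and assume in addition that $Z(t)=0$ for $t\leqslant0$. Define $$(\mathcal RZ)(t):=\int_0^{+\infty}K(t,\theta)Z(t-\theta)\,\alpha(d\theta),\qquad t\in[0,T],$$ $$(\mathcal A^*Q)(t):=E_t\Big[\int_0^{+\infty}K(t+\theta,\theta)^*Q(t+\theta)\mathbf 1_{[0,T]}(t+\theta)\,\alpha(d\theta)\Big],\qquad t\in[0,T],$$ where $\mathcal A^*Q$ is understood as the optional projection of the square-integrable measurable process $t\mapsto\int_0^{+\infty}K(t+\theta,\theta)^*Q(t+\theta)\mathbf 1_{[0,T]}(t+\theta)\,\alpha(d\theta)$; equivalently, the formula for $(\mathcal A^*Q)(t)$ holds for almost every $t\in[0,T]$,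 almost surely. Then $\mathcal RZ\in\mathcal M^2_{\mathcal F}(0,T;F)$, $\mathcal A^*Q\in\mathcal M^2_{\mathcal F}(0,T;E)$, and $$\mathbb E\Big[\int_0^T\langle\mathcal RZ(t),Q(t)\rangle_Fdt\Big]=\mathbb E\Big[\int_0^T\langle Z(t),(\mathcal A^*Q)(t)\rangle_Edt\Big].$$ Moreover, $$\mathbb E\Big[\int_0^T\|(\mathcal A^*Q)(t)\|_E^2dt\Big]\leqslant M_0M\,\mathbb E\Big[\int_0^T\|Q(t)\|_F^2dt\Big].$$
   Context: $T>0$ is fixed; $E,F$ are separable Hilbert spaces with inner products $\langle\cdot,\cdot\rangle_E,\langle\cdot,\cdot\rangle_F$; $\alpha$ is a finite signed Borel measure on $[0,+\infty)$ with total variation $|\alpha|$. $(\Omega,\mathcal F,\{\mathcal F_t\}_{t\geqslant0},P)$ is a complete filtered probability space satisfying the usual conditions ($\mathcal F_t:=\mathcal F_0$ for $t<0$), and $E_t[\cdot]$ denotes conditional expectation with respect to $\mathcal F_t$. $\mathcal M^2_{\mathcal F}(I;E)$ is the space of progressively measurable $E$-valued processes $X$ with $\mathbb E\int_I\|X(t)\|_E^2dt<\infty$. Expressions containing the factor $\mathbf 1_{[0,T]}(t+\theta)$ are understood to vanish when $t+\theta\notin[0,T]$.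
   Formalization: The membership of RZ in M²(0,T;F) is proved modulo dt⊗P-null sets (RZ is jointly measurable and a.e. equal to a progressively measurable square-integrable process); literal progressive measurability can fail, e.g. K=1{t=ω} with F_t the null and co-null sets. *)

theory Defs
  imports "HOL-Probability.Probability"
begin

section \<open>Finite signed measures\<close>

text \<open>The library has no signed measures. The measure argument \<open>S\<close> below only supplies the measurable
  space; its own emeasure is irrelevant.\<close>

definition finite_signed_measure :: "'a measure \<Rightarrow> ('a set \<Rightarrow> real) \<Rightarrow> bool" where
  "finite_signed_measure S \<alpha> \<longleftrightarrow> \<alpha> {} = 0 \<and>
     (\<forall>A :: nat \<Rightarrow> 'a set. range A \<subseteq> sets S \<longrightarrow> disjoint_family A \<longrightarrow>
        (\<lambda>i. \<alpha> (A i)) sums \<alpha> (\<Union>i. A i))"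

definition total_variation :: "'a measure \<Rightarrow> ('a set \<Rightarrow> real) \<Rightarrow> 'a measure" where
  "total_variation S \<alpha> = measure_of (space S) (sets S)
     (\<lambda>A. SUP D\<in>{D. finite D \<and> D \<subseteq> sets S \<and> partition_on A D}. \<Sum>B\<in>D. ennreal \<bar>\<alpha> B\<bar>)"

text \<open>The two parts of the Jordan decomposition, \<open>\<alpha> = upper_variation - lower_variation\<close>.
  (\<open>ennreal\<close> maps negative reals to \<open>0\<close>, which does not affect the supremum because \<open>B = {}\<close>
  is admissible.)\<close>

definition upper_variation :: "'a measure \<Rightarrow> ('a set \<Rightarrow> real) \<Rightarrow> 'a measure" where
  "upper_variation S \<alpha> = measure_of (space S) (sets S)
     (\<lambda>A. SUP B\<in>{B \<in> sets S. B \<subseteq> A}. ennreal (\<alpha> B))"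

definition lower_variation :: "'a measure \<Rightarrow> ('a set \<Rightarrow> real) \<Rightarrow> 'a measure" where
  "lower_variation S \<alpha> = upper_variation S (\<lambda>A. - \<alpha> A)"

definition signed_integral ::
    "'a measure \<Rightarrow> ('a set \<Rightarrow> real) \<Rightarrow> ('a \<Rightarrow> 'b::{banach, second_countable_topology}) \<Rightarrow> 'b" where
  "signed_integral S \<alpha> f =
     integral\<^sup>L (upper_variation S \<alpha>) f - integral\<^sup>L (lower_variation S \<alpha>) f"

abbreviation half_line :: "real measure" where
  "half_line \<equiv> restrict_space borel {0..}"

section \<open>Filtered probability spaces and processes\<close>

locale usual_filtered_prob_space =
  prob_space P + complete_measure P + filtration "space P" F
  for P :: "'w measure" and F :: "real \<Rightarrow> 'w measure" +
  assumes subalgebra_F: "subalgebra P (F t)"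
    and null_sets_F: "null_sets P \<subseteq> sets (F 0)"
    and right_continuous_F: "0 \<le> t \<Longrightarrow> sets (F t) = (\<Inter>s\<in>{t<..}. sets (F s))"
    and negative_F: "t < 0 \<Longrightarrow> sets (F t) = sets (F 0)"

definition progressive ::
    "(real \<Rightarrow> 'w measure) \<Rightarrow> real set \<Rightarrow> (real \<Rightarrow> 'w \<Rightarrow> 'b::topological_space) \<Rightarrow> bool" where
  "progressive F I X \<longleftrightarrow> (\<forall>t\<in>I.
     (\<lambda>(s, \<omega>). X s \<omega>) \<in> borel_measurable (restrict_space borel (I \<inter> {..t}) \<Otimes>\<^sub>M F t))"

definition M2 ::
    "'w measure \<Rightarrow> (real \<Rightarrow> 'w measure) \<Rightarrow> real set \<Rightarrow> (real \<Rightarrow> 'w \<Rightarrow> 'b::real_normed_vector) set" where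
  "M2 P F I = {X. progressive F I X \<and>
     (\<integral>\<^sup>+\<omega>. (\<integral>\<^sup>+t\<in>I. ennreal ((norm (X t \<omega>))\<^sup>2) \<partial>lborel) \<partial>P) < \<infinity>}"

text \<open>Membership in the \<open>L\<^sup>2\<close>-type space of classes modulo \<open>dt \<otimes> P\<close>-null sets: the measurable process
  \<open>X\<close> is a representative of the class of an element of \<open>M2\<close>. This is needed for processes that are
  only measurable and adapted: for example \<open>X t \<omega> = (if t = \<omega> then 1 else 0)\<close> on the Lebesgue space
  \<open>[0,1]\<close>, where every \<open>F t\<close> consists of the null and co-null sets, is measurable, adapted and
  a.e. zero, but not progressively measurable.\<close>

definition represents_M2 ::
    "'w measure \<Rightarrow> (real \<Rightarrow> 'w measure) \<Rightarrow> real set \<Rightarrow> (real \<Rightarrow> 'w \<Rightarrow> 'b::real_normed_vector) \<Rightarrow> bool" where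
  "represents_M2 P F I X \<longleftrightarrow>
     (\<lambda>(t, \<omega>). X t \<omega>) \<in> borel_measurable (restrict_space lborel I \<Otimes>\<^sub>M P) \<and>
     (\<exists>Y\<in>M2 P F I. AE (t, \<omega>) in restrict_space lborel I \<Otimes>\<^sub>M P. X t \<omega> = Y t \<omega>)"

section \<open>Optional projection\<close>

text \<open>The library's conditional expectation is real valued only.\<close>

definition is_cond_exp ::
    "'w measure \<Rightarrow> 'w measure \<Rightarrow> ('w \<Rightarrow> 'b::{banach, second_countable_topology}) \<Rightarrow> ('w \<Rightarrow> 'b) \<Rightarrow> bool" where
  "is_cond_exp P G f g \<longleftrightarrow> integrable P f \<and> integrable P g \<and> g \<in> borel_measurable G \<and>
     (\<forall>A\<in>sets G. (LINT \<omega>:A|P. g \<omega>) = (LINT \<omega>:A|P. f \<omega>))"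

definition adapted_cadlag ::
    "'w measure \<Rightarrow> (real \<Rightarrow> 'w measure) \<Rightarrow> real set \<Rightarrow> (real \<Rightarrow> 'w \<Rightarrow> real) \<Rightarrow> bool" where
  "adapted_cadlag P F I X \<longleftrightarrow>
     (\<forall>t\<in>I. X t \<in> borel_measurable (F t)) \<and>
     (\<forall>\<omega>\<in>space P. \<forall>t\<in>I.
        ((\<lambda>s. X s \<omega>) \<longlongrightarrow> X t \<omega>) (at t within I \<inter> {t<..}) \<and>
        (\<exists>l. ((\<lambda>s. X s \<omega>) \<longlongrightarrow> l) (at t within I \<inter> {..<t})))"

definition optional_algebra ::
    "'w measure \<Rightarrow> (real \<Rightarrow> 'w measure) \<Rightarrow> real set \<Rightarrow> (real \<times> 'w) measure" where
  "optional_algebra P F I = sigma (I \<times> space P)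
     {{(t, \<omega>). t \<in> I \<and> \<omega> \<in> space P \<and> X t \<omega> \<in> B} | X B.
        adapted_cadlag P F I X \<and> B \<in> sets borel}"

text \<open>\<open>V\<close> is an optional projection of \<open>Y\<close> in the \<open>dt \<otimes> P\<close>-a.e. sense. As \<open>Y\<close> need only be
  \<open>dt \<otimes> P\<close>-square-integrable, \<open>Y t\<close> may fail to be integrable for exceptional \<open>t\<close>.\<close>

definition is_optional_projection ::
    "'w measure \<Rightarrow> (real \<Rightarrow> 'w measure) \<Rightarrow> real set \<Rightarrow>
     (real \<Rightarrow> 'w \<Rightarrow> 'b::{banach, second_countable_topology}) \<Rightarrow> (real \<Rightarrow> 'w \<Rightarrow> 'b) \<Rightarrow> bool" where
  "is_optional_projection P F I Y V \<longleftrightarrow>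
     (\<lambda>(t, \<omega>). V t \<omega>) \<in> borel_measurable (optional_algebra P F I) \<and>
     (AE t in lborel. t \<in> I \<longrightarrow> is_cond_exp P (F t) (Y t) (V t))"

section \<open>The delay operator and its adjoint\<close>

definition delay_op ::
    "(real set \<Rightarrow> real) \<Rightarrow>
     (real \<Rightarrow> real \<Rightarrow> 'w \<Rightarrow> 'e::real_normed_vector \<Rightarrow>\<^sub>L 'f::{banach, second_countable_topology}) \<Rightarrow>
     (real \<Rightarrow> 'w \<Rightarrow> 'e) \<Rightarrow> real \<Rightarrow> 'w \<Rightarrow> 'f" where
  "delay_op \<alpha> K Z t \<omega> = signed_integral half_line \<alpha> (\<lambda>\<theta>. blinfun_apply (K t \<theta> \<omega>) (Z (t - \<theta>) \<omega>))"

text \<open>The process inside \<open>E\<^sub>t\<close> in the definition of the adjoint operator.\<close>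

definition anticipating_adjoint ::
    "(real set \<Rightarrow> real) \<Rightarrow> real \<Rightarrow>
     (real \<Rightarrow> real \<Rightarrow> 'w \<Rightarrow> 'e::{real_inner, banach, second_countable_topology} \<Rightarrow>\<^sub>L 'f::real_inner) \<Rightarrow>
     (real \<Rightarrow> 'w \<Rightarrow> 'f) \<Rightarrow> real \<Rightarrow> 'w \<Rightarrow> 'e" where
  "anticipating_adjoint \<alpha> T K Q t \<omega> = signed_integral half_line \<alpha>
     (\<lambda>\<theta>. indicator {0..T} (t + \<theta>) *\<^sub>R
            adjoint (blinfun_apply (K (t + \<theta>) \<theta> \<omega>)) (Q (t + \<theta>) \<omega>))"

end

theory Submission
  imports Defs
begin

text \<open>By the Hahn decomposition, an integral against \<open>\<alpha>\<close> is a difference of integrals against finite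
  measures. For almost every path, the Cauchy--Schwarz inequality with weight \<open>\<parallel>K\<parallel>\<close> and the shift
  \<open>t = u + \<theta>\<close> bound the squared \<open>L\<^sup>2\<close> operator norms of the delay operator \<open>R\<close> and of the map from \<open>Q\<close>
  to its anticipating adjoint \<open>Y\<close> by \<open>M\<^sub>0 M\<close>, and Fubini's theorem gives the pathwise duality \<open>\<integral> \<langle>R Z, Q\<rangle> dt = \<integral> \<langle>Z, Y\<rangle> du\<close>. As \<open>Z u\<close> is \<open>F u\<close>-measurable,
  \<open>Y u\<close> can be replaced by its conditional expectation, which is a contraction of \<open>L\<^sup>2\<close>.

  Optional projections in the almost everywhere sense exist for all integrable processes: the
  class of processes admitting one is linear and closed under dominated limits, so it suffices to
  treat an indicator constant in time. Since \<open>R Z\<close> is adapted at almost every time, it agrees almost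
  everywhere with its optional projection, which is progressively measurable.\<close>

text \<open>The product \<open>M\<^sub>0 * M\<close> is the constant of Schur's test:
  \<open>M\<^sub>0\<close> bounds the mass of the kernel at a fixed time \<open>t\<close>, and
  \<open>M\<close> bounds its mass along a diagonal \<open>t - \<theta> = u\<close>. The pathwise
  duality lives on the whole line, whereas projections are taken on \<open>{0..T}\<close> only. The
  anticipating integral need not vanish at negative times; the zero history of \<open>Z\<close>
  removes that part. Adaptedness of the delay operator is not plain Fubini, because \<open>K\<close>
  is jointly measurable only with respect to \<open>P\<close>, while \<open>F t\<close> sees single
  sections. The substitute argument needs absolute integrability in \<open>(\<theta>, w)\<close>,
  which is available at almost every \<open>t\<close> only. The difficulty with optional projections
  is to choose versions of uncountably many conditional expectations in a jointly measurable way. A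
  fast subsequence, chosen once for all times, has a pointwise limit that is again optional, and
  contractivity in \<open>L^1\<close> identifies this limit at almost every time.\<close>

abbreviation L2_sq :: "'a measure \<Rightarrow> ('a \<Rightarrow> 'b::real_normed_vector) \<Rightarrow> ennreal" where
  "L2_sq M f \<equiv> \<integral>\<^sup>+x. ennreal ((norm (f x))\<^sup>2) \<partial>M"

section \<open>The Hahn decomposition of a finite signed measure\<close>

locale finite_signed_measure_space =
  fixes S :: "'a measure" and \<alpha> :: "'a set \<Rightarrow> real"
  assumes finite_signed: "finite_signed_measure S \<alpha>"
begin

lemma signed_empty [simp]: "\<alpha> {} = 0"
  using finite_signed by (simp add: finite_signed_measure_def)

lemma signed_sums:
  fixes A :: "nat \<Rightarrow> 'a set"
  shows "range A \<subseteq> sets S \<Longrightarrow> disjoint_family A \<Longrightarrow> (\<lambda>i. \<alpha> (A i)) sums \<alpha> (\<Union>i. A i)"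
  using finite_signed by (simp add: finite_signed_measure_def)

lemma signed_Un:
  assumes "A \<in> sets S" "B \<in> sets S" "A \<inter> B = {}"
  shows "\<alpha> (A \<union> B) = \<alpha> A + \<alpha> B"
proof -
  have "(\<lambda>i. \<alpha> (binaryset A B i)) sums \<alpha> (\<Union>i. binaryset A B i)"
    using assms by (intro signed_sums) (auto simp: range_binaryset_eq disjoint_family_on_def binaryset_def)
  moreover have "(\<lambda>i. \<alpha> (binaryset A B i)) sums (\<alpha> A + \<alpha> B)"
    by (rule binaryset_sums) simp
  ultimately show ?thesis
    by (simp add: UN_binaryset_eq sums_unique2)
qed

lemma signed_diff:
  assumes "A \<in> sets S" "B \<in> sets S" "B \<subseteq> A"
  shows "\<alpha> (A - B) = \<alpha> A - \<alpha> B"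
proof -
  have "\<alpha> (B \<union> (A - B)) = \<alpha> B + \<alpha> (A - B)"
    using assms by (intro signed_Un) auto
  moreover have "B \<union> (A - B) = A" using assms by auto
  ultimately show ?thesis by simp
qed

text \<open>The values of \<open>g\<close> are not known to be bounded, so they are cut off at
  \<open>1\<close> to make the supremum exist. Any \<open>B\<close> beyond half of a positive
  supremum will do; if the supremum is \<open>0\<close>, the empty set is chosen.\<close>

lemma greedy_choice:
  assumes C0: "\<C> \<subseteq> sets S" "{} \<in> \<C>" and g: "g {} = (0::real)"
  shows "\<exists>B\<in>\<C>. B \<subseteq> A \<and> 0 \<le> g B \<and> (\<forall>C\<in>\<C>. C \<subseteq> A \<longrightarrow> min 1 (g C) \<le> 2 * g B)"
proof -
  let ?X = "(\<lambda>C. min 1 (g C)) ` {C\<in>\<C>. C \<subseteq> A}"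
  have ne: "?X \<noteq> {}" using C0 by auto
  have bdd: "bdd_above ?X" by (intro bdd_aboveI[where M=1]) auto
  have up: "min 1 (g C) \<le> Sup ?X" if "C \<in> \<C>" "C \<subseteq> A" for C
    using that bdd by (intro cSup_upper) auto
  have s0: "0 \<le> Sup ?X" using up[of "{}"] C0 g by auto
  show ?thesis
  proof (cases "Sup ?X = 0")
    case True
    then show ?thesis using up C0 g by (intro bexI[of _ "{}"]) auto
  next
    case False
    then have "Sup ?X / 2 < Sup ?X" using s0 by simp
    then obtain B where B: "B \<in> \<C>" "B \<subseteq> A" "Sup ?X / 2 < min 1 (g B)"
      using less_cSup_iff[OF ne bdd, of "Sup ?X / 2"] by blast
    show ?thesis
    proof (intro bexI[of _ B] conjI ballI impI)
      show "0 \<le> g B" using B s0 by (auto simp: min_def split: if_splits)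
      fix C assume "C \<in> \<C>" "C \<subseteq> A"
      then show "min 1 (g C) \<le> 2 * g B" using up[of C] B by (auto simp: min_def split: if_splits)
    qed (use B in auto)
  qed
qed

text \<open>Removing step by step sets that are optimal up to a factor \<open>2\<close> leaves a remainder without
  sets of positive value, since the values of the removed disjoint sets tend to \<open>0\<close>.\<close>

lemma greedy_exhaustion:
  assumes C0: "\<C> \<subseteq> sets S" "{} \<in> \<C>" and A: "A \<in> sets S" and c: "c = 1 \<or> c = (-1::real)"
  obtains B :: "nat \<Rightarrow> 'a set" where "range B \<subseteq> \<C>" "disjoint_family B" "(\<Union>i. B i) \<subseteq> A"
    "\<And>i. 0 \<le> c * \<alpha> (B i)" "\<And>C. C \<in> \<C> \<Longrightarrow> C \<subseteq> A - (\<Union>i. B i) \<Longrightarrow> c * \<alpha> C \<le> 0"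
proof -
  have "\<exists>B\<in>\<C>. B \<subseteq> X \<and> 0 \<le> c * \<alpha> B \<and> (\<forall>C\<in>\<C>. C \<subseteq> X \<longrightarrow> min 1 (c * \<alpha> C) \<le> 2 * (c * \<alpha> B))" for X
    by (rule greedy_choice[OF C0]) simp
  then obtain G where G: "\<And>X. G X \<in> \<C>" "\<And>X. G X \<subseteq> X" "\<And>X. 0 \<le> c * \<alpha> (G X)"
    "\<And>X C. C \<in> \<C> \<Longrightarrow> C \<subseteq> X \<Longrightarrow> min 1 (c * \<alpha> C) \<le> 2 * (c * \<alpha> (G X))"
    by metis
  define R where "R n = ((\<lambda>X. X - G X) ^^ n) A" for n
  define B where "B n = G (R n)" for n
  have R_Suc: "R (Suc n) = R n - B n" for n by (simp add: R_def B_def)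
  have R_mono: "m \<le> n \<Longrightarrow> R n \<subseteq> R m" for m n
    by (induction n rule: dec_induct) (auto simp: R_Suc)
  have BR: "B n \<subseteq> R n" for n using G(2) by (simp add: B_def)
  have RA: "R n \<subseteq> A" for n using R_mono[of 0 n] by (simp add: R_def)
  have R_eq: "R n = A - (\<Union>i<n. B i)" for n
    by (induction n) (auto simp: R_Suc lessThan_Suc R_def[of 0])
  have disj: "disjoint_family B"
  proof -
    have "B m \<inter> B n = {}" if "m < n" for m n
      using R_mono[of "Suc m" n] BR[of n] that by (auto simp: R_Suc)
    then show ?thesis unfolding disjoint_family_on_def by (metis Int_commute linorder_neqE_nat)
  qed
  have rng: "range B \<subseteq> \<C>" using G(1) by (auto simp: B_def)
  \<comment> \<open>Finiteness enters here: the values of disjoint sets form a convergent series of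
    reals, so they tend to \<open>0\<close>.\<close>
  have "(\<lambda>i. \<alpha> (B i)) sums \<alpha> (\<Union>i. B i)"
    using rng C0 disj by (intro signed_sums) auto
  then have lim: "(\<lambda>i. 2 * (c * \<alpha> (B i))) \<longlonglongrightarrow> 0"
    using summable_LIMSEQ_zero sums_summable by (auto intro!: tendsto_eq_intros)
  show ?thesis
  proof
    show "range B \<subseteq> \<C>" "disjoint_family B" by fact+
    show "(\<Union>i. B i) \<subseteq> A" using BR RA by blast
    show "0 \<le> c * \<alpha> (B i)" for i using G(3) by (simp add: B_def)
    fix C assume C: "C \<in> \<C>" "C \<subseteq> A - (\<Union>i. B i)"
    \<comment> \<open>A set that avoids all removed pieces was a competitor at every stage.\<close>
    have "min 1 (c * \<alpha> C) \<le> 2 * (c * \<alpha> (B i))" for i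
      unfolding B_def using C by (intro G(4)) (auto simp: R_eq)
    then have "min 1 (c * \<alpha> C) \<le> 0"
      using lim LIMSEQ_le_const by blast
    then show "c * \<alpha> C \<le> 0" by (auto simp: min_def split: if_splits)
  qed
qed

definition positive_set :: "'a set \<Rightarrow> bool" where
  "positive_set A \<longleftrightarrow> A \<in> sets S \<and> (\<forall>B\<in>sets S. B \<subseteq> A \<longrightarrow> 0 \<le> \<alpha> B)"

text \<open>Exhausting \<open>A\<close> by sets of nonpositive value, with \<open>c = -1\<close>,
  leaves a remainder without subsets of negative value. Removing a union of nonpositive value can
  only increase the value of what is left.\<close>

lemma positive_subset:
  assumes A: "A \<in> sets S"
  obtains Q where "positive_set Q" "Q \<subseteq> A" "\<alpha> A \<le> \<alpha> Q"
proof -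
  obtain B :: "nat \<Rightarrow> 'a set" where B: "range B \<subseteq> sets S" "disjoint_family B" "(\<Union>i. B i) \<subseteq> A"
    "\<And>i. 0 \<le> -1 * \<alpha> (B i)" "\<And>C. C \<in> sets S \<Longrightarrow> C \<subseteq> A - (\<Union>i. B i) \<Longrightarrow> -1 * \<alpha> C \<le> 0"
    by (rule greedy_exhaustion[of "sets S" A "-1"]) (use A in auto)
  have UB: "(\<Union>i. B i) \<in> sets S" using B(1) by auto
  have sB: "(\<lambda>i. \<alpha> (B i)) sums \<alpha> (\<Union>i. B i)" using B(1,2) by (rule signed_sums)
  have "\<alpha> (\<Union>i. B i) \<le> 0"
    by (rule sums_le[OF _ sB sums_zero]) (use B(4) in simp)
  then show ?thesis
    using B A UB by (intro that[of "A - (\<Union>i. B i)"]) (auto simp: positive_set_def signed_diff)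
qed

text \<open>A measurable subset is cut along the disjoint pieces, and each cut has nonnegative
  value.\<close>

lemma positive_set_UN:
  fixes B :: "nat \<Rightarrow> 'a set"
  assumes "\<And>i. positive_set (B i)" "disjoint_family B"
  shows "positive_set (\<Union>i. B i)"
  unfolding positive_set_def
proof (intro conjI ballI impI)
  show "(\<Union>i. B i) \<in> sets S" using assms by (auto simp: positive_set_def)
  fix C assume C: "C \<in> sets S" "C \<subseteq> (\<Union>i. B i)"
  have s: "(\<lambda>i. \<alpha> (C \<inter> B i)) sums \<alpha> (\<Union>i. C \<inter> B i)"
    using assms(1) C disjoint_family_subset[OF assms(2), of "\<lambda>i. C \<inter> B i"]
    by (intro signed_sums) (auto simp: positive_set_def)
  have C_eq: "(\<Union>i. C \<inter> B i) = C" using C by auto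
  have "0 \<le> \<alpha> (C \<inter> B i)" for i
    using assms(1)[of i] C by (auto simp: positive_set_def)
  then show "0 \<le> \<alpha> C" by (intro sums_le[OF _ sums_zero s[unfolded C_eq]])
qed

text \<open>Here the exhaustion, with \<open>c = 1\<close>, uses positive sets only. A set of
  positive value outside their union would contain a positive set of at least that value by
  \<open>positive_subset\<close>, which the exhaustion excludes.\<close>

lemma Hahn_decomposition:
  obtains D where "D \<in> sets S" "\<And>B. B \<in> sets S \<Longrightarrow> B \<subseteq> D \<Longrightarrow> 0 \<le> \<alpha> B"
    "\<And>B. B \<in> sets S \<Longrightarrow> D \<inter> B = {} \<Longrightarrow> \<alpha> B \<le> 0"
proof -
  obtain B :: "nat \<Rightarrow> 'a set" where B: "range B \<subseteq> Collect positive_set" "disjoint_family B"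
    "\<And>C. C \<in> Collect positive_set \<Longrightarrow> C \<subseteq> space S - (\<Union>i. B i) \<Longrightarrow> 1 * \<alpha> C \<le> 0"
    by (rule greedy_exhaustion[of "Collect positive_set" "space S" 1]) (auto simp: positive_set_def)
  have pos: "positive_set (\<Union>i. B i)" using B by (intro positive_set_UN) auto
  show ?thesis
  proof (rule that[of "\<Union>i. B i"])
    fix C assume C: "C \<in> sets S" "(\<Union>i. B i) \<inter> C = {}"
    obtain Q where Q: "positive_set Q" "Q \<subseteq> C" "\<alpha> C \<le> \<alpha> Q" using positive_subset[OF C(1)] .
    have "1 * \<alpha> Q \<le> 0"
      using Q C sets.sets_into_space[OF C(1)] by (intro B(3)) auto
    with Q show "\<alpha> C \<le> 0" by simp
  qed (use pos in \<open>auto simp: positive_set_def\<close>)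
qed

section \<open>Jordan decomposition and total variation\<close>

abbreviation "upperV \<equiv> upper_variation S \<alpha>"
abbreviation "lowerV \<equiv> lower_variation S \<alpha>"
abbreviation "totalV \<equiv> total_variation S \<alpha>"

lemma Jordan_decomposition:
  obtains D where "D \<in> sets S"
    "finite_measure totalV" "sets totalV = sets S"
    "upperV = density totalV (indicator D)"
    "lowerV = density totalV (indicator (space S - D))"
proof -
  let ?tv = "\<lambda>A. SUP P\<in>{P. finite P \<and> P \<subseteq> sets S \<and> partition_on A P}. \<Sum>B\<in>P. ennreal \<bar>\<alpha> B\<bar>"
  obtain D where D: "D \<in> sets S" and pos: "\<And>B. B \<in> sets S \<Longrightarrow> B \<subseteq> D \<Longrightarrow> 0 \<le> \<alpha> B"
    and neg: "\<And>B. B \<in> sets S \<Longrightarrow> D \<inter> B = {} \<Longrightarrow> \<alpha> B \<le> 0"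
    using Hahn_decomposition by blast
  \<comment> \<open>This is the total variation in terms of the Hahn set \<open>D\<close>:
    subtracting the part outside \<open>D\<close>, where \<alpha> is nonpositive, makes both
    contributions nonnegative.\<close>
  define v where "v A = \<alpha> (A \<inter> D) - \<alpha> (A - D)" for A
  have split: "\<alpha> A = \<alpha> (A \<inter> D) + \<alpha> (A - D)" if "A \<in> sets S" for A
    using signed_Un[of "A \<inter> D" "A - D"] that D by (simp add: Int_Diff_Un Int_Diff_disjoint)
  have v0: "0 \<le> v A" if "A \<in> sets S" for A
    using pos[of "A \<inter> D"] neg[of "A - D"] that D by (auto simp: v_def)
  have v_sums: "(\<lambda>i. v (A i)) sums v (\<Union>i. A i)"
    if A: "range A \<subseteq> sets S" "disjoint_family A" for A :: "nat \<Rightarrow> 'a set"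
  proof -
    have s1: "(\<lambda>i. \<alpha> (A i \<inter> D)) sums \<alpha> (\<Union>i. A i \<inter> D)"
      using A D by (intro signed_sums) (auto simp: disjoint_family_on_def)
    have s2: "(\<lambda>i. \<alpha> (A i - D)) sums \<alpha> (\<Union>i. A i - D)"
      using A D by (intro signed_sums) (auto simp: disjoint_family_on_def)
    show ?thesis using sums_diff[OF s1 s2] by (simp add: v_def)
  qed
  define N where "N = measure_of (space S) (sets S) (\<lambda>A. ennreal (v A))"
  have emN: "emeasure N A = ennreal (v A)" if "A \<in> sets S" for A
    unfolding N_def
  proof (rule emeasure_measure_of_sigma[OF sets.sigma_algebra_axioms])
    show "positive (sets S) (\<lambda>A. ennreal (v A))" by (simp add: positive_def v_def)
    show "countably_additive (sets S) (\<lambda>A. ennreal (v A))"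
      unfolding countably_additive_def
    proof (intro allI impI)
      fix A :: "nat \<Rightarrow> 'a set" assume A: "range A \<subseteq> sets S" "disjoint_family A"
      show "(\<Sum>i. ennreal (v (A i))) = ennreal (v (\<Union>i. A i))"
        by (rule suminf_ennreal_eq[OF _ v_sums[OF A]]) (use A v0 in auto)
    qed
  qed fact
  have sN: "sets N = sets S" "space N = space S" by (simp_all add: N_def)
  have "totalV = N"
    unfolding N_def total_variation_def
  proof (rule measure_of_eq)
    fix A assume "A \<in> sigma_sets (space S) (sets S)"
    then have A: "A \<in> sets S" by (simp add: sets.sigma_sets_eq)
    show "?tv A = ennreal (v A)"
    proof (rule antisym)
      show "?tv A \<le> ennreal (v A)"
      proof (rule SUP_least, clarify)
        fix P assume P: "finite P" "P \<subseteq> sets S" "partition_on A P"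
        have "(\<Sum>B\<in>P. ennreal \<bar>\<alpha> B\<bar>) \<le> (\<Sum>B\<in>P. emeasure N B)"
        proof (rule sum_mono)
          fix B assume "B \<in> P"
          then have B: "B \<in> sets S" using P by auto
          have "\<bar>\<alpha> B\<bar> \<le> v B"
            using split[OF B] pos[of "B \<inter> D"] neg[of "B - D"] B D by (auto simp: v_def)
          then show "ennreal \<bar>\<alpha> B\<bar> \<le> emeasure N B" using emN[OF B] by (simp add: ennreal_leI)
        qed
        also have "\<dots> = emeasure N (\<Union>B\<in>P. B)"
          using P by (intro sum_emeasure)
            (auto simp: sN disjoint_family_on_def partition_on_def disjoint_def)
        also have "\<dots> = ennreal (v A)"
          using P A emN by (auto simp: partition_on_def)
        finally show "(\<Sum>B\<in>P. ennreal \<bar>\<alpha> B\<bar>) \<le> ennreal (v A)" .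
      qed
      \<comment> \<open>This partition attains the supremum. The empty set must be taken out, since
        \<open>partition_on\<close> forbids empty blocks; hence the case distinction below.\<close>
      let ?P = "{A \<inter> D, A - D} - {{}}"
      have "ennreal (v A) = ennreal (\<bar>\<alpha> (A \<inter> D)\<bar>) + ennreal \<bar>\<alpha> (A - D)\<bar>"
        using pos[of "A \<inter> D"] neg[of "A - D"] A D
        by (subst ennreal_plus[symmetric]) (auto simp: v_def)
      also have "\<dots> \<le> (\<Sum>B\<in>?P. ennreal \<bar>\<alpha> B\<bar>)"
      proof (cases "A \<inter> D = {} \<or> A - D = {}")
        case True
        then show ?thesis
        proof
          assume e: "A \<inter> D = {}"
          then have "?P = (if A = {} then {} else {A})" "A - D = A" by auto
          with e show ?thesis by simp
        next
          assume e: "A - D = {}"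
          then have "?P = (if A = {} then {} else {A})" "A \<inter> D = A" "A - D = {}" by auto
          then show ?thesis by (simp only: signed_empty) simp
        qed
      next
        case False
        then have "?P = {A \<inter> D, A - D}" "A \<inter> D \<noteq> A - D" by auto
        then show ?thesis by simp
      qed
      also have "\<dots> \<le> ?tv A"
        using A D by (intro SUP_upper) (auto simp: partition_on_def disjoint_def)
      finally show "ennreal (v A) \<le> ?tv A" .
    qed
  qed (use sets.space_closed[of S] in auto)
  note tv = this
  have dens: "emeasure (density N (indicator E)) A = ennreal (v (A \<inter> E))"
    if "A \<in> sets S" "E \<in> sets S" for A E
  proof -
    have "emeasure (density N (indicator E)) A = (\<integral>\<^sup>+x. indicator E x * indicator A x \<partial>N)"
      using that by (intro emeasure_density borel_measurable_indicator) (auto simp: sN)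
    also have "\<dots> = (\<integral>\<^sup>+x. indicator (A \<inter> E) x \<partial>N)"
      by (intro nn_integral_cong) (auto simp: indicator_def)
    also have "\<dots> = ennreal (v (A \<inter> E))"
      using that emN[of "A \<inter> E"] sN by (subst nn_integral_indicator) auto
    finally show ?thesis .
  qed
  \<comment> \<open>Two set functions that agree on the measurable sets generate the same measure,
    so \<open>f\<close> inherits all measure properties from the density.\<close>
  have mof: "measure_of (space S) (sets S) f = density N (indicator E)"
    if "E \<in> sets S" "\<And>A. A \<in> sets S \<Longrightarrow> f A = ennreal (v (A \<inter> E))" for f E
  proof -
    have "density N (indicator E) = measure_of (space S) (sets S) (emeasure (density N (indicator E)))"
      by (metis measure_of_of_measure sets_density space_density sN)
    also have "\<dots> = measure_of (space S) (sets S) f"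
      using that dens sets.space_closed[of S] by (intro measure_of_eq) (auto simp: sets.sigma_sets_eq)
    finally show ?thesis by simp
  qed
  \<comment> \<open>The sign \<open>c\<close> serves both variations: \<open>c = 1\<close> with
    \<open>E = D\<close>, and \<open>c = -1\<close> with the complement of \<open>D\<close>. The
    supremum is attained at \<open>A \<inter> E\<close>.\<close>
  have sup: "(SUP B\<in>{B \<in> sets S. B \<subseteq> A}. ennreal (c * \<alpha> B)) = ennreal (c * \<alpha> (A \<inter> E))"
    if A: "A \<in> sets S" and E: "E \<in> sets S" and p: "\<And>B. B \<in> sets S \<Longrightarrow> B \<subseteq> E \<Longrightarrow> 0 \<le> c * \<alpha> B"
      and n: "\<And>B. B \<in> sets S \<Longrightarrow> E \<inter> B = {} \<Longrightarrow> c * \<alpha> B \<le> 0" for A E c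
  proof (intro antisym SUP_least)
    fix B assume B: "B \<in> {B \<in> sets S. B \<subseteq> A}"
    have "\<alpha> ((B \<inter> E) \<union> (B - E)) = \<alpha> (B \<inter> E) + \<alpha> (B - E)" using B E by (intro signed_Un) auto
    then have "c * \<alpha> B = c * \<alpha> (B \<inter> E) + c * \<alpha> (B - E)" by (simp add: Int_Diff_Un distrib_left)
    also have "\<dots> \<le> c * \<alpha> (B \<inter> E) + 0" using B E by (intro add_left_mono n) auto
    also have "\<dots> \<le> c * \<alpha> (B \<inter> E) + c * \<alpha> (A \<inter> E - B \<inter> E)" using A B E by (intro add_left_mono p) auto
    also have "\<dots> = c * \<alpha> (A \<inter> E)"
      using A B E by (subst signed_diff) (auto simp: algebra_simps)
    finally show "ennreal (c * \<alpha> B) \<le> ennreal (c * \<alpha> (A \<inter> E))" by (rule ennreal_leI)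
  next
    show "ennreal (c * \<alpha> (A \<inter> E)) \<le> (SUP B\<in>{B \<in> sets S. B \<subseteq> A}. ennreal (c * \<alpha> B))"
      using A E by (intro SUP_upper2[of "A \<inter> E"]) auto
  qed
  have up: "upperV = density N (indicator D)"
    unfolding upper_variation_def
    using sup[of _ D 1] pos neg D by (intro mof) (auto simp: v_def Int_assoc Diff_eq)
  have lo: "lowerV = density N (indicator (space S - D))"
    unfolding lower_variation_def upper_variation_def
  proof (rule mof)
    show Dc: "space S - D \<in> sets S" using D by auto
    fix A assume A: "A \<in> sets S"
    have "A \<inter> (space S - D) \<inter> D = {}" "A \<inter> (space S - D) - D = A \<inter> (space S - D)" by auto
    then have "v (A \<inter> (space S - D)) = - \<alpha> (A \<inter> (space S - D))" by (simp only: v_def signed_empty)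
    moreover have "D \<inter> B = {}" if "B \<subseteq> space S - D" for B using that by auto
    moreover have "B \<subseteq> D" if "B \<in> sets S" "(space S - D) \<inter> B = {}" for B
      using that sets.sets_into_space[OF that(1)] by auto
    ultimately show "(SUP B\<in>{B \<in> sets S. B \<subseteq> A}. ennreal (- \<alpha> B)) = ennreal (v (A \<inter> (space S - D)))"
      using sup[OF A Dc, of "-1"] pos neg by simp
  qed
  have "finite_measure N"
    by (rule finite_measureI) (simp add: sN emN)
  with tv up lo sN D show ?thesis by (intro that[of D]) auto
qed

end

section \<open>Hilbert-space valued functions\<close>

text \<open>The representing vector minimises the energy \<open>J x = (norm x)^2 - 2 * f x\<close>,
  which is bounded below because \<open>f\<close> is bounded. The vanishing first variation at the
  minimiser is the claimed identity.\<close>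

lemma Riesz_representation:
  fixes f :: "'a::{real_inner, banach} \<Rightarrow> real"
  assumes "bounded_linear f"
  obtains v where "\<And>x. f x = inner x v"
proof -
  interpret f: bounded_linear f by fact
  obtain B where B: "0 < B" "\<And>x. \<bar>f x\<bar> \<le> norm x * B"
    using f.pos_bounded by auto
  define J where "J x = (norm x)\<^sup>2 - 2 * f x" for x
  have J_low: "- B\<^sup>2 \<le> J x" for x
  proof -
    have "0 \<le> (norm x - B)\<^sup>2" by simp
    then show ?thesis using B(2)[of x] by (simp add: J_def power2_diff abs_le_iff)
  qed
  have bdd: "bdd_below (range J)" using J_low by (auto intro!: bdd_belowI)
  define m where "m = (INF x. J x)"
  have m_le: "m \<le> J x" for x unfolding m_def using bdd by (intro cINF_lower) auto
  have "\<exists>x. J x < m + 1 / real (Suc n)" for n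
    using cINF_less_iff[OF _ bdd, of "m + 1 / real (Suc n)"] by (auto simp: m_def)
  then obtain X where X: "\<And>n. J (X n) < m + 1 / real (Suc n)" by metis
  \<comment> \<open>The parallelogram law for \<open>J\<close>, whose linear part cancels: points
    with nearly minimal energy are close to each other, so a minimising sequence is Cauchy.\<close>
  have par: "(norm (x - y))\<^sup>2 = 2 * J x + 2 * J y - 4 * J ((1/2) *\<^sub>R (x + y))" for x y
    by (simp add: J_def power2_norm_eq_inner f.add f.scaleR algebra_simps inner_commute)
  have close: "(norm (X i - X j))\<^sup>2 < 2 / real (Suc i) + 2 / real (Suc j)" for i j
    using par[of "X i" "X j"] X[of i] X[of j] m_le[of "(1/2) *\<^sub>R (X i + X j)"] by simp
  have "Cauchy X"
  proof (rule metric_CauchyI)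
    fix e :: real assume "0 < e"
    then obtain N where N: "4 / e\<^sup>2 < real N" using reals_Archimedean2 by blast
    have "dist (X i) (X j) < e" if "i \<ge> N" "j \<ge> N" for i j
    proof -
      have "0 < 4 / e\<^sup>2" using \<open>0 < e\<close> by simp
      then have N0: "0 < real N" using N by linarith
      have "2 / real (Suc k) \<le> 2 / real N" if "k \<ge> N" for k
        using that N0 by (intro divide_left_mono) auto
      from this[OF that(1)] this[OF that(2)] close[of i j]
      have "(norm (X i - X j))\<^sup>2 < 2 / real N + 2 / real N" by linarith
      also have "\<dots> = 4 / real N" by simp
      also have "\<dots> < e\<^sup>2" using N N0 \<open>0 < e\<close> by (simp add: field_simps)
      finally show ?thesis using \<open>0 < e\<close> by (simp add: dist_norm power2_less_imp_less)
    qed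
    then show "\<exists>N. \<forall>i\<ge>N. \<forall>j\<ge>N. dist (X i) (X j) < e" by blast
  qed
  then obtain v where v: "X \<longlonglongrightarrow> v" using Cauchy_convergent convergent_def by blast
  have "(\<lambda>n. J (X n)) \<longlonglongrightarrow> J v" unfolding J_def by (intro tendsto_intros f.tendsto v)
  moreover have "(\<lambda>n. m + 1 / real (Suc n)) \<longlonglongrightarrow> m + 0"
    by (intro tendsto_add tendsto_const) (rule LIMSEQ_Suc[OF lim_1_over_n])
  ultimately have "J v \<le> m" using X by (intro LIMSEQ_le[where X="\<lambda>n. J (X n)"]) (auto intro: less_imp_le)
  then have min: "J v \<le> J y" for y using m_le[of y] by simp
  have "f x = inner x v" for x
  proof -
    define c where "c = inner x v - f x"
    have q: "0 \<le> 2 * t * c + t\<^sup>2 * (norm x)\<^sup>2" for t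
    proof -
      have "J (v + t *\<^sub>R x) = J v + 2 * t * c + t\<^sup>2 * (norm x)\<^sup>2"
        unfolding J_def c_def power2_norm_eq_inner
        by (simp add: f.add f.scaleR inner_add_left inner_add_right inner_commute power2_eq_square algebra_simps)
      then show ?thesis using min[of "v + t *\<^sub>R x"] by simp
    qed
    \<comment> \<open>With \<open>t = - c / s\<close> the quadratic in \<open>q\<close> is negative
      unless \<open>c = 0\<close>. The summand \<open>1\<close> keeps \<open>s\<close> positive also
      for \<open>x = 0\<close>.\<close>
    define s where "s = 1 + (norm x)\<^sup>2"
    have s: "0 < s" "(norm x)\<^sup>2 < s" by (auto simp: s_def add_pos_nonneg)
    have "0 \<le> 2 * (- c / s) * c + (- c / s)\<^sup>2 * (norm x)\<^sup>2" by (rule q)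
    also have "\<dots> = (c / s)\<^sup>2 * ((norm x)\<^sup>2 - 2 * s)"
      using s by (simp add: field_simps power2_eq_square)
    finally have "c = 0"
      using s by (auto simp: zero_le_mult_iff)
    then show ?thesis by (simp add: c_def)
  qed
  then show ?thesis using that by blast
qed

text \<open>\<open>adjoint\<close> is a choice, so its characteristic equation is available only
  once some adjoint is known to exist. Riesz supplies one vector for each \<open>y\<close>.\<close>

lemma adjoint_inner:
  fixes f :: "'a::{real_inner, banach} \<Rightarrow> 'b::real_inner"
  assumes "bounded_linear f"
  shows "inner (f x) y = inner x (adjoint f y)"
proof -
  have "\<exists>v. \<forall>x. inner (f x) y = inner x v" for y
    using Riesz_representation[of "\<lambda>x. inner (f x) y"]
      bounded_linear_compose[OF bounded_linear_inner_left assms, of y] by metis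
  then obtain g where "\<forall>x y. inner (f x) y = inner x (g y)" by metis
  then have "\<forall>x y. inner (f x) y = inner x (adjoint f y)"
    unfolding adjoint_def by (rule someI[where P="\<lambda>f'. \<forall>x y. inner (f x) y = inner x (f' y)"])
  then show ?thesis by blast
qed

text \<open>The adjoint vector is paired with itself, and one factor of its norm is
  cancelled.\<close>

lemma norm_adjoint_le:
  fixes k :: "'a::{real_inner, banach} \<Rightarrow>\<^sub>L 'b::real_inner"
  shows "norm (adjoint (blinfun_apply k) y) \<le> norm k * norm y"
proof -
  let ?a = "adjoint (blinfun_apply k) y"
  have "(norm ?a)\<^sup>2 = inner (blinfun_apply k ?a) y"
    by (simp add: adjoint_inner[OF blinfun.bounded_linear_right] power2_norm_eq_inner)
  also have "\<dots> \<le> norm (blinfun_apply k ?a) * norm y" by (rule norm_cauchy_schwarz)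
  also have "\<dots> \<le> (norm k * norm ?a) * norm y" by (intro mult_right_mono norm_blinfun) auto
  finally show ?thesis
    by (cases "norm ?a = 0") (auto simp: power2_eq_square mult.commute mult.left_commute)
qed

lemma adjoint_zero [simp]: "adjoint (\<lambda>x::'a::{real_inner, banach}. 0::'b::real_inner) y = 0"
proof -
  have "inner x (adjoint (\<lambda>x::'a. 0::'b) y) = 0" for x
    using adjoint_inner[of "\<lambda>x::'a. 0::'b" x y] by simp
  then show ?thesis using inner_eq_zero_iff by blast
qed

section \<open>Measurability in separable spaces by countable dense subsets\<close>

lemma countable_dense_subset:
  obtains D :: "'a::{metric_space, second_countable_topology} set"
  where "countable D" "\<And>x e. 0 < e \<Longrightarrow> \<exists>d\<in>D. dist d x < e"
proof -
  obtain D :: "'a set" where D: "countable D" "\<And>X. open X \<Longrightarrow> X \<noteq> {} \<Longrightarrow> \<exists>d\<in>D. d \<in> X"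
    using countable_dense_exists by blast
  have "\<exists>d\<in>D. dist d x < e" if "0 < e" for x e
    using D(2)[of "ball x e"] that by (auto simp: dist_commute)
  then show ?thesis using D that by blast
qed

lemma le_of_le_on_dense:
  fixes f g :: "'a::metric_space \<Rightarrow> real"
  assumes D: "\<And>x e. 0 < e \<Longrightarrow> \<exists>d\<in>D. dist d x < e"
    and fg: "continuous_on UNIV f" "continuous_on UNIV g" "\<And>d. d \<in> D \<Longrightarrow> f d \<le> g d"
  shows "f x \<le> g x"
proof -
  have "closure D \<subseteq> {x. f x \<le> g x}"
    using fg by (intro closure_minimal closed_Collect_le) auto
  moreover have "closure D = UNIV" using D by (auto simp: closure_approachable)
  ultimately show ?thesis by auto
qed

text \<open>The operators are measurable only after application to a fixed vector. By density and
  continuity, each sublevel set of the norm is cut out by countably many conditions of this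
  kind.\<close>

lemma borel_measurable_norm_blinfun:
  fixes k :: "'x \<Rightarrow> 'a::{real_normed_vector, second_countable_topology} \<Rightarrow>\<^sub>L 'b::real_normed_vector"
  assumes [measurable]: "\<And>e. (\<lambda>x. blinfun_apply (k x) e) \<in> borel_measurable M"
  shows "(\<lambda>x. norm (k x)) \<in> borel_measurable M"
proof -
  obtain D :: "'a set" where D: "countable D" "\<And>x e. 0 < e \<Longrightarrow> \<exists>d\<in>D. dist d x < e"
    by (rule countable_dense_subset) (rule that)
  have eq: "norm (k x) \<le> c \<longleftrightarrow> 0 \<le> c \<and> (\<forall>d\<in>D. norm (blinfun_apply (k x) d) \<le> c * norm d)" for x c
  proof
    assume "norm (k x) \<le> c"
    then show "0 \<le> c \<and> (\<forall>d\<in>D. norm (blinfun_apply (k x) d) \<le> c * norm d)"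
      using norm_blinfun[of "k x"] order_trans[OF norm_ge_zero]
      by (metis mult_right_mono norm_ge_zero order_trans)
  next
    assume *: "0 \<le> c \<and> (\<forall>d\<in>D. norm (blinfun_apply (k x) d) \<le> c * norm d)"
    have "norm (blinfun_apply (k x) e) \<le> c * norm e" for e
      by (rule le_of_le_on_dense[OF D(2)]) (use * in \<open>auto intro!: continuous_intros\<close>)
    then show "norm (k x) \<le> c" using * by (intro norm_blinfun_bound) auto
  qed
  have "{x\<in>space M. 0 \<le> c \<and> (\<forall>d\<in>D. norm (blinfun_apply (k x) d) \<le> c * norm d)} \<in> sets M" for c
    using D(1) by measurable
  then show ?thesis
    unfolding borel_measurable_iff_le eq by blast
qed

text \<open>Pettis' theorem. A closed ball is given by countably many conditions on inner products,
  and an open set is a countable union of balls.\<close>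

lemma borel_measurable_weak:
  fixes f :: "'x \<Rightarrow> 'a::{real_inner, second_countable_topology}"
  assumes [measurable]: "\<And>e. (\<lambda>x. inner (f x) e) \<in> borel_measurable M"
  shows "f \<in> borel_measurable M"
proof -
  obtain D :: "'a set" where D: "countable D" "\<And>x e. 0 < e \<Longrightarrow> \<exists>d\<in>D. dist d x < e"
    by (rule countable_dense_subset) (rule that)
  have eq: "norm v \<le> c \<longleftrightarrow> 0 \<le> c \<and> (\<forall>d\<in>D. inner v d \<le> c * norm d)" for v :: 'a and c
  proof
    assume "norm v \<le> c"
    then show "0 \<le> c \<and> (\<forall>d\<in>D. inner v d \<le> c * norm d)"
      using norm_cauchy_schwarz[of v] by (meson mult_right_mono norm_ge_zero order_trans)
  next
    assume *: "0 \<le> c \<and> (\<forall>d\<in>D. inner v d \<le> c * norm d)"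
    \<comment> \<open>The inequality on the dense set extends to all vectors and is then applied to
      \<open>v\<close> itself.\<close>
    have "inner v v \<le> c * norm v"
      by (rule le_of_le_on_dense[OF D(2)]) (use * in \<open>auto intro!: continuous_intros\<close>)
    then show "norm v \<le> c"
      using * by (cases "v = 0") (auto simp: power2_norm_eq_inner[symmetric] power2_eq_square)
  qed
  have ball: "{x\<in>space M. dist (f x) a \<le> c} \<in> sets M" for a c
  proof -
    have "{x\<in>space M. 0 \<le> c \<and> (\<forall>d\<in>D. inner (f x) d - inner a d \<le> c * norm d)} \<in> sets M"
      using D(1) by measurable
    then show ?thesis by (simp only: dist_norm eq inner_diff_left)
  qed
  have dm: "(\<lambda>x. dist (f x) a) \<in> borel_measurable M" for a
    unfolding borel_measurable_iff_le using ball by auto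
  show ?thesis
  proof (rule borel_measurableI)
    fix S :: "'a set" assume S: "open S"
    define I where "I = {(d, n::nat). d \<in> D \<and> ball d (1 / Suc n) \<subseteq> S}"
    have "countable I" by (rule countable_subset[of _ "D \<times> UNIV"]) (use D(1) in \<open>auto simp: I_def\<close>)
    have "S = (\<Union>p\<in>I. ball (fst p) (1 / Suc (snd p)))"
    proof (intro equalityI subsetI)
      fix y assume "y \<in> S"
      then obtain e where e: "0 < e" "ball y e \<subseteq> S" using S openE by blast
      obtain n where n: "1 / Suc n < e / 2" using e(1) nat_approx_posE[of "e/2"] by auto
      obtain d where d: "d \<in> D" "dist d y < 1 / Suc n" using D(2)[of "1 / Suc n"] by auto
      have "ball d (1 / Suc n) \<subseteq> ball y e"
      proof
        fix z assume "z \<in> ball d (1 / Suc n)"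
        then show "z \<in> ball y e" using d n dist_triangle[of y z d] by (simp add: dist_commute)
      qed
      then have "(d, n) \<in> I" using e d by (auto simp: I_def)
      then show "y \<in> (\<Union>p\<in>I. ball (fst p) (1 / Suc (snd p)))" using d by (intro UN_I[of "(d, n)"]) auto
    qed (auto simp: I_def)
    then have "y \<in> S \<longleftrightarrow> (\<exists>p\<in>I. dist y (fst p) < 1 / Suc (snd p))" for y
      by (simp add: dist_commute)
    then have "f -` S \<inter> space M = (\<Union>p\<in>I. {x\<in>space M. dist (f x) (fst p) < 1 / Suc (snd p)})"
      by blast
    also have "\<dots> \<in> sets M"
      using \<open>countable I\<close> dm by (intro sets.countable_UN'') auto
    finally show "f -` S \<inter> space M \<in> sets M" .
  qed
qed

text \<open>For a simple function in place of \<open>f\<close>, the operator meets a fixed vector on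
  each level set. The limit uses continuity of each single operator.\<close>

lemma borel_measurable_blinfun_apply_Caratheodory:
  fixes k :: "'x \<Rightarrow> 'a::{real_normed_vector, second_countable_topology} \<Rightarrow>\<^sub>L 'b::{real_normed_vector, second_countable_topology}"
  assumes k: "\<And>e. (\<lambda>x. blinfun_apply (k x) e) \<in> borel_measurable M"
    and f: "f \<in> borel_measurable M"
  shows "(\<lambda>x. blinfun_apply (k x) (f x)) \<in> borel_measurable M"
proof -
  obtain s where s: "\<And>i. simple_function M (s i)" "\<And>x. x \<in> space M \<Longrightarrow> (\<lambda>i. s i x) \<longlonglongrightarrow> f x"
    using borel_measurable_implies_sequence_metric[OF f, of 0] by blast
  show ?thesis
  proof (rule borel_measurable_LIMSEQ_metric)
    fix i
    have fin: "finite (s i ` space M)" using s(1) by (simp add: simple_function_def)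
    have "(\<lambda>x. \<Sum>c\<in>s i ` space M. indicator (s i -` {c} \<inter> space M) x *\<^sub>R blinfun_apply (k x) c) \<in> borel_measurable M"
        using s(1)[of i] k by (intro borel_measurable_sum borel_measurable_scaleR borel_measurable_indicator)
        (auto simp: simple_function_def)
    also have "?this \<longleftrightarrow> (\<lambda>x. blinfun_apply (k x) (s i x)) \<in> borel_measurable M"
    proof (rule measurable_cong)
      fix x assume x: "x \<in> space M"
      have "(\<Sum>c\<in>s i ` space M. indicator (s i -` {c} \<inter> space M) x *\<^sub>R blinfun_apply (k x) c) =
        (\<Sum>c\<in>s i ` space M. if c = s i x then blinfun_apply (k x) c else 0)"
        using x by (intro sum.cong) auto
      also have "\<dots> = blinfun_apply (k x) (s i x)" using fin x by (simp add: sum.delta)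
      finally show "(\<Sum>c\<in>s i ` space M. indicator (s i -` {c} \<inter> space M) x *\<^sub>R blinfun_apply (k x) c) =
        blinfun_apply (k x) (s i x)" .
    qed
    finally show "(\<lambda>x. blinfun_apply (k x) (s i x)) \<in> borel_measurable M" .
  next
    fix x assume "x \<in> space M"
    then show "(\<lambda>i. blinfun_apply (k x) (s i x)) \<longlonglongrightarrow> blinfun_apply (k x) (f x)"
      using s(2) by (intro blinfun.tendsto tendsto_const)
  qed
qed

text \<open>Weak measurability suffices, and it allows the operator to be moved to a fixed vector,
  where its measurability is assumed.\<close>

lemma borel_measurable_adjoint:
  fixes k :: "'x \<Rightarrow> 'a::{real_inner, banach, second_countable_topology} \<Rightarrow>\<^sub>L 'b::{real_inner, second_countable_topology}"
  assumes k: "\<And>e. (\<lambda>x. blinfun_apply (k x) e) \<in> borel_measurable M"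
    and f: "f \<in> borel_measurable M"
  shows "(\<lambda>x. adjoint (blinfun_apply (k x)) (f x)) \<in> borel_measurable M"
proof (rule borel_measurable_weak)
  fix e
  have "(\<lambda>x. inner (blinfun_apply (k x) e) (f x)) \<in> borel_measurable M"
    using k f by (intro borel_measurable_inner)
  then show "(\<lambda>x. inner (adjoint (blinfun_apply (k x)) (f x)) e) \<in> borel_measurable M"
    by (simp add: adjoint_inner[OF blinfun.bounded_linear_right] inner_commute[of _ e])
qed

section \<open>Conditional expectations\<close>

lemma
  assumes "is_cond_exp P G f g" "is_cond_exp P G f' g'" "subalgebra P G"
  shows is_cond_exp_diff: "is_cond_exp P G (\<lambda>x. f x - f' x) (\<lambda>x. g x - g' x)"
    and is_cond_exp_add: "is_cond_exp P G (\<lambda>x. f x + f' x) (\<lambda>x. g x + g' x)"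
proof -
  have "set_integrable P A h" if "A \<in> sets G" "integrable P h" for A and h :: "'a \<Rightarrow> 'b"
    using that assms(3) unfolding set_integrable_def subalgebra_def
    by (intro integrable_mult_indicator) auto
  then show "is_cond_exp P G (\<lambda>x. f x - f' x) (\<lambda>x. g x - g' x)" "is_cond_exp P G (\<lambda>x. f x + f' x) (\<lambda>x. g x + g' x)"
    using assms by (auto simp: is_cond_exp_def)
qed

lemma is_cond_exp_self:
  "integrable P f \<Longrightarrow> f \<in> borel_measurable G \<Longrightarrow> is_cond_exp P G f f"
  by (simp add: is_cond_exp_def)

section \<open>Conditional expectations in Hilbert spaces: pairing with measurable vectors,
  contractivity, limits\<close>

context
  fixes P G :: "'w measure"
  assumes PG: "prob_space P" and sub: "subalgebra P G"
begin

interpretation prob_space P by (rule PG)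

lemma sets_sub: "A \<in> sets G \<Longrightarrow> A \<in> sets P"
  using sub by (auto simp: subalgebra_def)

lemma is_cond_exp_scale:
  fixes c :: "'b::{banach, second_countable_topology}"
  assumes "is_cond_exp P G f g"
  shows "is_cond_exp P G (\<lambda>x. f x *\<^sub>R c) (\<lambda>x. g x *\<^sub>R c)"
proof -
  have *: "(LINT x:A|P. h x *\<^sub>R c) = (LINT x:A|P. h x) *\<^sub>R c" if "A \<in> sets G" "integrable P h" for h A
  proof -
    have "integrable P (\<lambda>x. indicator A x *\<^sub>R h x)" using that sets_sub by (intro integrable_mult_indicator)
    then have "(\<integral>x. (indicator A x *\<^sub>R h x) *\<^sub>R c \<partial>P) = (\<integral>x. indicator A x *\<^sub>R h x \<partial>P) *\<^sub>R c"
      by (rule integral_scaleR_left)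
    then show ?thesis unfolding set_lebesgue_integral_def by (simp add: mult.assoc)
  qed
  then show ?thesis using assms by (auto simp: is_cond_exp_def)
qed

lemma is_cond_exp_real_cond_exp:
  assumes "integrable P f"
  shows "is_cond_exp P G f (real_cond_exp P G f)"
proof -
  interpret finite_measure_subalgebra P G by standard (rule sub)
  show ?thesis using assms real_cond_exp_intA[OF assms] by (auto simp: is_cond_exp_def)
qed

text \<open>For a simple \<open>U\<close>, the pairing depends on \<open>f\<close> only through its
  integrals over sets of \<open>G\<close>, which \<open>g\<close> shares. A bounded \<open>U\<close>
  is a dominated limit of simple functions.\<close>

lemma is_cond_exp_inner_bounded:
  fixes f g U :: "'w \<Rightarrow> 'b::{real_inner, banach, second_countable_topology}"
  assumes fg: "is_cond_exp P G f g" and U: "U \<in> borel_measurable G"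
    and B: "\<And>x. x \<in> space P \<Longrightarrow> norm (U x) \<le> B"
  shows "(\<integral>x. inner (g x) (U x) \<partial>P) = (\<integral>x. inner (f x) (U x) \<partial>P)"
proof -
  have sp: "space G = space P" using sub by (simp add: subalgebra_def)
  obtain s where s: "\<And>i. simple_function G (s i)" "\<And>x. x \<in> space G \<Longrightarrow> (\<lambda>i. s i x) \<longlonglongrightarrow> U x"
    "\<And>i x. x \<in> space G \<Longrightarrow> dist (s i x) 0 \<le> 2 * dist (U x) 0"
    using borel_measurable_implies_sequence_metric[OF U, of 0] by blast
  have fin: "finite (s i ` space P)" for i using s(1)[of i] by (simp add: simple_function_def sp)
  have lev: "s i -` {c} \<inter> space P \<in> sets G" for i c
    using simple_functionD(2)[OF s(1)[of i], of "{c}"] by (simp add: sp)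
  have base: "(\<integral>x. inner (h x) (s i x) \<partial>P) =
      (\<Sum>c\<in>s i ` space P. inner (LINT x:(s i -` {c} \<inter> space P)|P. h x) c)"
    if h: "integrable P h" for h i
  proof -
    let ?A = "\<lambda>c. s i -` {c} \<inter> space P"
    have ih: "integrable P (\<lambda>x. indicator (?A c) x *\<^sub>R h x)" for c
      using h lev sets_sub by (intro integrable_mult_indicator) auto
    have "(\<integral>x. inner (h x) (s i x) \<partial>P) = (\<integral>x. (\<Sum>c\<in>s i ` space P. inner (indicator (?A c) x *\<^sub>R h x) c) \<partial>P)"
    proof (rule Bochner_Integration.integral_cong[OF refl])
      fix x assume x: "x \<in> space P"
      have "(\<Sum>c\<in>s i ` space P. inner (indicator (?A c) x *\<^sub>R h x) c) =
        (\<Sum>c\<in>s i ` space P. if c = s i x then inner (h x) c else 0)"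
        using x by (intro sum.cong) auto
      then show "inner (h x) (s i x) = (\<Sum>c\<in>s i ` space P. inner (indicator (?A c) x *\<^sub>R h x) c)"
        using fin[of i] x by simp
    qed
    also have "\<dots> = (\<Sum>c\<in>s i ` space P. (\<integral>x. inner (indicator (?A c) x *\<^sub>R h x) c \<partial>P))"
      using ih by (intro Bochner_Integration.integral_sum integrable_inner_left) auto
    also have "\<dots> = (\<Sum>c\<in>s i ` space P. inner (LINT x:?A c|P. h x) c)"
      unfolding set_lebesgue_integral_def using ih by (intro sum.cong integral_inner_left) auto
    finally show ?thesis .
  qed
  have lim: "(\<lambda>i. \<integral>x. inner (h x) (s i x) \<partial>P) \<longlonglongrightarrow> (\<integral>x. inner (h x) (U x) \<partial>P)"
    if h: "integrable P h" for h
  proof (rule integral_dominated_convergence[where w="\<lambda>x. 2 * B * norm (h x)"])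
    have [measurable]: "U \<in> borel_measurable P" "\<And>i. s i \<in> borel_measurable P" "h \<in> borel_measurable P"
      using U s(1) h by (auto intro: measurable_from_subalg[OF sub] borel_measurable_simple_function)
    show "(\<lambda>x. inner (h x) (U x)) \<in> borel_measurable P" "\<And>i. (\<lambda>x. inner (h x) (s i x)) \<in> borel_measurable P"
      by measurable
    show "integrable P (\<lambda>x. 2 * B * norm (h x))" using h by auto
    show "AE x in P. (\<lambda>i. inner (h x) (s i x)) \<longlonglongrightarrow> inner (h x) (U x)"
      using s(2) by (intro AE_I2 tendsto_intros) (auto simp: sp)
    show "AE x in P. norm (inner (h x) (s i x)) \<le> 2 * B * norm (h x)" for i
    proof (rule AE_I2)
      fix x assume x: "x \<in> space P"
      have "norm (inner (h x) (s i x)) \<le> norm (h x) * norm (s i x)"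
        using Cauchy_Schwarz_ineq2 by simp
      also have "\<dots> \<le> norm (h x) * (2 * B)"
        using s(3)[of x i] B[OF x] x by (intro mult_left_mono) (auto simp: sp)
      finally show "norm (inner (h x) (s i x)) \<le> 2 * B * norm (h x)" by (simp add: mult.commute)
    qed
  qed
  have "(\<integral>x. inner (g x) (s i x) \<partial>P) = (\<integral>x. inner (f x) (s i x) \<partial>P)" for i
    using fg lev by (simp add: base is_cond_exp_def)
  then show ?thesis
    using lim[of f] lim[of g] fg by (auto simp: is_cond_exp_def intro: LIMSEQ_unique)
qed

text \<open>Tested with \<open>sgn (g x)\<close>, which is measurable for \<open>G\<close> and of
  norm at most \<open>1\<close>, the pairing gives \<open>norm (g x)\<close> on the left.\<close>

lemma is_cond_exp_L1:
  fixes f g :: "'w \<Rightarrow> 'b::{real_inner, banach, second_countable_topology}"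
  assumes fg: "is_cond_exp P G f g"
  shows "(\<integral>\<^sup>+x. norm (g x) \<partial>P) \<le> (\<integral>\<^sup>+x. norm (f x) \<partial>P)"
proof -
  have int: "integrable P f" "integrable P g" and g[measurable]: "g \<in> borel_measurable G"
    using fg by (auto simp: is_cond_exp_def)
  have sg: "(\<lambda>x. sgn (g x)) \<in> borel_measurable G" unfolding sgn_div_norm by measurable
  have [measurable]: "f \<in> borel_measurable P" "g \<in> borel_measurable P" "(\<lambda>x. sgn (g x)) \<in> borel_measurable P"
    using int measurable_from_subalg[OF sub sg] by auto
  have le: "norm (inner (f x) (sgn (g x))) \<le> norm (f x)" for x
    using Cauchy_Schwarz_ineq2[of "f x" "sgn (g x)"] by (auto simp: norm_sgn split: if_splits)
  have "(\<integral>x. norm (g x) \<partial>P) = (\<integral>x. inner (g x) (sgn (g x)) \<partial>P)"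
  proof (rule Bochner_Integration.integral_cong[OF refl])
    show "norm (g x) = inner (g x) (sgn (g x))" for x
      by (cases "g x = 0") (auto simp: sgn_div_norm power2_norm_eq_inner[symmetric] power2_eq_square)
  qed
  also have "\<dots> = (\<integral>x. inner (f x) (sgn (g x)) \<partial>P)"
    by (rule is_cond_exp_inner_bounded[OF fg sg, where B=1]) (simp add: norm_sgn)
  also have "\<dots> \<le> (\<integral>x. norm (f x) \<partial>P)"
    using int le by (intro integral_mono) (auto intro: Bochner_Integration.integrable_bound[OF int(1)] order_trans[OF abs_ge_self])
  finally have "ennreal (\<integral>x. norm (g x) \<partial>P) \<le> ennreal (\<integral>x. norm (f x) \<partial>P)" by (rule ennreal_leI)
  then show ?thesis using int by (simp add: nn_integral_eq_integral)
qed

text \<open>The difference of two versions is a conditional expectation of \<open>0\<close>, to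
  which the \<open>L^1\<close> bound applies.\<close>

lemma is_cond_exp_AE_unique:
  fixes f g g' :: "'w \<Rightarrow> 'b::{real_inner, banach, second_countable_topology}"
  assumes "is_cond_exp P G f g" "is_cond_exp P G f g'"
  shows "AE x in P. g x = g' x"
proof -
  have d: "is_cond_exp P G (\<lambda>x. f x - f x) (\<lambda>x. g x - g' x)"
    using assms sub by (rule is_cond_exp_diff)
  have [measurable]: "g \<in> borel_measurable P" "g' \<in> borel_measurable P"
    using assms by (auto simp: is_cond_exp_def)
  have "(\<integral>\<^sup>+x. norm (g x - g' x) \<partial>P) = 0" using is_cond_exp_L1[OF d] by simp
  then show ?thesis by (subst (asm) nn_integral_0_iff_AE) auto
qed

text \<open>Testing with \<open>g\<close> itself would require its square integrability in advance.
  For the bounded truncations \<open>U n\<close>, Young's inequality gives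
  \<open>E[|U n|^2] \<le> (E[|f|^2] + E[|U n|^2]) / 2\<close>, where the last term is finite and can
  be absorbed. Fatou removes the truncation.\<close>

lemma is_cond_exp_L2:
  fixes f g :: "'w \<Rightarrow> 'b::{real_inner, banach, second_countable_topology}"
  assumes fg: "is_cond_exp P G f g"
  shows "L2_sq P g \<le> L2_sq P f"
proof (cases "L2_sq P f = \<infinity>")
  case False
  have int: "integrable P f" "integrable P g" and g[measurable]: "g \<in> borel_measurable G"
    using fg by (auto simp: is_cond_exp_def)
  have [measurable]: "f \<in> borel_measurable P" "g \<in> borel_measurable P" using int by auto
  have f2: "integrable P (\<lambda>x. (norm (f x))\<^sup>2)"
    using False by (intro integrableI_bounded) (auto simp: less_top)
  define U where "U n x = (if norm (g x) \<le> real n then g x else 0)" for n :: nat and x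
  have UG: "U n \<in> borel_measurable G" for n unfolding U_def by measurable
  have [measurable]: "U n \<in> borel_measurable P" for n using measurable_from_subalg[OF sub UG] .
  have Ub: "norm (U n x) \<le> real n" for n x by (simp add: U_def)
  have bound: "L2_sq P (\<lambda>x. U n x) \<le> L2_sq P f" for n
  proof -
    have U2: "integrable P (\<lambda>x. (norm (U n x))\<^sup>2)"
      using Ub by (intro integrable_const_bound[of _ "(real n)\<^sup>2"]) (auto intro!: power_mono)
    have young: "inner (f x) (U n x) \<le> ((norm (f x))\<^sup>2 + (norm (U n x))\<^sup>2) / 2" for x
      using norm_cauchy_schwarz[of "f x" "U n x"] sum_squares_bound[of "norm (f x)" "norm (U n x)"] by simp
    have "(\<integral>x. (norm (U n x))\<^sup>2 \<partial>P) = (\<integral>x. inner (g x) (U n x) \<partial>P)"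
      by (intro Bochner_Integration.integral_cong) (auto simp: U_def power2_norm_eq_inner)
    also have "\<dots> = (\<integral>x. inner (f x) (U n x) \<partial>P)"
      by (rule is_cond_exp_inner_bounded[OF fg UG Ub])
    also have "\<dots> \<le> (\<integral>x. ((norm (f x))\<^sup>2 + (norm (U n x))\<^sup>2) / 2 \<partial>P)"
    proof (rule integral_mono)
      have "norm (inner (f x) (U n x)) \<le> norm (real n * norm (f x))" for x
        using Cauchy_Schwarz_ineq2[of "f x" "U n x"] mult_left_mono[OF Ub[of n x], of "norm (f x)"]
        by (simp add: mult.commute)
      moreover have "integrable P (\<lambda>x. real n * norm (f x))" using int by simp
      ultimately show "integrable P (\<lambda>x. inner (f x) (U n x))"
        by (rule Bochner_Integration.integrable_bound[rotated 2, OF AE_I2]) simp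
    qed (use f2 U2 young in auto)
    also have "\<dots> = ((\<integral>x. (norm (f x))\<^sup>2 \<partial>P) + (\<integral>x. (norm (U n x))\<^sup>2 \<partial>P)) / 2"
      using f2 U2 by simp
    finally have "(\<integral>x. (norm (U n x))\<^sup>2 \<partial>P) \<le> (\<integral>x. (norm (f x))\<^sup>2 \<partial>P)" by simp
    then show ?thesis using f2 U2 by (simp add: nn_integral_eq_integral ennreal_leI)
  qed
  have lim: "(\<lambda>n. ennreal ((norm (U n x))\<^sup>2)) \<longlonglongrightarrow> ennreal ((norm (g x))\<^sup>2)" for x
  proof (rule tendsto_eventually)
    obtain n where "norm (g x) \<le> real n" using real_arch_simple by blast
    then show "\<forall>\<^sub>F n in sequentially. ennreal ((norm (U n x))\<^sup>2) = ennreal ((norm (g x))\<^sup>2)"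
      by (intro eventually_sequentiallyI[of n]) (auto simp: U_def)
  qed
  have "L2_sq P g = (\<integral>\<^sup>+x. liminf (\<lambda>n. ennreal ((norm (U n x))\<^sup>2)) \<partial>P)"
    by (intro nn_integral_cong lim_imp_Liminf[symmetric] lim) simp
  also have "\<dots> \<le> liminf (\<lambda>n. L2_sq P (U n))" by (rule nn_integral_liminf) measurable
  also have "\<dots> \<le> L2_sq P f"
    by (rule order_trans[OF Liminf_mono[OF always_eventually[OF allI[OF bound]]]]) (simp add: Liminf_const)
  finally show ?thesis .
qed simp

text \<open>The bounded case holds for the truncations \<open>W n\<close> of \<open>U\<close>. Both
  pairings converge by dominated convergence, that of \<open>g\<close> because the
  \<open>L^2\<close> contraction makes \<open>g\<close> square integrable.\<close>

lemma is_cond_exp_inner_L2: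
  fixes f g U :: "'w \<Rightarrow> 'b::{real_inner, banach, second_countable_topology}"
  assumes fg: "is_cond_exp P G f g" and U: "U \<in> borel_measurable G"
    and f2: "integrable P (\<lambda>x. (norm (f x))\<^sup>2)" and U2: "integrable P (\<lambda>x. (norm (U x))\<^sup>2)"
  shows "(\<integral>x. inner (g x) (U x) \<partial>P) = (\<integral>x. inner (f x) (U x) \<partial>P)"
proof -
  note [measurable] = U
  have int: "integrable P f" "integrable P g" using fg by (auto simp: is_cond_exp_def)
  have [measurable]: "f \<in> borel_measurable P" "g \<in> borel_measurable P" "U \<in> borel_measurable P"
    using int measurable_from_subalg[OF sub U] by auto
  have g2: "integrable P (\<lambda>x. (norm (g x))\<^sup>2)"
  proof (rule integrableI_bounded)
    have "L2_sq P g \<le> L2_sq P f"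
      by (rule is_cond_exp_L2[OF fg])
    also have "\<dots> < \<infinity>" using f2 by (simp add: nn_integral_eq_integral)
    finally show "(\<integral>\<^sup>+x. ennreal (norm ((norm (g x))\<^sup>2)) \<partial>P) < \<infinity>" by simp
  qed simp
  define W where "W n x = (if norm (U x) \<le> real n then U x else 0)" for n :: nat and x
  have WG: "W n \<in> borel_measurable G" for n unfolding W_def by measurable
  have [measurable]: "W n \<in> borel_measurable P" for n using measurable_from_subalg[OF sub WG] .
  have lim: "(\<lambda>n. \<integral>x. inner (h x) (W n x) \<partial>P) \<longlonglongrightarrow> (\<integral>x. inner (h x) (U x) \<partial>P)"
    if h2: "integrable P (\<lambda>x. (norm (h x))\<^sup>2)" and [measurable]: "h \<in> borel_measurable P" for h
  proof (rule integral_dominated_convergence[where w="\<lambda>x. ((norm (h x))\<^sup>2 + (norm (U x))\<^sup>2) / 2"])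
    show "integrable P (\<lambda>x. ((norm (h x))\<^sup>2 + (norm (U x))\<^sup>2) / 2)" using h2 U2 by auto
    show "AE x in P. (\<lambda>n. inner (h x) (W n x)) \<longlonglongrightarrow> inner (h x) (U x)"
    proof (intro AE_I2 tendsto_eventually)
      fix x
      obtain n where "norm (U x) \<le> real n" using real_arch_simple by blast
      then show "\<forall>\<^sub>F n in sequentially. inner (h x) (W n x) = inner (h x) (U x)"
        by (intro eventually_sequentiallyI[of n]) (auto simp: W_def)
    qed
    show "AE x in P. norm (inner (h x) (W n x)) \<le> ((norm (h x))\<^sup>2 + (norm (U x))\<^sup>2) / 2" for n
    proof (rule AE_I2)
      fix x
      have "norm (inner (h x) (W n x)) \<le> norm (h x) * norm (W n x)" using Cauchy_Schwarz_ineq2 by simp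
      also have "\<dots> \<le> norm (h x) * norm (U x)" by (intro mult_left_mono) (auto simp: W_def)
      also have "\<dots> \<le> ((norm (h x))\<^sup>2 + (norm (U x))\<^sup>2) / 2"
        using sum_squares_bound[of "norm (h x)" "norm (U x)"] by simp
      finally show "norm (inner (h x) (W n x)) \<le> ((norm (h x))\<^sup>2 + (norm (U x))\<^sup>2) / 2" .
    qed
  qed measurable
  have "(\<integral>x. inner (g x) (W n x) \<partial>P) = (\<integral>x. inner (f x) (W n x) \<partial>P)" for n
    by (rule is_cond_exp_inner_bounded[OF fg WG, where B="real n"]) (simp add: W_def)
  then show ?thesis using lim[OF f2] lim[OF g2] by (auto intro: LIMSEQ_unique)
qed

text \<open>Integrability of \<open>W\<close> comes from some \<open>V k\<close> at finite
  \<open>L^1\<close> distance. The integrals over each set of \<open>G\<close> then pass to the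
  limit on both sides.\<close>

lemma is_cond_exp_L1_limit:
  fixes Y V :: "nat \<Rightarrow> 'w \<Rightarrow> 'b::{real_inner, banach, second_countable_topology}"
  assumes YV: "\<And>k. is_cond_exp P G (Y k) (V k)"
    and Z: "integrable P Z" and W: "W \<in> borel_measurable G"
    and YZ: "(\<lambda>k. \<integral>\<^sup>+x. norm (Y k x - Z x) \<partial>P) \<longlonglongrightarrow> 0"
    and VW: "(\<lambda>k. \<integral>\<^sup>+x. norm (V k x - W x) \<partial>P) \<longlonglongrightarrow> 0"
  shows "is_cond_exp P G Z W"
proof -
  have intY: "integrable P (Y k)" and intV: "integrable P (V k)" for k using YV by (auto simp: is_cond_exp_def)
  have Wm[measurable]: "W \<in> borel_measurable P" using measurable_from_subalg[OF sub W] .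
  have Vm[measurable]: "V k \<in> borel_measurable P" for k using intV by auto
  have "\<forall>\<^sub>F k in sequentially. (\<integral>\<^sup>+x. norm (V k x - W x) \<partial>P) < 1"
    using VW by (rule order_tendstoD) simp
  then obtain k where "(\<integral>\<^sup>+x. norm (V k x - W x) \<partial>P) < 1" by (auto simp: eventually_sequentially)
  then have "integrable P (\<lambda>x. V k x - W x)"
    by (intro integrableI_bounded) (auto intro: less_trans)
  from Bochner_Integration.integrable_diff[OF intV[of k] this] have intW: "integrable P W" by simp
  have lim: "(\<lambda>k. LINT x:A|P. X k x) \<longlonglongrightarrow> (LINT x:A|P. y x)"
    if A: "A \<in> sets G" and X: "\<And>k. integrable P (X k)" "integrable P y"
      "(\<lambda>k. \<integral>\<^sup>+x. norm (X k x - y x) \<partial>P) \<longlonglongrightarrow> 0" for A and X :: "nat \<Rightarrow> 'w \<Rightarrow> 'b" and y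
    unfolding set_lebesgue_integral_def
  proof (rule tendsto_L1_int)
    show "integrable P (\<lambda>x. indicator A x *\<^sub>R X k x)" "integrable P (\<lambda>x. indicator A x *\<^sub>R y x)" for k
      using X sets_sub[OF A] by (auto intro: integrable_mult_indicator)
    show "(\<lambda>k. \<integral>\<^sup>+x. norm (indicator A x *\<^sub>R X k x - indicator A x *\<^sub>R y x) \<partial>P) \<longlonglongrightarrow> 0"
      by (rule tendsto_sandwich[OF _ _ tendsto_const X(3)])
        (auto intro!: nn_integral_mono always_eventually split: split_indicator)
  qed
  have "(LINT x:A|P. W x) = (LINT x:A|P. Z x)" if A: "A \<in> sets G" for A
    using lim[OF A intV intW VW] lim[OF A intY Z YZ] YV A
    by (auto simp: is_cond_exp_def intro: LIMSEQ_unique)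
  then show ?thesis using Z intW W by (auto simp: is_cond_exp_def)
qed

end

section \<open>Optional processes\<close>

lemma space_optional_algebra: "space (optional_algebra P F I) = I \<times> space P"
  by (auto simp: optional_algebra_def intro!: space_measure_of)

lemma adapted_cadlag_optional:
  assumes "adapted_cadlag P F I X"
  shows "(\<lambda>(t, w). X t w) \<in> borel_measurable (optional_algebra P F I)"
proof (rule measurableI)
  fix B :: "real set" assume B: "B \<in> sets borel"
  have "(\<lambda>(t, w). X t w) -` B \<inter> space (optional_algebra P F I) =
      {(t, w). t \<in> I \<and> w \<in> space P \<and> X t w \<in> B}"
    by (auto simp: space_optional_algebra)
  also have "\<dots> \<in> sets (optional_algebra P F I)"
    unfolding optional_algebra_def using assms B by (intro in_measure_of) auto
  finally show "(\<lambda>(t, w). X t w) -` B \<inter> space (optional_algebra P F I) \<in> sets (optional_algebra P F I)" .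
qed simp

text \<open>Time itself is a continuous adapted process. Hence measurable deterministic functions of
  time are optional.\<close>

lemma optional_fst: "(\<lambda>(t, w). t) \<in> borel_measurable (optional_algebra P F I)"
  by (rule adapted_cadlag_optional) (auto simp: adapted_cadlag_def intro!: tendsto_intros exI)

context usual_filtered_prob_space
begin

abbreviation L2_process :: "(real \<Rightarrow> 'w \<Rightarrow> 'b::real_normed_vector) \<Rightarrow> ennreal" where
  "L2_process X \<equiv> \<integral>\<^sup>+w. (\<integral>\<^sup>+t. ennreal ((norm (X t w))\<^sup>2) \<partial>lborel) \<partial>P"

abbreviation L2_process_on :: "real set \<Rightarrow> (real \<Rightarrow> 'w \<Rightarrow> 'b::real_normed_vector) \<Rightarrow> ennreal" where
  "L2_process_on I X \<equiv> \<integral>\<^sup>+w. (\<integral>\<^sup>+t\<in>I. ennreal ((norm (X t w))\<^sup>2) \<partial>lborel) \<partial>P"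

abbreviation dtP :: "(real \<times> 'w) measure" where
  "dtP \<equiv> lborel \<Otimes>\<^sub>M P"

abbreviation jointly_measurable :: "(real \<Rightarrow> 'w \<Rightarrow> 'b::topological_space) \<Rightarrow> bool" where
  "jointly_measurable X \<equiv> (\<lambda>(t, w). X t w) \<in> borel_measurable dtP"

abbreviation optional :: "real \<Rightarrow> (real \<Rightarrow> 'w \<Rightarrow> 'b::topological_space) \<Rightarrow> bool" where
  "optional T X \<equiv> (\<lambda>(t, w). X t w) \<in> borel_measurable (optional_algebra P F {0..T})"

abbreviation opt_proj ::
    "real \<Rightarrow> (real \<Rightarrow> 'w \<Rightarrow> 'b::{banach, second_countable_topology}) \<Rightarrow> (real \<Rightarrow> 'w \<Rightarrow> 'b) \<Rightarrow> bool" where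
  "opt_proj T Y V \<equiv> is_optional_projection P F {0..T} Y V"

lemma measurable_F_P: "X \<in> borel_measurable (F t) \<Longrightarrow> X \<in> borel_measurable P"
  using measurable_from_subalg[OF subalgebra_F] .

lemma measurable_F_mono: "s \<le> t \<Longrightarrow> X \<in> borel_measurable (F s) \<Longrightarrow> X \<in> borel_measurable (F t)"
  using sets_F_mono[of s t] by (auto simp: measurable_def space_F)

text \<open>The path at time \<open>s\<close> is approximated by its values at grid points strictly
  to the right of \<open>s\<close>, as right continuity demands, but capped at \<open>t\<close>, so
  that only information from \<open>F t\<close> is used.\<close>

lemma adapted_cadlag_progressive:
  assumes X: "adapted_cadlag P F {0..T} X"
  shows "progressive F {0..T} X"
  unfolding progressive_def
proof
  fix t assume t: "t \<in> {0..T}"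
  let ?M = "restrict_space borel ({0..T} \<inter> {..t}) \<Otimes>\<^sub>M F t"
  \<comment> \<open>The \<open>+ 1\<close> makes the uncapped grid point strictly larger than
    \<open>s\<close>. At \<open>s = t\<close> the cap gives \<open>a n s = s\<close>.\<close>
  define a where "a n s = max 0 (min t ((real_of_int \<lfloor>real (Suc n) * s\<rfloor> + 1) / real (Suc n)))" for n s
  have spM: "space ?M = {0..t} \<times> space P"
    using t by (auto simp: space_pair_measure space_restrict_space space_F)
  have XF: "\<And>s. s \<in> {0..T} \<Longrightarrow> X s \<in> borel_measurable (F s)"
    using X by (simp add: adapted_cadlag_def)
  show "(\<lambda>(s, w). X s w) \<in> borel_measurable ?M"
  proof (rule borel_measurable_LIMSEQ_real)
    fix n
    have "(\<lambda>p. (\<lambda>i p. X (max 0 (min t ((real_of_int i + 1) / real (Suc n)))) (snd p))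
         \<lfloor>real (Suc n) * fst p\<rfloor> p) \<in> borel_measurable ?M"
    proof (rule measurable_compose_countable[where g="\<lambda>p. \<lfloor>real (Suc n) * fst p\<rfloor>"
          and f="\<lambda>i p. X (max 0 (min t ((real_of_int i + 1) / real (Suc n)))) (snd p)"])
      fix i :: int
      let ?r = "max 0 (min t ((real_of_int i + 1) / real (Suc n)))"
      have "?r \<in> {0..T}" "?r \<le> t" using t by auto
      then have "X ?r \<in> borel_measurable (F t)"
        using XF t by (intro measurable_F_mono[of ?r t]) auto
      then show "(\<lambda>p. X ?r (snd p)) \<in> borel_measurable ?M" by simp
    next
      have [measurable]: "fst \<in> borel_measurable ?M"
        by (rule measurable_compose[OF measurable_fst, of "\<lambda>x. x", unfolded id_def comp_def])
          (rule measurable_restrict_space1, simp)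
      show "(\<lambda>p. \<lfloor>real (Suc n) * fst p\<rfloor>) \<in> ?M \<rightarrow>\<^sub>M count_space UNIV" by measurable
    qed
    then show "(\<lambda>p. X (a n (fst p)) (snd p)) \<in> borel_measurable ?M" by (simp add: a_def)
  next
    fix p assume "p \<in> space ?M"
    then have "p \<in> {0..t} \<times> space P" unfolding spM .
    then obtain s w where p: "p = (s, w)" and s: "0 \<le> s" "s \<le> t" and w: "w \<in> space P"
      by auto
    have fl: "real (Suc n) * s < real_of_int \<lfloor>real (Suc n) * s\<rfloor> + 1"
      "real_of_int \<lfloor>real (Suc n) * s\<rfloor> \<le> real (Suc n) * s" for n by linarith+
    have up: "s < (real_of_int \<lfloor>real (Suc n) * s\<rfloor> + 1) / real (Suc n)" for n
      using fl[of n] by (subst pos_less_divide_eq) (auto simp: mult.commute)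
    have low: "(real_of_int \<lfloor>real (Suc n) * s\<rfloor> + 1) / real (Suc n) \<le> s + 1 / real (Suc n)" for n
    proof -
      have "(real_of_int \<lfloor>real (Suc n) * s\<rfloor> + 1) / real (Suc n) \<le> (real (Suc n) * s + 1) / real (Suc n)"
        using fl[of n] by (intro divide_right_mono) auto
      also have "\<dots> = s + 1 / real (Suc n)" by (simp add: add_divide_distrib)
      finally show ?thesis .
    qed
    have a_bd: "s \<le> a n s" "a n s \<le> s + 1 / real (Suc n)" "a n s \<in> {0..t}" for n
      using up[of n] low[of n] s by (auto simp: a_def)
    have a_lim: "(\<lambda>n. a n s) \<longlonglongrightarrow> s"
    proof (rule tendsto_sandwich[OF _ _ tendsto_const])
      show "\<forall>\<^sub>F n in sequentially. s \<le> a n s" "\<forall>\<^sub>F n in sequentially. a n s \<le> s + 1 / real (Suc n)"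
        using a_bd by auto
      show "(\<lambda>n. s + 1 / real (Suc n)) \<longlonglongrightarrow> s"
        using tendsto_add[OF tendsto_const LIMSEQ_Suc[OF lim_1_over_n], of s] by simp
    qed
    show "(\<lambda>n. X (a n (fst p)) (snd p)) \<longlonglongrightarrow> (case p of (s, w) \<Rightarrow> X s w)"
    proof (cases "s = t")
      case True
      then have "a n s = s" for n using a_bd[of n] by auto
      then show ?thesis by (simp add: p)
    next
      case False
      then have "s < t" using s by simp
      then have gt: "s < a n s" for n using up[of n] s by (auto simp: a_def)
      have "filterlim (\<lambda>n. a n s) (at s within {0..T} \<inter> {s<..}) sequentially"
      proof -
        have "a n s \<in> {0..T} \<inter> {s<..} \<and> a n s \<noteq> s" for n using a_bd(3)[of n] gt[of n] t by auto
        then show ?thesis using a_lim by (auto simp: filterlim_at)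
      qed
      moreover have "((\<lambda>s. X s w) \<longlongrightarrow> X s w) (at s within {0..T} \<inter> {s<..})"
        using X s t w by (auto simp: adapted_cadlag_def)
      ultimately show ?thesis by (auto simp: p intro: filterlim_compose)
    qed
  qed
qed

text \<open>The claim is that the inclusion of \<open>{0..t} \<times> space P\<close>, with the
  product algebra of \<open>F t\<close>, into the optional space is measurable. This is checked on
  the generators, which are covered by \<open>adapted_cadlag_progressive\<close>.\<close>

lemma optional_progressive:
  fixes V :: "real \<Rightarrow> 'w \<Rightarrow> 'b::topological_space"
  assumes V: "optional T V"
  shows "progressive F {0..T} V"
  unfolding progressive_def
proof
  fix t assume t: "t \<in> {0..T}"
  let ?M = "restrict_space borel ({0..T} \<inter> {..t}) \<Otimes>\<^sub>M F t"
  have spM: "space ?M = {0..t} \<times> space P"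
    using t by (auto simp: space_pair_measure space_restrict_space space_F)
  have "(\<lambda>x. x) \<in> ?M \<rightarrow>\<^sub>M optional_algebra P F {0..T}"
    unfolding optional_algebra_def
  proof (rule measurable_measure_of)
    show "{{(t, w). t \<in> {0..T} \<and> w \<in> space P \<and> X t w \<in> B} |X B.
        adapted_cadlag P F {0..T} X \<and> B \<in> sets borel} \<subseteq> Pow ({0..T} \<times> space P)" by auto
    show "(\<lambda>x. x) \<in> space ?M \<rightarrow> {0..T} \<times> space P" unfolding spM using t by auto
    fix A assume "A \<in> {{(t, w). t \<in> {0..T} \<and> w \<in> space P \<and> X t w \<in> B} |X B.
        adapted_cadlag P F {0..T} X \<and> B \<in> sets borel}"
    then obtain X B where A: "A = {(t, w). t \<in> {0..T} \<and> w \<in> space P \<and> X t w \<in> B}"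
      and X: "adapted_cadlag P F {0..T} X" and B: "B \<in> sets borel" by blast
    have "(\<lambda>(s, w). X s w) \<in> borel_measurable ?M"
      using adapted_cadlag_progressive[OF X] t by (auto simp: progressive_def)
    from measurable_sets[OF this B] have "(\<lambda>(s, w). X s w) -` B \<inter> space ?M \<in> sets ?M" .
    also have "(\<lambda>(s, w). X s w) -` B \<inter> space ?M = (\<lambda>x. x) -` A \<inter> space ?M"
      unfolding spM using t by (auto simp: A)
    finally show "(\<lambda>x. x) -` A \<inter> space ?M \<in> sets ?M" .
  qed
  from measurable_compose[OF this V] show "(\<lambda>(s, w). V s w) \<in> borel_measurable ?M" .
qed

lemma progressive_adapted:
  assumes "progressive F I X" "t \<in> I"
  shows "X t \<in> borel_measurable (F t)"
proof -
  have "(\<lambda>(s, w). X s w) \<in> borel_measurable (restrict_space borel (I \<inter> {..t}) \<Otimes>\<^sub>M F t)"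
    using assms by (auto simp: progressive_def)
  moreover have "Pair t \<in> F t \<rightarrow>\<^sub>M (restrict_space borel (I \<inter> {..t}) \<Otimes>\<^sub>M F t)"
    using assms by (intro measurable_Pair1') (auto simp: space_restrict_space)
  ultimately have "(\<lambda>w. (\<lambda>(s, w). X s w) (t, w)) \<in> borel_measurable (F t)"
    by (rule measurable_compose[rotated])
  then show ?thesis by simp
qed

section \<open>Limits of processes along a subsequence common to all times\<close>

text \<open>This is the completeness argument behind the existence of projections. One subsequence
  works at almost every time, since the integrals of \<open>h (r k)\<close> over \<open>I\<close>
  are summable. The algebra \<open>N\<close> is left open so that the limit can be optional. The
  convergence of \<open>h (r k) t\<close> is part of the conclusion, because it allows the limit to
  be identified.\<close>

lemma L1_summable_subsequence:
  fixes V :: "nat \<Rightarrow> real \<Rightarrow> 'w \<Rightarrow> 'b::{banach, second_countable_topology}" and h :: "nat \<Rightarrow> real \<Rightarrow> ennreal"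
  assumes I: "I \<in> sets borel"
    and N: "\<And>n. (\<lambda>(t, w). V n t w) \<in> borel_measurable N"
    and sect: "\<And>n t. t \<in> I \<Longrightarrow> V n t \<in> borel_measurable P"
    and h: "\<And>n. h n \<in> borel_measurable borel"
    and h0: "(\<lambda>n. \<integral>\<^sup>+t\<in>I. h n t \<partial>lborel) \<longlonglongrightarrow> 0"
    and bound: "AE t in lborel. t \<in> I \<longrightarrow> (\<forall>m n. (\<integral>\<^sup>+w. norm (V m t w - V n t w) \<partial>P) \<le> h m t + h n t)"
  obtains r W where "strict_mono r" "(\<lambda>(t, w). W t w) \<in> borel_measurable N"
    "AE t in lborel. t \<in> I \<longrightarrow> (\<lambda>k. h (r k) t) \<longlonglongrightarrow> 0 \<and>
       (\<lambda>k. \<integral>\<^sup>+w. norm (V (r k) t w - W t w) \<partial>P) \<longlonglongrightarrow> 0"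
proof -
  note [measurable] = I h
  have "\<exists>n>m. (\<integral>\<^sup>+t\<in>I. h n t \<partial>lborel) < ennreal ((1/2)^k)" for m k :: nat
  proof -
    have "\<forall>\<^sub>F n in sequentially. (\<integral>\<^sup>+t\<in>I. h n t \<partial>lborel) < ennreal ((1/2)^k)"
      by (rule order_tendstoD[OF h0]) simp
    moreover have "\<forall>\<^sub>F n in sequentially. n > m" by (rule eventually_gt_at_top)
    ultimately have "\<forall>\<^sub>F n in sequentially. n > m \<and> (\<integral>\<^sup>+t\<in>I. h n t \<partial>lborel) < ennreal ((1/2)^k)"
      by eventually_elim auto
    then show ?thesis by (auto simp: eventually_sequentially)
  qed
  then obtain c where c: "\<And>m k. c m k > (m::nat)" "\<And>m k. (\<integral>\<^sup>+t\<in>I. h (c m k) t \<partial>lborel) < ennreal ((1/2)^k)"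
    by metis
  \<comment> \<open>\<open>r k\<close> exceeds \<open>r (k - 1)\<close> and has time integral below
    \<open>(1/2)^k\<close>.\<close>
  define r where "r = rec_nat (c 0 0) (\<lambda>k m. c m (Suc k))"
  have r_Suc: "r (Suc k) = c (r k) (Suc k)" and r_0: "r 0 = c 0 0" for k by (simp_all add: r_def)
  have r: "strict_mono r" unfolding strict_mono_Suc_iff using c(1) by (simp add: r_Suc)
  have hr: "(\<integral>\<^sup>+t\<in>I. h (r k) t \<partial>lborel) \<le> ennreal ((1/2)^k)" for k
    by (cases k) (use c(2) in \<open>simp_all only: r_Suc r_0 less_imp_le\<close>)
  have "(\<integral>\<^sup>+t. (\<Sum>k. h (r k) t * indicator I t) \<partial>lborel) = (\<Sum>k. \<integral>\<^sup>+t\<in>I. h (r k) t \<partial>lborel)"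
    by (rule nn_integral_suminf) measurable
  also have "\<dots> \<le> (\<Sum>k. ennreal ((1/2)^k))" by (intro suminf_le hr) auto
  also have "\<dots> = ennreal (\<Sum>k. (1/2)^k)" by (intro suminf_ennreal2) (auto intro: summable_geometric)
  also have "\<dots> < \<infinity>" by simp
  finally have fin: "(\<integral>\<^sup>+t. (\<Sum>k. h (r k) t * indicator I t) \<partial>lborel) \<noteq> \<infinity>" by simp
  have AE_sum: "AE t in lborel. (\<Sum>k. h (r k) t * indicator I t) \<noteq> \<infinity>"
    by (rule nn_integral_PInf_AE[OF _ fin]) measurable
  \<comment> \<open>Taking \<open>lim\<close> at every \<open>(t, w)\<close>, also where the
    sequence diverges, preserves measurability for \<open>N\<close> without removing any null
    set.\<close>
  define W where "W t w = lim (\<lambda>k. V (r k) t w)" for t w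
  have WN: "(\<lambda>(t, w). W t w) \<in> borel_measurable N"
  proof -
    have "(\<lambda>p. lim (\<lambda>k. (\<lambda>(t, w). V (r k) t w) p)) \<in> borel_measurable N"
      using N by (intro borel_measurable_lim_metric)
    then show ?thesis by (simp add: W_def case_prod_unfold)
  qed
  have "AE t in lborel. t \<in> I \<longrightarrow> (\<lambda>k. h (r k) t) \<longlonglongrightarrow> 0 \<and>
       (\<lambda>k. \<integral>\<^sup>+w. norm (V (r k) t w - W t w) \<partial>P) \<longlonglongrightarrow> 0"
    using AE_sum bound
  proof eventually_elim
    case (elim t)
    show ?case
    proof
      assume t: "t \<in> I"
      have bd: "(\<integral>\<^sup>+w. norm (V m t w - V n t w) \<partial>P) \<le> h m t + h n t" for m n using elim t by auto
      have sm: "(\<Sum>k. h (r k) t) \<noteq> \<infinity>" using elim t by simp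
      have [measurable]: "V n t \<in> borel_measurable P" for n using sect[OF t] .
      have [measurable]: "W t \<in> borel_measurable P" unfolding W_def by (intro borel_measurable_lim_metric) measurable
      have hfin: "h (r k) t < \<infinity>" for k
      proof -
        have "h (r k) t = (\<Sum>j\<in>{k}. h (r j) t)" by simp
        also have "\<dots> \<le> (\<Sum>j. h (r j) t)" by (intro sum_le_suminf summableI) auto
        also have "\<dots> < \<infinity>" using sm by (simp add: less_top)
        finally show ?thesis .
      qed
      have hlim: "(\<lambda>k. h (r k) t) \<longlonglongrightarrow> 0"
      proof -
        define H where "H k = enn2real (h (r k) t)" for k
        have H: "h (r k) t = ennreal (H k)" "0 \<le> H k" for k using hfin[of k] by (auto simp: H_def)
        have "summable H" using sm H by (intro summable_suminf_not_top) (auto simp: top_unique)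
        then have "H \<longlonglongrightarrow> 0" by (rule summable_LIMSEQ_zero)
        then have "(\<lambda>k. ennreal (H k)) \<longlonglongrightarrow> ennreal 0" by (rule tendsto_ennrealI)
        then show ?thesis by (simp add: H)
      qed
      let ?d = "\<lambda>k w. V (r (Suc k)) t w - V (r k) t w" and ?D = "\<lambda>k. \<integral>\<^sup>+w. norm (V (r k) t w - W t w) \<partial>P"
      have "(\<integral>\<^sup>+w. (\<Sum>k. ennreal (norm (?d k w))) \<partial>P) =
          (\<Sum>k. \<integral>\<^sup>+w. norm (?d k w) \<partial>P)"
        by (rule nn_integral_suminf) measurable
      also have "\<dots> \<le> (\<Sum>k. h (r (Suc k)) t + h (r k) t)"
        by (intro suminf_le bd) auto
      also have "\<dots> = (\<Sum>k. h (r (Suc k)) t) + (\<Sum>k. h (r k) t)" by (rule suminf_add[symmetric]) auto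
      also have "\<dots> \<le> (\<Sum>k. h (r k) t) + (\<Sum>k. h (r k) t)"
      proof (intro add_right_mono suminf_le_const summableI)
        fix n
        have "(\<Sum>k<n. h (r (Suc k)) t) \<le> (\<Sum>k<Suc n. h (r k) t)"
          by (simp only: sum.lessThan_Suc_shift) simp
        also have "\<dots> \<le> (\<Sum>k. h (r k) t)" by (intro sum_le_suminf summableI) auto
        finally show "(\<Sum>k<n. h (r (Suc k)) t) \<le> (\<Sum>k. h (r k) t)" .
      qed
      also have "\<dots> < \<infinity>" using sm by (simp add: less_top)
      finally have fin2: "(\<integral>\<^sup>+w. (\<Sum>k. ennreal (norm (?d k w))) \<partial>P) \<noteq> \<infinity>" by simp
      have AE_conv: "AE w in P. (\<lambda>k. V (r k) t w) \<longlonglongrightarrow> W t w"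
      proof -
        have "AE w in P. (\<Sum>k. ennreal (norm (?d k w))) \<noteq> \<infinity>"
          by (rule nn_integral_PInf_AE[OF _ fin2]) measurable
        then show ?thesis
        proof eventually_elim
          case (elim w)
          then have "summable (\<lambda>k. norm (?d k w))"
            by (intro summable_suminf_not_top) (auto simp: top_unique)
          then have "summable (\<lambda>k. ?d k w)" by (rule summable_norm_cancel)
          then have "convergent (\<lambda>n. \<Sum>k<n. ?d k w)" by (simp add: summable_iff_convergent)
          then have "convergent (\<lambda>n. V (r n) t w - V (r 0) t w)" by (simp only: sum_lessThan_telescope[of "\<lambda>k. V (r k) t w"])
          then have "convergent (\<lambda>n. V (r n) t w - V (r 0) t w + V (r 0) t w)"
            by (intro convergent_add convergent_const)
          then show ?case by (simp add: W_def convergent_LIMSEQ_iff)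
        qed
      qed
      \<comment> \<open>Fatou in the second index of the assumed bound turns almost sure convergence
        into a rate in \<open>L^1\<close>.\<close>
      have le: "?D k \<le> h (r k) t" for k
      proof -
        have "?D k =
            (\<integral>\<^sup>+w. liminf (\<lambda>j. ennreal (norm (V (r k) t w - V (r j) t w))) \<partial>P)"
        proof (rule nn_integral_cong_AE, use AE_conv in eventually_elim)
          case (elim w)
          have "(\<lambda>j. ennreal (norm (V (r k) t w - V (r j) t w))) \<longlonglongrightarrow> ennreal (norm (V (r k) t w - W t w))"
            by (intro tendsto_ennrealI tendsto_intros elim)
          from lim_imp_Liminf[OF _ this] show ?case by simp
        qed
        also have "\<dots> \<le> liminf (\<lambda>j. \<integral>\<^sup>+w. norm (V (r k) t w - V (r j) t w) \<partial>P)"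
          by (rule nn_integral_liminf) measurable
        also have "\<dots> \<le> liminf (\<lambda>j. h (r k) t + h (r j) t)" by (intro Liminf_mono always_eventually allI bd)
        also have "\<dots> = h (r k) t + 0"
          by (intro lim_imp_Liminf tendsto_add tendsto_const hlim) simp
        finally show ?thesis by simp
      qed
      have "(\<lambda>k. ?D k) \<longlonglongrightarrow> 0"
        by (rule tendsto_sandwich[OF _ _ tendsto_const hlim]) (auto intro!: always_eventually le)
      with hlim show "(\<lambda>k. h (r k) t) \<longlonglongrightarrow> 0 \<and> (\<lambda>k. ?D k) \<longlonglongrightarrow> 0" by simp
    qed
  qed
  with r WN show ?thesis by (rule that)
qed

end

section \<open>Existence of optional projections\<close>

lemma is_cond_exp_cong:
  assumes "\<And>w. w \<in> space P \<Longrightarrow> f w = f' w"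
  shows "is_cond_exp P G f g \<longleftrightarrow> is_cond_exp P G f' g"
proof -
  have "integrable P f \<longleftrightarrow> integrable P f'"
    by (rule Bochner_Integration.integrable_cong[OF refl assms])
  moreover have "(LINT w:A|P. f w) = (LINT w:A|P. f' w)" for A
    unfolding set_lebesgue_integral_def using assms by (intro Bochner_Integration.integral_cong) auto
  ultimately show ?thesis by (simp add: is_cond_exp_def)
qed

lemma nn_integral_norm_triangle:
  fixes f g h :: "'a \<Rightarrow> 'b::{real_normed_vector, second_countable_topology}"
  assumes [measurable]: "f \<in> borel_measurable M" "g \<in> borel_measurable M" "h \<in> borel_measurable M"
  shows "(\<integral>\<^sup>+x. norm (f x - h x) \<partial>M) \<le> (\<integral>\<^sup>+x. norm (f x - g x) \<partial>M) + (\<integral>\<^sup>+x. norm (h x - g x) \<partial>M)"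
proof -
  have "(\<integral>\<^sup>+x. norm (f x - h x) \<partial>M) \<le> (\<integral>\<^sup>+x. ennreal (norm (f x - g x)) + ennreal (norm (h x - g x)) \<partial>M)"
  proof (rule nn_integral_mono)
    fix x
    have "norm (f x - h x) \<le> norm (f x - g x) + norm (h x - g x)"
      using norm_triangle_ineq4[of "f x - g x" "h x - g x"] by simp
    then show "ennreal (norm (f x - h x)) \<le> ennreal (norm (f x - g x)) + ennreal (norm (h x - g x))"
      by (simp add: ennreal_plus[symmetric] del: ennreal_plus)
  qed
  also have "\<dots> = (\<integral>\<^sup>+x. norm (f x - g x) \<partial>M) + (\<integral>\<^sup>+x. norm (h x - g x) \<partial>M)"
    by (rule nn_integral_add) auto
  finally show ?thesis .
qed

section \<open>Discretisation of time\<close>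

text \<open>Rounding is downward, so that a variable measurable for
  \<open>F (floor_time n t)\<close> is measurable for \<open>F t\<close>, and the step functions are
  right continuous.\<close>

definition floor_time :: "nat \<Rightarrow> real \<Rightarrow> real" where
  "floor_time n t = real_of_int \<lfloor>real (Suc n) * t\<rfloor> / real (Suc n)"

lemma floor_time_le: "floor_time n t \<le> t"
  unfolding floor_time_def by (subst pos_divide_le_eq) (auto simp: mult.commute)

lemma floor_time_tendsto: "(\<lambda>n. floor_time n t) \<longlonglongrightarrow> t"
proof (rule tendsto_sandwich[OF _ _ _ tendsto_const])
  have "t - 1 / real (Suc n) \<le> floor_time n t" for n
  proof -
    have "t - 1 / real (Suc n) = (real (Suc n) * t - 1) / real (Suc n)" by (simp add: diff_divide_distrib)
    also have "\<dots> \<le> floor_time n t"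
      unfolding floor_time_def by (intro divide_right_mono) linarith+
    finally show ?thesis .
  qed
  then show "\<forall>\<^sub>F n in sequentially. t - 1 / real (Suc n) \<le> floor_time n t" by simp
  show "\<forall>\<^sub>F n in sequentially. floor_time n t \<le> t" by (simp add: floor_time_le)
  show "(\<lambda>n. t - 1 / real (Suc n)) \<longlonglongrightarrow> t"
    using tendsto_diff[OF tendsto_const LIMSEQ_Suc[OF lim_1_over_n], of t] by simp
qed

lemma floor_time_right: "\<forall>\<^sub>F s in at t within S \<inter> {t<..}. floor_time n s = floor_time n t"
proof -
  let ?k = "real (Suc n)"
  let ?u = "(real_of_int \<lfloor>?k * t\<rfloor> + 1) / ?k"
  have "t < ?u" by (subst pos_less_divide_eq) (auto simp: mult.commute)
  then have "0 < ?u - t" by simp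
  moreover have "floor_time n s = floor_time n t" if "t < s" "s < ?u" for s
  proof -
    have "?k * s < real_of_int \<lfloor>?k * t\<rfloor> + 1" using that(2) by (subst (asm) pos_less_divide_eq) (auto simp: mult.commute)
    moreover have "?k * t \<le> ?k * s" using that by (intro mult_left_mono) auto
    ultimately have "\<lfloor>?k * s\<rfloor> = \<lfloor>?k * t\<rfloor>" by (intro floor_unique) linarith+
    then show ?thesis by (simp add: floor_time_def)
  qed
  ultimately show ?thesis
    unfolding eventually_at by (intro exI[of _ "?u - t"]) (auto simp: dist_real_def)
qed

text \<open>The left limit needs the ceiling minus one: at a grid point \<open>t\<close> the
  preceding value is one step lower than \<open>floor_time n t\<close>.\<close>

lemma floor_time_left:
  "\<forall>\<^sub>F s in at t within S \<inter> {..<t}. floor_time n s = (real_of_int \<lceil>real (Suc n) * t\<rceil> - 1) / real (Suc n)"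
proof -
  let ?k = "real (Suc n)"
  let ?u = "(real_of_int \<lceil>?k * t\<rceil> - 1) / ?k"
  have "?u < t" by (subst pos_divide_less_eq) (auto simp: mult.commute, linarith)
  then have "0 < t - ?u" by simp
  moreover have "floor_time n s = ?u" if "s < t" "?u < s" for s
  proof -
    have "real_of_int \<lceil>?k * t\<rceil> - 1 < ?k * s" using that(2) by (subst (asm) pos_divide_less_eq) (auto simp: mult.commute)
    moreover have "?k * s < ?k * t" using that by (intro mult_strict_left_mono) auto
    ultimately have "\<lfloor>?k * s\<rfloor> = \<lceil>?k * t\<rceil> - 1" by (intro floor_unique) (simp, linarith+)
    then show ?thesis by (simp add: floor_time_def)
  qed
  ultimately show ?thesis
    unfolding eventually_at by (intro exI[of _ "t - ?u"]) (auto simp: dist_real_def)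
qed

context usual_filtered_prob_space
begin

lemma optional_section:
  fixes V :: "real \<Rightarrow> 'w \<Rightarrow> 'b::topological_space"
  assumes "optional T V" "t \<in> {0..T}"
  shows "V t \<in> borel_measurable (F t)" "V t \<in> borel_measurable P"
  using progressive_adapted[OF optional_progressive[OF assms(1)] assms(2)] measurable_F_P by auto

text \<open>The paths are locally constant on either side of each time, whatever the family
  \<open>p\<close>, so only measurability at the grid times matters.\<close>

lemma floor_time_cadlag:
  assumes p: "\<And>s. p s \<in> borel_measurable (F s)"
  shows "adapted_cadlag P F I (\<lambda>t. p (floor_time n t))"
  unfolding adapted_cadlag_def
proof (intro conjI ballI)
  fix t
  show "p (floor_time n t) \<in> borel_measurable (F t)"
    by (rule measurable_F_mono[OF floor_time_le p])
  fix w
  show "((\<lambda>s. p (floor_time n s) w) \<longlongrightarrow> p (floor_time n t) w) (at t within I \<inter> {t<..})"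
    by (rule tendsto_eventually, use floor_time_right[of n t I] in eventually_elim) simp
  show "\<exists>l. ((\<lambda>s. p (floor_time n s) w) \<longlongrightarrow> l) (at t within I \<inter> {..<t})"
    by (intro exI[of _ "p ((real_of_int \<lceil>real (Suc n) * t\<rceil> - 1) / real (Suc n)) w"] tendsto_eventually,
        use floor_time_left[of n t I] in eventually_elim) simp
qed

text \<open>For a constant process, the projections onto \<open>F (floor_time n t)\<close> are step processes. They
  converge in \<open>L\<^sup>2\<close> to the projection \<open>p t\<close> onto \<open>F t\<close> at all continuity points \<open>t\<close> of the increasing
  function \<open>t \<mapsto> E[(p t)\<^sup>2]\<close>, hence at almost every \<open>t\<close>.\<close>

lemma optional_projection_constant:
  assumes A: "A \<in> sets P"
  shows "\<exists>V. opt_proj T (\<lambda>t. indicator A :: 'w \<Rightarrow> real) V"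
proof -
  note [measurable] = A
  define p where "p s = real_cond_exp P (F s) (indicator A)" for s
  have iA: "integrable P (indicator A :: 'w \<Rightarrow> real)"
    by (intro integrable_const_bound[where B=1]) auto
  have ce: "is_cond_exp P (F s) (indicator A) (p s)" for s
    unfolding p_def by (rule is_cond_exp_real_cond_exp[OF prob_space_axioms subalgebra_F iA])
  have pF: "p s \<in> borel_measurable (F s)" and ip: "integrable P (p s)" for s
    using ce by (auto simp: is_cond_exp_def)
  have [measurable]: "p s \<in> borel_measurable P" for s using ip by auto
  \<comment> \<open>For \<open>s \<le> t\<close> the variable \<open>p s\<close> is measurable for
    \<open>F t\<close>, so \<open>p t\<close> may be replaced by the indicator. In particular,
    \<open>E[p s * p t] = E[(p s)^2]\<close>.\<close>
  have orth: "integrable P (\<lambda>w. p s w * p t w)" "(\<integral>w. p s w * p t w \<partial>P) = (\<integral>w. p s w * indicator A w \<partial>P)"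
    if "s \<le> t" for s t
  proof -
    interpret S: finite_measure_subalgebra P "F t" by standard (rule subalgebra_F)
    have "integrable P (\<lambda>w. p s w * indicator A w)"
      using integrable_mult_indicator[OF A ip[of s]] by (simp add: mult.commute)
    from S.real_cond_exp_intg[OF this measurable_F_mono[OF that pF]]
    show "integrable P (\<lambda>w. p s w * p t w)" "(\<integral>w. p s w * p t w \<partial>P) = (\<integral>w. p s w * indicator A w \<partial>P)"
      by (auto simp: p_def)
  qed
  let ?V = "\<lambda>n t. p (floor_time n t)"
  define g where "g s = (\<integral>w. (p s w)\<^sup>2 \<partial>P)" for s
  \<comment> \<open>Pythagoras for the orthogonal projections \<open>p s\<close> and
    \<open>p t\<close>.\<close>
  have g_diff: "(\<integral>w. (p t w - p s w)\<^sup>2 \<partial>P) = g t - g s" and g_int: "integrable P (\<lambda>w. (p t w - p s w)\<^sup>2)"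
    if "s \<le> t" for s t
  proof -
    have i: "integrable P (\<lambda>w. (p s w)\<^sup>2)" for s using orth(1)[of s s] by (simp add: power2_eq_square)
    have eq: "(p t w - p s w)\<^sup>2 = (p t w)\<^sup>2 - 2 * (p s w * p t w) + (p s w)\<^sup>2" for w
      by (simp add: power2_diff)
    show "integrable P (\<lambda>w. (p t w - p s w)\<^sup>2)" unfolding eq using i orth(1)[OF that] by auto
    have "(\<integral>w. p s w * p t w \<partial>P) = g s"
      using orth(2)[OF that] orth(2)[of s s] by (simp add: g_def power2_eq_square)
    then show "(\<integral>w. (p t w - p s w)\<^sup>2 \<partial>P) = g t - g s"
      unfolding eq using i orth(1)[OF that] by (simp add: g_def)
  qed
  have g_mono: "mono g"
  proof (rule monoI)
    fix s t :: real assume "s \<le> t"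
    then show "g s \<le> g t" using g_diff[of s t] Bochner_Integration.integral_nonneg[of P "\<lambda>w. (p t w - p s w)\<^sup>2"] by simp
  qed
  have [measurable]: "g \<in> borel_measurable borel" using g_mono by (rule borel_measurable_mono)
  have g0: "0 \<le> g s" for s by (simp add: g_def)
  have g1: "g s \<le> 1" for s
  proof -
    have "g s = (\<integral>w. p s w * indicator A w \<partial>P)" using orth(2)[of s s] by (simp add: g_def power2_eq_square)
    also have "\<dots> \<le> (\<integral>w. norm (p s w) \<partial>P)"
      using ip[of s] integrable_mult_indicator[OF A ip[of s]]
      by (intro integral_mono) (auto simp: mult.commute indicator_def)
    also have "\<dots> \<le> 1"
    proof -
      have "ennreal (\<integral>w. norm (p s w) \<partial>P) = (\<integral>\<^sup>+w. norm (p s w) \<partial>P)"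
        using ip[of s] by (simp add: nn_integral_eq_integral)
      also have "\<dots> \<le> (\<integral>\<^sup>+w. norm (indicator A w :: real) \<partial>P)"
        by (rule is_cond_exp_L1[OF prob_space_axioms subalgebra_F ce])
      also have "\<dots> \<le> (\<integral>\<^sup>+w. 1 \<partial>P)" by (intro nn_integral_mono) (auto simp: indicator_def)
      also have "\<dots> = ennreal 1" by (simp add: emeasure_space_1)
      finally show ?thesis by (subst (asm) ennreal_le_iff) auto
    qed
    finally show ?thesis .
  qed
  \<comment> \<open>The square root converts the \<open>L^2\<close> distance into a bound for the
    \<open>L^1\<close> distance, by nonnegativity of the variance. Since \<open>g\<close> takes
    values between \<open>0\<close> and \<open>1\<close>, \<open>h\<close> is at most
    \<open>1\<close> and dominated convergence applies in time.\<close>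
  define h where "h n t = ennreal (sqrt (g t - g (floor_time n t)))" for n t
  have fm[measurable]: "floor_time n \<in> borel_measurable borel" for n
    unfolding floor_time_def by measurable
  have hm[measurable]: "h n \<in> borel_measurable borel" for n unfolding h_def by measurable
  have Vh: "(\<integral>\<^sup>+w. norm (?V n t w - p t w) \<partial>P) \<le> h n t" for n t
  proof -
    let ?d = "\<lambda>w. p t w - ?V n t w"
    have i2: "integrable P (\<lambda>w. (?d w)\<^sup>2)" using g_int[OF floor_time_le] .
    have i1: "integrable P (\<lambda>w. norm (?d w))" using ip by auto
    have "(\<integral>w. norm (?d w) \<partial>P)\<^sup>2 \<le> (\<integral>w. (norm (?d w))\<^sup>2 \<partial>P)"
      using variance_eq[of "\<lambda>w. norm (?d w)"] i1 i2 variance_positive[of "\<lambda>w. norm (?d w)"] by simp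
    also have "\<dots> = g t - g (floor_time n t)" using g_diff[OF floor_time_le[of n t]] by simp
    finally have "(\<integral>w. norm (?d w) \<partial>P) \<le> sqrt (g t - g (floor_time n t))" by (rule real_le_rsqrt)
    then show ?thesis
      unfolding h_def norm_minus_commute[of "?V n t _"]
      using i1 by (subst nn_integral_eq_integral) (auto intro: ennreal_leI)
  qed
  have h0: "(\<lambda>n. \<integral>\<^sup>+t\<in>{0..T}. h n t \<partial>lborel) \<longlonglongrightarrow> 0"
  proof -
    have "(\<lambda>n. \<integral>\<^sup>+t. h n t * indicator {0..T} t \<partial>lborel) \<longlonglongrightarrow> (\<integral>\<^sup>+(t::real). 0 \<partial>lborel)"
    proof (rule nn_integral_dominated_convergence[where w="indicator {0..T}"])
      show "AE t in lborel. h n t * indicator {0..T} t \<le> indicator {0..T} t" for n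
      proof (rule AE_I2)
        fix t
        have "sqrt (g t - g (floor_time n t)) \<le> 1" using g0[of "floor_time n t"] g1[of t] by simp
        then show "h n t * indicator {0..T} t \<le> indicator {0..T} t"
          by (auto simp: h_def indicator_def)
      qed
      \<comment> \<open>A monotone function has only countably many discontinuities.\<close>
      have "AE t in lborel. t \<notin> {t. \<not> isCont g t}"
        using mono_ctble_discont[OF g_mono] by (intro AE_not_in countable_imp_null_set_lborel)
      then show "AE t in lborel. (\<lambda>n. h n t * indicator {0..T} t) \<longlonglongrightarrow> 0"
      proof eventually_elim
        case (elim t)
        then have "(\<lambda>n. g (floor_time n t)) \<longlonglongrightarrow> g t"
          using isCont_tendsto_compose[OF _ floor_time_tendsto] by auto
        then have "(\<lambda>n. h n t) \<longlonglongrightarrow> ennreal (sqrt (g t - g t))"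
          unfolding h_def by (intro tendsto_ennrealI tendsto_intros)
        then have "(\<lambda>n. h n t) \<longlonglongrightarrow> 0" by simp
        then show ?case by (cases "t \<in> {0..T}") auto
      qed
    qed (auto simp: emeasure_lborel_Icc_eq)
    then show ?thesis by simp
  qed
  obtain r W where r: "strict_mono r" and W: "optional T W"
    and lim: "AE t in lborel. t \<in> {0..T} \<longrightarrow> (\<lambda>k. h (r k) t) \<longlonglongrightarrow> 0 \<and>
       (\<lambda>k. \<integral>\<^sup>+w. norm (?V (r k) t w - W t w) \<partial>P) \<longlonglongrightarrow> 0"
  proof (rule L1_summable_subsequence[where V="\<lambda>n t. ?V n t" and h=h and I="{0..T}" and N="optional_algebra P F {0..T}"])
    show "(\<lambda>(t, w). ?V n t w) \<in> borel_measurable (optional_algebra P F {0..T})" for n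
      by (intro adapted_cadlag_optional floor_time_cadlag pF)
    show "AE t in lborel. t \<in> {0..T} \<longrightarrow> (\<forall>m n. (\<integral>\<^sup>+w. norm (?V m t w - ?V n t w) \<partial>P) \<le> h m t + h n t)"
    proof (intro AE_I2 impI allI)
      fix t m n
      have "(\<integral>\<^sup>+w. norm (?V m t w - ?V n t w) \<partial>P) \<le>
        (\<integral>\<^sup>+w. norm (?V m t w - p t w) \<partial>P) + (\<integral>\<^sup>+w. norm (?V n t w - p t w) \<partial>P)"
        by (rule nn_integral_norm_triangle) measurable
      also have "\<dots> \<le> h m t + h n t" by (intro add_mono Vh)
      finally show "(\<integral>\<^sup>+w. norm (?V m t w - ?V n t w) \<partial>P) \<le> h m t + h n t" .
    qed
  qed (use hm h0 in auto)
  have "AE t in lborel. t \<in> {0..T} \<longrightarrow> is_cond_exp P (F t) (indicator A) (W t)"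
    using lim
  proof eventually_elim
    case (elim t)
    show ?case
    proof
      assume t: "t \<in> {0..T}"
      with elim have hl: "(\<lambda>k. h (r k) t) \<longlonglongrightarrow> 0"
        and Wl: "(\<lambda>k. \<integral>\<^sup>+w. norm (?V (r k) t w - W t w) \<partial>P) \<longlonglongrightarrow> 0" by auto
      \<comment> \<open>Each step process is measurable for \<open>F t\<close>, hence its own
        conditional expectation. Its two \<open>L^1\<close> limits are \<open>p t\<close> and
        \<open>W t\<close>.\<close>
      have "is_cond_exp P (F t) (p t) (W t)"
      proof (rule is_cond_exp_L1_limit[OF prob_space_axioms subalgebra_F])
        show "is_cond_exp P (F t) (?V (r k) t) (?V (r k) t)" for k
          by (rule is_cond_exp_self[OF ip measurable_F_mono[OF floor_time_le pF]])
        show "(\<lambda>k. \<integral>\<^sup>+w. norm (?V (r k) t w - p t w) \<partial>P) \<longlonglongrightarrow> 0"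
          by (rule tendsto_sandwich[OF _ _ tendsto_const hl]) (intro always_eventually allI Vh zero_le)+
        show "W t \<in> borel_measurable (F t)" by (rule optional_section[OF W t])
      qed (fact ip Wl)+
      then show "is_cond_exp P (F t) (indicator A) (W t)"
        using ce[of t] by (auto simp: is_cond_exp_def)
    qed
  qed
  with W show ?thesis by (auto simp: is_optional_projection_def)
qed

section \<open>Closure properties of the class of processes with an optional projection\<close>

lemma optional_projection_add:
  fixes Y Y' V V' :: "real \<Rightarrow> 'w \<Rightarrow> 'b::{banach, second_countable_topology}"
  assumes "is_optional_projection P F I Y V" "is_optional_projection P F I Y' V'"
  shows "is_optional_projection P F I (\<lambda>t w. Y t w + Y' t w) (\<lambda>t w. V t w + V' t w)"
  unfolding is_optional_projection_def
proof
  show "(\<lambda>(t, w). V t w + V' t w) \<in> borel_measurable (optional_algebra P F I)"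
    using assms unfolding is_optional_projection_def case_prod_unfold by (intro borel_measurable_add) auto
  have "AE t in lborel. t \<in> I \<longrightarrow> is_cond_exp P (F t) (Y t) (V t)"
    "AE t in lborel. t \<in> I \<longrightarrow> is_cond_exp P (F t) (Y' t) (V' t)"
    using assms by (auto simp: is_optional_projection_def)
  then show "AE t in lborel. t \<in> I \<longrightarrow> is_cond_exp P (F t) (\<lambda>w. Y t w + Y' t w) (\<lambda>w. V t w + V' t w)"
    by eventually_elim (auto intro: is_cond_exp_add subalgebra_F)
qed

lemma optional_projection_scale:
  fixes Y V :: "real \<Rightarrow> 'w \<Rightarrow> real" and c :: "real \<Rightarrow> 'b::{banach, second_countable_topology}"
  assumes "is_optional_projection P F I Y V" and c: "c \<in> borel_measurable borel"
  shows "is_optional_projection P F I (\<lambda>t w. Y t w *\<^sub>R c t) (\<lambda>t w. V t w *\<^sub>R c t)"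
  unfolding is_optional_projection_def
proof
  have "(\<lambda>p. c (fst p)) \<in> borel_measurable (optional_algebra P F I)"
    using measurable_compose[OF optional_fst c, of P F I] by (simp add: case_prod_unfold)
  then show "(\<lambda>(t, w). V t w *\<^sub>R c t) \<in> borel_measurable (optional_algebra P F I)"
    using assms unfolding is_optional_projection_def case_prod_unfold by (intro borel_measurable_scaleR) auto
  have "AE t in lborel. t \<in> I \<longrightarrow> is_cond_exp P (F t) (Y t) (V t)"
    using assms by (auto simp: is_optional_projection_def)
  then show "AE t in lborel. t \<in> I \<longrightarrow> is_cond_exp P (F t) (\<lambda>w. Y t w *\<^sub>R c t) (\<lambda>w. V t w *\<^sub>R c t)"
    by eventually_elim (auto intro: is_cond_exp_scale[OF prob_space_axioms subalgebra_F])
qed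

lemma optional_projection_cong:
  assumes "is_optional_projection P F I Y V" "\<And>t w. t \<in> I \<Longrightarrow> w \<in> space P \<Longrightarrow> Y t w = Y' t w"
  shows "is_optional_projection P F I Y' V"
  using assms is_cond_exp_cong[of P "Y t" "Y' t" for t] unfolding is_optional_projection_def
  by (auto elim!: eventually_mono)

text \<open>Contractivity in \<open>L^1\<close> bounds \<open>V m t - V n t\<close> by the distances
  of \<open>Y m\<close> and \<open>Y n\<close> from \<open>Z\<close> at time \<open>t\<close>, that
  is by \<open>h m t + h n t\<close>. This is the input of \<open>L1_summable_subsequence\<close>,
  whose limit is then a conditional expectation of \<open>Z\<close> at almost every time.\<close>

lemma optional_projection_limit:
  fixes Y :: "nat \<Rightarrow> real \<times> 'w \<Rightarrow> 'b::{real_inner, banach, second_countable_topology}"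
  assumes Y[measurable]: "\<And>n. Y n \<in> borel_measurable dtP"
    and Z[measurable]: "Z \<in> borel_measurable dtP"
    and b[measurable]: "b \<in> borel_measurable dtP"
    and lim: "\<And>p. p \<in> space dtP \<Longrightarrow> (\<lambda>n. Y n p) \<longlonglongrightarrow> Z p"
    and bd: "\<And>n p. p \<in> space dtP \<Longrightarrow> norm (Y n p) \<le> b p"
    and fin: "(\<integral>\<^sup>+p. ennreal (b p) * indicator {0..T} (fst p) \<partial>dtP) < \<infinity>"
    and ex: "\<And>n. \<exists>V. opt_proj T (\<lambda>t w. Y n (t, w)) V"
  shows "\<exists>V. opt_proj T (\<lambda>t w. Z (t, w)) V"
proof -
  obtain V where V: "\<And>n. opt_proj T (\<lambda>t w. Y n (t, w)) (V n)" using ex by metis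
  have Vm: "optional T (V n)" for n using V by (auto simp: is_optional_projection_def)
  have ce: "AE t in lborel. \<forall>n. t \<in> {0..T} \<longrightarrow> is_cond_exp P (F t) (\<lambda>w. Y n (t, w)) (V n t)"
    using V unfolding AE_all_countable by (auto simp: is_optional_projection_def)
  have bdZ: "norm (Z p) \<le> b p" if "p \<in> space dtP" for p
    by (rule LIMSEQ_le_const2[OF tendsto_norm[OF lim[OF that]]]) (use bd that in auto)
  define h where "h n t = (\<integral>\<^sup>+w. norm (Y n (t, w) - Z (t, w)) \<partial>P)" for n t
  have hm: "h n \<in> borel_measurable borel" for n
    unfolding h_def measurable_lborel1[symmetric] by (rule borel_measurable_nn_integral) measurable
  let ?I = "\<lambda>p::real \<times> 'w. indicator {0..T} (fst p) :: ennreal"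
  have "(\<lambda>n. \<integral>\<^sup>+p. norm (Y n p - Z p) * ?I p \<partial>dtP) \<longlonglongrightarrow> (\<integral>\<^sup>+p. 0 \<partial>dtP)"
  proof (rule nn_integral_dominated_convergence[where w="\<lambda>p. 2 * (ennreal (b p) * ?I p)"])
    show "AE p in lborel \<Otimes>\<^sub>M P. norm (Y n p - Z p) * ?I p \<le> 2 * (ennreal (b p) * ?I p)" for n
    proof (rule AE_I2)
      fix p :: "real \<times> 'w" assume p: "p \<in> space dtP"
      have "norm (Y n p - Z p) \<le> 2 * b p" "0 \<le> b p"
        using norm_triangle_ineq4[of "Y n p" "Z p"] norm_ge_zero[of "Z p"] bd[OF p, of n] bdZ[OF p] by linarith+
      then have "ennreal (norm (Y n p - Z p)) \<le> 2 * ennreal (b p)"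
        by (metis ennreal_leI ennreal_mult'' ennreal_numeral)
      then show "norm (Y n p - Z p) * ?I p \<le> 2 * (ennreal (b p) * ?I p)"
        by (auto simp: indicator_def)
    qed
    show "(\<integral>\<^sup>+p. 2 * (ennreal (b p) * ?I p) \<partial>dtP) < \<infinity>"
      using fin by (subst nn_integral_cmult) (auto simp: ennreal_mult_less_top)
    show "AE p in lborel \<Otimes>\<^sub>M P. (\<lambda>n. norm (Y n p - Z p) * ?I p) \<longlonglongrightarrow> 0"
    proof (rule AE_I2)
      fix p :: "real \<times> 'w" assume p: "p \<in> space dtP"
      have "(\<lambda>n. ennreal (norm (Y n p - Z p))) \<longlonglongrightarrow> ennreal (norm (Z p - Z p))"
        by (intro tendsto_ennrealI tendsto_intros lim[OF p])
      then show "(\<lambda>n. norm (Y n p - Z p) * ?I p) \<longlonglongrightarrow> 0" by (cases "fst p \<in> {0..T}") auto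
    qed
  qed measurable
  moreover have "(\<integral>\<^sup>+p. norm (Y n p - Z p) * ?I p \<partial>dtP) = (\<integral>\<^sup>+t\<in>{0..T}. h n t \<partial>lborel)" for n
    by (subst nn_integral_fst[symmetric]) (auto simp: h_def nn_integral_multc)
  ultimately have h0: "(\<lambda>n. \<integral>\<^sup>+t\<in>{0..T}. h n t \<partial>lborel) \<longlonglongrightarrow> 0" by simp
  obtain r W where r: "strict_mono r" and W: "optional T W"
    and WL: "AE t in lborel. t \<in> {0..T} \<longrightarrow> (\<lambda>k. h (r k) t) \<longlonglongrightarrow> 0 \<and>
       (\<lambda>k. \<integral>\<^sup>+w. norm (V (r k) t w - W t w) \<partial>P) \<longlonglongrightarrow> 0"
  proof (rule L1_summable_subsequence[where V=V and h=h and I="{0..T}" and N="optional_algebra P F {0..T}"])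
    show "AE t in lborel. t \<in> {0..T} \<longrightarrow> (\<forall>m n. (\<integral>\<^sup>+w. norm (V m t w - V n t w) \<partial>P) \<le> h m t + h n t)"
      using ce
    proof eventually_elim
      case (elim t)
      show ?case
      proof (intro impI allI)
        fix m n assume t: "t \<in> {0..T}"
        have "is_cond_exp P (F t) (\<lambda>w. Y m (t, w) - Y n (t, w)) (\<lambda>w. V m t w - V n t w)"
          using elim t by (intro is_cond_exp_diff subalgebra_F) auto
        from is_cond_exp_L1[OF prob_space_axioms subalgebra_F this]
        have "(\<integral>\<^sup>+w. norm (V m t w - V n t w) \<partial>P) \<le> (\<integral>\<^sup>+w. norm (Y m (t, w) - Y n (t, w)) \<partial>P)" .
        also have "\<dots> \<le> h m t + h n t" unfolding h_def by (rule nn_integral_norm_triangle) measurable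
        finally show "(\<integral>\<^sup>+w. norm (V m t w - V n t w) \<partial>P) \<le> h m t + h n t" .
      qed
    qed
  qed (use hm h0 Vm optional_section[OF Vm] in auto)
  \<comment> \<open>This gives integrability of \<open>Z\<close> at almost every time, which a
    conditional expectation requires.\<close>
  have "AE t in lborel. (\<integral>\<^sup>+w. ennreal (b (t, w)) * indicator {0..T} t \<partial>P) \<noteq> \<infinity>"
  proof (rule nn_integral_PInf_AE)
    have "(\<lambda>p. ennreal (b p) * ?I p) \<in> borel_measurable dtP" by measurable
    from nn_integral_fst[OF this] fin
    show "(\<integral>\<^sup>+t. (\<integral>\<^sup>+w. ennreal (b (t, w)) * indicator {0..T} t \<partial>P) \<partial>lborel) \<noteq> \<infinity>" by simp
  qed measurable
  with ce WL have "AE t in lborel. t \<in> {0..T} \<longrightarrow> is_cond_exp P (F t) (\<lambda>w. Z (t, w)) (W t)"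
  proof eventually_elim
    case (elim t)
    show ?case
    proof
      assume t: "t \<in> {0..T}"
      show "is_cond_exp P (F t) (\<lambda>w. Z (t, w)) (W t)"
      proof (rule is_cond_exp_L1_limit[OF prob_space_axioms subalgebra_F])
        show "is_cond_exp P (F t) (\<lambda>w. Y (r k) (t, w)) (V (r k) t)" for k using elim t by auto
        have "(\<integral>\<^sup>+w. norm (Z (t, w)) \<partial>P) \<le> (\<integral>\<^sup>+w. ennreal (b (t, w)) \<partial>P)"
          by (intro nn_integral_mono ennreal_leI bdZ) (simp add: space_pair_measure)
        also have "\<dots> < \<infinity>" using elim t by (simp add: less_top)
        finally show "integrable P (\<lambda>w. Z (t, w))" by (intro integrableI_bounded) auto
        show "W t \<in> borel_measurable (F t)" by (rule optional_section[OF W t])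
        show "(\<lambda>k. \<integral>\<^sup>+w. norm (Y (r k) (t, w) - Z (t, w)) \<partial>P) \<longlonglongrightarrow> 0"
          "(\<lambda>k. \<integral>\<^sup>+w. norm (V (r k) t w - W t w) \<partial>P) \<longlonglongrightarrow> 0"
          using elim t by (auto simp: h_def)
      qed
    qed
  qed
  with W show ?thesis by (auto simp: is_optional_projection_def)
qed

text \<open>Dynkin's argument: a rectangle is a constant indicator scaled by a function of time, and
  rectangles are stable under intersection. Complements follow by linearity, disjoint unions by
  bounded limits.\<close>

lemma optional_projection_indicator:
  assumes "X \<in> sets dtP"
  shows "\<exists>V. opt_proj T (\<lambda>t w. indicator X (t, w) :: real) V"
proof -
  let ?G = "{a \<times> b |a b. a \<in> sets (lborel :: real measure) \<and> b \<in> sets P}"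
  let ?\<Omega> = "space (lborel :: real measure) \<times> space P"
  have rect: "\<exists>V. opt_proj T (\<lambda>t w. indicator (a \<times> b) (t, w) :: real) V"
    if ab: "a \<in> sets lborel" "b \<in> sets P" for a b
  proof -
    obtain V where "opt_proj T (\<lambda>t. indicator b :: 'w \<Rightarrow> real) V"
      using optional_projection_constant[OF ab(2)] by blast
    from optional_projection_scale[OF this, of "indicator a :: real \<Rightarrow> real"] ab(1)
    have "opt_proj T (\<lambda>t w. (indicator b w :: real) *\<^sub>R (indicator a t :: real)) (\<lambda>t w. V t w *\<^sub>R indicator a t)"
      by simp
    then have "opt_proj T (\<lambda>t w. indicator (a \<times> b) (t, w) :: real) (\<lambda>t w. V t w *\<^sub>R (indicator a t :: real))"
      by (rule optional_projection_cong) (auto simp: indicator_def)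
    then show ?thesis by blast
  qed
  have "Int_stable ?G" "?G \<subseteq> Pow ?\<Omega>" "X \<in> sigma_sets ?\<Omega> ?G"
    using assms Int_stable_pair_measure_generator[of lborel P] pair_measure_closed[of lborel P]
    by (auto simp: sets_pair_measure)
  then show ?thesis
  proof (induction rule: sigma_sets_induct_disjoint)
    case (basic A)
    then show ?case using rect by auto
  next
    case empty
    show ?case using rect[of "{}" "{}"] by simp
  next
    case (compl A)
    obtain V where V: "opt_proj T (\<lambda>t w. indicator A (t, w) :: real) V"
      using compl by blast
    obtain U where U: "opt_proj T (\<lambda>t w. indicator (UNIV \<times> space P) (t, w) :: real) U"
      using rect[of UNIV "space P"] by auto
    have "opt_proj T (\<lambda>t w. indicator (UNIV \<times> space P) (t, w) + indicator A (t, w) *\<^sub>R (- 1 :: real))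
        (\<lambda>t w. U t w + V t w *\<^sub>R (- 1))"
      by (intro optional_projection_add U optional_projection_scale V) simp
    then have "opt_proj T (\<lambda>t w. indicator (?\<Omega> - A) (t, w) :: real) (\<lambda>t w. U t w + V t w *\<^sub>R (- 1))"
      by (rule optional_projection_cong) (auto simp: indicator_def)
    then show ?case by blast
  next
    case (union A)
    have Am: "A i \<in> sets dtP" for i using union(2) by (auto simp: sets_pair_measure)
    have s: "(\<lambda>i. indicator (A i) x :: real) sums indicator (\<Union>i. A i) x" for x
      by (rule indicator_sums) (use union(1) in \<open>auto simp: disjoint_family_on_def\<close>)
    show ?case
    \<comment> \<open>Disjointness bounds the partial sums by \<open>1\<close>, which is integrable
      over the bounded time interval.\<close>
    proof (rule optional_projection_limit[where Y="\<lambda>n p. \<Sum>i<n. indicator (A i) p" and b="\<lambda>p. 1"])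
      show "(\<lambda>p. \<Sum>i<n. indicator (A i) p :: real) \<in> borel_measurable dtP" for n
        using Am by simp
      have "(\<Union>i. A i) \<in> sets dtP" using Am by auto
      then show "indicator (\<Union>i. A i) \<in> borel_measurable dtP" by simp
      show "(\<lambda>n. \<Sum>i<n. indicator (A i) p :: real) \<longlonglongrightarrow> indicator (\<Union>i. A i) p" for p
        using s[of p] by (simp add: sums_def)
      show "norm (\<Sum>i<n. indicator (A i) p :: real) \<le> 1" for n p
      proof -
        have "(\<Sum>i<n. indicator (A i) p :: real) \<le> indicator (\<Union>i. A i) p"
          using sum_le_suminf[OF sums_summable[OF s], of "{..<n}" p] sums_unique[OF s, of p] by simp
        also have "\<dots> \<le> 1" by (simp add: indicator_def)
        finally show ?thesis by (simp add: sum_nonneg)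
      qed
      have "(\<lambda>p. ennreal 1 * indicator {0..T} (fst p)) \<in> borel_measurable dtP" by measurable
      from nn_integral_fst[OF this, symmetric]
      show "(\<integral>\<^sup>+p. ennreal 1 * indicator {0..T} (fst p) \<partial>dtP) < \<infinity>"
        by (simp add: emeasure_space_1 emeasure_lborel_Icc_eq)
      show "\<exists>V. opt_proj T (\<lambda>t w. \<Sum>i<n. indicator (A i) (t, w) :: real) V" for n
      proof (induction n)
        case 0
        then show ?case using rect[of "{}" "{}"] by simp
      next
        case (Suc n)
        then show ?case using union(3)[of n] optional_projection_add[of "{0..T}"] by simp blast
      qed
    qed simp
  qed
qed

text \<open>The induction principle for Bochner integrable functions supplies approximations bounded
  by \<open>2 * norm (f p)\<close>, which is the majorant that the limit lemma asks for.\<close>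

lemma optional_projection_exists:
  fixes Y :: "real \<times> 'w \<Rightarrow> 'b::{real_inner, banach, second_countable_topology}"
  assumes "integrable dtP Y"
  shows "\<exists>V. opt_proj T (\<lambda>t w. Y (t, w)) V"
  using assms
proof (induction rule: integrable_induct)
  case (base A c)
  then obtain V where "opt_proj T (\<lambda>t w. indicator A (t, w) :: real) V"
    using optional_projection_indicator by blast
  from optional_projection_scale[OF this, of "\<lambda>_. c"] show ?case by auto
next
  case (add f g)
  then show ?case using optional_projection_add[of "{0..T}"] by blast
next
  case (lim f s)
  have [measurable]: "f \<in> borel_measurable dtP" using lim by auto
  show ?case
  proof (rule optional_projection_limit[where Y=s and b="\<lambda>p. 2 * norm (f p)"])
    have "(\<integral>\<^sup>+p. ennreal (2 * norm (f p)) * indicator {0..T} (fst p) \<partial>dtP) \<le>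
        (\<integral>\<^sup>+p. ennreal (2 * norm (f p)) \<partial>dtP)"
      by (intro nn_integral_mono) (auto simp: indicator_def)
    also have "\<dots> < \<infinity>"
      using integrableD(2)[of dtP "\<lambda>p. 2 * norm (f p)"] lim by (auto simp: less_top)
    finally show "(\<integral>\<^sup>+p. ennreal (2 * norm (f p)) * indicator {0..T} (fst p) \<partial>dtP) < \<infinity>" .
  qed (use lim in auto)
qed

end

section \<open>Adaptedness of parameter integrals\<close>

context usual_filtered_prob_space
begin

lemma null_sets_F_all: "N \<in> null_sets P \<Longrightarrow> N \<in> sets (F t)"
  using null_sets_F sets_F_mono[of 0 t] negative_F[of t] by (cases "t < 0") auto

text \<open>The part of the preimage inside the exceptional set is a null set by completeness, and
  \<open>F t\<close> contains all null sets.\<close>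

lemma measurable_F_AE_eq:
  assumes g: "g \<in> F t \<rightarrow>\<^sub>M N" and f: "f \<in> space P \<rightarrow> space N" and eq: "AE w in P. f w = g w"
  shows "f \<in> F t \<rightarrow>\<^sub>M N"
proof (rule measurableI)
  fix w assume "w \<in> space (F t)" then show "f w \<in> space N" using f by (auto simp: space_F)
next
  fix B assume B: "B \<in> sets N"
  from eq obtain X where X: "X \<in> null_sets P" "{w\<in>space P. f w \<noteq> g w} \<subseteq> X" by (auto elim!: AE_E)
  have "f -` B \<inter> X \<in> null_sets P"
    by (rule complete2[OF Int_lower2 X(1)])
  from sets.Int[OF null_sets_F_all[OF this, of t] sets.top[of "F t"]]
  have "f -` B \<inter> X \<inter> space P \<in> sets (F t)" unfolding space_F .
  moreover have "g -` B \<inter> space (F t) - X \<in> sets (F t)"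
    using measurable_sets[OF g B] null_sets_F_all[OF X(1)] by auto
  ultimately have "(g -` B \<inter> space (F t) - X) \<union> (f -` B \<inter> X \<inter> space P) \<in> sets (F t)" by auto
  also have "(g -` B \<inter> space (F t) - X) \<union> (f -` B \<inter> X \<inter> space P) = f -` B \<inter> space (F t)"
    using X(2) by (auto simp: space_F)
  finally show "f -` B \<inter> space (F t) \<in> sets (F t)" .
qed

text \<open>By Fubini, \<open>\<xi> = \<integral> X s\<close> satisfies \<open>E[\<xi> 1\<^sub>A] = E[\<xi> P(A|F t)] = E[E[\<xi>|F t] 1\<^sub>A]\<close> for every event \<open>A\<close>,
  so that \<open>\<xi> = E[\<xi>|F t]\<close> almost surely.\<close>

lemma integral_adapted_real:
  fixes X :: "'a \<Rightarrow> 'w \<Rightarrow> real"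
  assumes M: "sigma_finite_measure M"
    and X: "integrable (M \<Otimes>\<^sub>M P) (\<lambda>(s, w). X s w)"
    and XF: "\<And>s. s \<in> space M \<Longrightarrow> X s \<in> borel_measurable (F t)"
  shows "(\<lambda>w. \<integral>s. X s w \<partial>M) \<in> borel_measurable (F t)"
proof -
  interpret M: sigma_finite_measure M by fact
  interpret MP: pair_sigma_finite M P ..
  interpret S: finite_measure_subalgebra P "F t" by standard (rule subalgebra_F)
  have Xm[measurable]: "(\<lambda>(s, w). X s w) \<in> borel_measurable (M \<Otimes>\<^sub>M P)" using X by auto
  define \<xi> where "\<xi> w = (\<integral>s. X s w \<partial>M)" for w
  have i\<xi>: "integrable P \<xi>" unfolding \<xi>_def using MP.integrable_snd[OF X] by simp
  define c where "c = real_cond_exp P (F t) \<xi>"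
  have cF: "c \<in> borel_measurable (F t)" and ic: "integrable P c" using i\<xi> by (auto simp: c_def)
  have "(LINT w:A|P. \<xi> w) = (LINT w:A|P. c w)" if A[measurable]: "A \<in> sets P" for A
  proof -
    define pA where "pA = real_cond_exp P (F t) (indicator A)"
    \<comment> \<open>A version of the conditional probability of \<open>A\<close> that lies in
      \<open>[0,1]\<close> everywhere, so that products with it are dominated by the other
      factor.\<close>
    define q where "q w = max 0 (min 1 (pA w))" for w
    have iA: "integrable P (indicator A :: 'w \<Rightarrow> real)" by (intro integrable_const_bound[where B=1]) auto
    have pF: "pA \<in> borel_measurable (F t)" by (simp add: pA_def)
    have qF: "q \<in> borel_measurable (F t)" unfolding q_def using pF by measurable
    have [measurable]: "pA \<in> borel_measurable P" "q \<in> borel_measurable P" using measurable_F_P pF qF by auto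
    have "AE w in P. pA w \<ge> 0" "AE w in P. pA w \<le> 1"
      unfolding pA_def using S.real_cond_exp_ge_c[OF iA, of 0] S.real_cond_exp_le_c[OF iA, of 1]
      by (auto simp: indicator_def)
    then have pq: "AE w in P. pA w = q w" by eventually_elim (auto simp: q_def)
    \<comment> \<open>Fubini is used only for multipliers bounded by \<open>1\<close>, for which the
      integrability of \<open>X\<close> suffices.\<close>
    have swap: "(\<integral>w. \<xi> w * b w \<partial>P) = (\<integral>s. (\<integral>w. X s w * b w \<partial>P) \<partial>M)"
      if [measurable]: "b \<in> borel_measurable P" and b1: "\<And>w. \<bar>b w\<bar> \<le> 1" for b
    proof -
      have "integrable (M \<Otimes>\<^sub>M P) (\<lambda>(s, w). X s w * b w)"
      proof (rule Bochner_Integration.integrable_bound[OF X])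
        have "norm (X s w * b w) \<le> norm (X s w)" for s w
          using mult_left_mono[OF b1[of w], of "\<bar>X s w\<bar>"] by (simp add: abs_mult)
        then show "AE p in M \<Otimes>\<^sub>M P. norm (case p of (s, w) \<Rightarrow> X s w * b w) \<le> norm (case p of (s, w) \<Rightarrow> X s w)"
          by (auto simp: case_prod_unfold)
      qed measurable
      from MP.Fubini_integral[OF this] show ?thesis by (simp add: \<xi>_def)
    qed
    have iX: "AE s in M. integrable P (X s)" using MP.AE_integrable_fst'[OF X] by simp
    have "(LINT w:A|P. \<xi> w) = (\<integral>w. \<xi> w * indicator A w \<partial>P)"
      by (simp add: set_lebesgue_integral_def mult.commute)
    also have "\<dots> = (\<integral>s. (\<integral>w. X s w * indicator A w \<partial>P) \<partial>M)" by (rule swap) (auto simp: indicator_def)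
    also have "\<dots> = (\<integral>s. (\<integral>w. X s w * q w \<partial>P) \<partial>M)"
    proof (rule integral_cong_AE)
      show "AE s in M. (\<integral>w. X s w * indicator A w \<partial>P) = (\<integral>w. X s w * q w \<partial>P)"
        using iX AE_space
      proof eventually_elim
        case (elim s)
        have "integrable P (\<lambda>w. X s w * indicator A w)"
          using integrable_mult_indicator[OF A elim(1)] by (simp add: mult.commute)
        from S.real_cond_exp_intg(2)[OF this XF[OF elim(2)]]
        have "(\<integral>w. X s w * indicator A w \<partial>P) = (\<integral>w. X s w * pA w \<partial>P)" by (simp add: pA_def)
        also have "\<dots> = (\<integral>w. X s w * q w \<partial>P)"
          using pq elim by (intro integral_cong_AE) auto
        finally show ?case .
      qed
    qed measurable
    also have "\<dots> = (\<integral>w. \<xi> w * q w \<partial>P)" by (rule swap[symmetric]) (auto simp: q_def)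
    also have "\<dots> = (\<integral>w. q w * \<xi> w \<partial>P)" by (simp add: mult.commute)
    also have "\<dots> = (\<integral>w. q w * c w \<partial>P)"
      unfolding c_def
    proof (rule S.real_cond_exp_intg(2)[symmetric, OF _ qF])
      show "integrable P (\<lambda>w. q w * \<xi> w)"
      proof (rule Bochner_Integration.integrable_bound[OF i\<xi>])
        have "norm (q w * \<xi> w) \<le> norm (\<xi> w)" for w
          using mult_right_mono[of "\<bar>q w\<bar>" 1 "\<bar>\<xi> w\<bar>"] by (simp add: abs_mult q_def)
        then show "AE w in P. norm (q w * \<xi> w) \<le> norm (\<xi> w)" by simp
      qed (use i\<xi> in auto)
    qed (use i\<xi> in auto)
    also have "\<dots> = (\<integral>w. c w * pA w \<partial>P)"
      using pq ic by (intro integral_cong_AE) auto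
    also have "\<dots> = (\<integral>w. c w * indicator A w \<partial>P)"
      unfolding pA_def
    proof (rule S.real_cond_exp_intg(2)[OF _ cF])
      show "integrable P (\<lambda>w. c w * indicator A w)"
        using integrable_mult_indicator[OF A ic] by (simp add: mult.commute)
    qed auto
    also have "\<dots> = (LINT w:A|P. c w)" by (simp add: set_lebesgue_integral_def mult.commute)
    finally show ?thesis .
  qed
  then have "AE w in P. \<xi> w = c w" using i\<xi> ic by (intro density_unique_real) auto
  from measurable_F_AE_eq[OF cF _ this] have "\<xi> \<in> borel_measurable (F t)" by simp
  then show ?thesis by (simp add: \<xi>_def[abs_def])
qed

text \<open>Weak measurability reduces the claim to real integrands. The inner product commutes with
  the integral only on the almost sure event where the integral converges, hence the passage through
  \<open>measurable_F_AE_eq\<close>.\<close>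

lemma integral_adapted:
  fixes X :: "'a \<Rightarrow> 'w \<Rightarrow> 'b::{real_inner, banach, second_countable_topology}"
  assumes M: "sigma_finite_measure M"
    and X: "integrable (M \<Otimes>\<^sub>M P) (\<lambda>(s, w). X s w)"
    and XF: "\<And>s. s \<in> space M \<Longrightarrow> X s \<in> borel_measurable (F t)"
  shows "(\<lambda>w. \<integral>s. X s w \<partial>M) \<in> borel_measurable (F t)"
proof (rule borel_measurable_weak)
  fix e
  interpret M: sigma_finite_measure M by fact
  interpret MP: pair_sigma_finite M P ..
  have "(\<lambda>w. \<integral>s. inner (X s w) e \<partial>M) \<in> borel_measurable (F t)"
  proof (rule integral_adapted_real[OF M])
    show "integrable (M \<Otimes>\<^sub>M P) (\<lambda>(s, w). inner (X s w) e)"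
      using integrable_inner_left[OF X, of e] by (simp add: case_prod_unfold)
    show "(\<lambda>w. inner (X s w) e) \<in> borel_measurable (F t)" if "s \<in> space M" for s
      by (rule borel_measurable_inner[OF XF[OF that] borel_measurable_const])
  qed
  then show "(\<lambda>w. inner (\<integral>s. X s w \<partial>M) e) \<in> borel_measurable (F t)"
  proof (rule measurable_F_AE_eq)
    show "AE w in P. inner (\<integral>s. X s w \<partial>M) e = (\<integral>s. inner (X s w) e \<partial>M)"
      using MP.AE_integrable_snd[OF X] by eventually_elim (simp add: integral_inner_left)
  qed simp
qed

end

section \<open>Pathwise estimates for delay kernels\<close>

text \<open>A crude form of Young's inequality, from which only finiteness is drawn.\<close>

lemma ennreal_mult_le_squares: "x * y \<le> x\<^sup>2 + y\<^sup>2" for x y :: ennreal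
proof (cases "x \<le> y")
  case True
  then have "x * y \<le> y * y" by (rule mult_right_mono) simp
  then show ?thesis by (simp add: power2_eq_square add_increasing)
next
  case False
  then have "x * y \<le> x * x" by (intro mult_left_mono) auto
  then show ?thesis by (simp add: power2_eq_square add_increasing2)
qed

text \<open>The weight is split evenly: Cauchy--Schwarz is applied to \<open>sqrt (a x)\<close> and
  \<open>sqrt (a x) * z x\<close>.\<close>

lemma Cauchy_Schwarz_weighted:
  fixes a :: "'a \<Rightarrow> real" and z :: "'a \<Rightarrow> ennreal"
  assumes [measurable]: "a \<in> borel_measurable M" "z \<in> borel_measurable M" and a: "\<And>x. 0 \<le> a x"
  shows "(\<integral>\<^sup>+x. a x * z x \<partial>M)\<^sup>2 \<le> (\<integral>\<^sup>+x. a x \<partial>M) * (\<integral>\<^sup>+x. a x * (z x)\<^sup>2 \<partial>M)"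
proof -
  have s: "ennreal (sqrt (a x)) * ennreal (sqrt (a x)) = ennreal (a x)" for x
    using a[of x] by (simp add: ennreal_mult[symmetric])
  have "(\<integral>\<^sup>+x. ennreal (sqrt (a x)) * (ennreal (sqrt (a x)) * z x) \<partial>M)\<^sup>2 \<le>
      (\<integral>\<^sup>+x. (ennreal (sqrt (a x)))\<^sup>2 \<partial>M) * (\<integral>\<^sup>+x. (ennreal (sqrt (a x)) * z x)\<^sup>2 \<partial>M)"
    by (rule Cauchy_Schwarz_nn_integral) measurable
  moreover have "ennreal (sqrt (a x)) * (ennreal (sqrt (a x)) * z x) = a x * z x" for x
    by (simp add: s mult.assoc[symmetric])
  moreover have "(ennreal (sqrt (a x)))\<^sup>2 = a x" for x by (simp add: power2_eq_square s)
  moreover have "(ennreal (sqrt (a x)) * z x)\<^sup>2 = a x * (z x)\<^sup>2" for x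
    by (simp only: power_mult_distrib) (simp only: power2_eq_square s)
  ultimately show ?thesis by simp
qed

text \<open>The measure is later the positive part, the negative part or the total variation of
  \<alpha>. Duality is proved for the two parts separately, whereas norm estimates use the total
  variation.\<close>

locale delay_kernel_measure = sigma_finite_measure \<nu> for \<nu> :: "real measure" +
  assumes sets_\<nu>[measurable_cong]: "sets \<nu> = sets half_line"
begin

sublocale lborel_\<nu>: pair_sigma_finite "lborel :: real measure" \<nu> ..

lemma space_\<nu>: "space \<nu> = {0..}"
  using sets_eq_imp_space_eq[OF sets_\<nu>] by (simp add: space_restrict_space)

lemma measurable_pair_\<nu>: "measurable (N \<Otimes>\<^sub>M \<nu>) L = measurable (N \<Otimes>\<^sub>M half_line) L"
  "measurable (\<nu> \<Otimes>\<^sub>M N) L = measurable (half_line \<Otimes>\<^sub>M N) L"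
  by (intro measurable_cong_sets sets_pair_measure_cong sets_\<nu> refl)+

lemma measurable_id_\<nu>[measurable]: "(\<lambda>s. s) \<in> borel_measurable \<nu>"
  using measurable_restrict_space1[of "\<lambda>x. x" borel borel "{0..}"]
  by (simp add: measurable_cong_sets[OF sets_\<nu> refl])

lemma measurable_shift:
  assumes "(\<lambda>(t, s). f t s) \<in> lborel \<Otimes>\<^sub>M \<nu> \<rightarrow>\<^sub>M N"
  shows "(\<lambda>(u, s). f (u + s) s) \<in> lborel \<Otimes>\<^sub>M \<nu> \<rightarrow>\<^sub>M N"
proof -
  have "(\<lambda>p. (fst p + snd p, snd p)) \<in> lborel \<Otimes>\<^sub>M \<nu> \<rightarrow>\<^sub>M lborel \<Otimes>\<^sub>M \<nu>" by measurable
  from measurable_compose[OF this assms] show ?thesis by (simp add: case_prod_unfold)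
qed

text \<open>Tonelli and translation invariance of Lebesgue measure at each fixed delay
  \<open>s\<close>.\<close>

lemma nn_integral_shift:
  fixes f :: "real \<Rightarrow> real \<Rightarrow> ennreal"
  assumes [measurable]: "(\<lambda>(t, s). f t s) \<in> borel_measurable (lborel \<Otimes>\<^sub>M \<nu>)"
  shows "(\<integral>\<^sup>+t. (\<integral>\<^sup>+s. f t s \<partial>\<nu>) \<partial>lborel) = (\<integral>\<^sup>+u. (\<integral>\<^sup>+s. f (u + s) s \<partial>\<nu>) \<partial>lborel)"
proof -
  have m[measurable]: "(\<lambda>(u, s). f (u + s) s) \<in> borel_measurable (lborel \<Otimes>\<^sub>M \<nu>)" by (rule measurable_shift) fact
  have "(\<integral>\<^sup>+t. (\<integral>\<^sup>+s. f t s \<partial>\<nu>) \<partial>lborel) = (\<integral>\<^sup>+s. (\<integral>\<^sup>+t. f t s \<partial>lborel) \<partial>\<nu>)"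
    using lborel_\<nu>.Fubini[of "\<lambda>(t, s). f t s"] by simp
  also have "\<dots> = (\<integral>\<^sup>+s. (\<integral>\<^sup>+u. f (u + s) s \<partial>lborel) \<partial>\<nu>)"
  proof (rule nn_integral_cong)
    fix s assume s: "s \<in> space \<nu>"
    have "(\<lambda>t. f t s) \<in> borel_measurable lborel"
      using measurable_compose[OF measurable_Pair2'[OF s] assms] by simp
    then show "(\<integral>\<^sup>+t. f t s \<partial>lborel) = (\<integral>\<^sup>+u. f (u + s) s \<partial>lborel)"
      using nn_integral_real_affine[of "\<lambda>t. f t s" 1 s] by (simp add: add.commute)
  qed
  also have "\<dots> = (\<integral>\<^sup>+u. (\<integral>\<^sup>+s. f (u + s) s \<partial>\<nu>) \<partial>lborel)"
    using lborel_\<nu>.Fubini[OF m] by simp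
  finally show ?thesis .
qed

lemma kernel_weight:
  fixes k :: "real \<Rightarrow> real \<Rightarrow> real" and g :: "real \<Rightarrow> ennreal"
  assumes k: "(\<lambda>(t, s). k t s) \<in> borel_measurable (lborel \<Otimes>\<^sub>M \<nu>)" and g: "g \<in> borel_measurable borel"
    and C: "\<And>t. (\<integral>\<^sup>+s. k t s \<partial>\<nu>) \<le> C"
  shows "(\<integral>\<^sup>+t. (\<integral>\<^sup>+s. k t s * g t \<partial>\<nu>) \<partial>lborel) \<le> C * (\<integral>\<^sup>+t. g t \<partial>lborel)"
proof -
  have [measurable]: "(\<lambda>s. k t s) \<in> borel_measurable \<nu>" for t
    using measurable_compose[OF measurable_Pair1'[of t lborel \<nu>] k] by simp
  have "(\<integral>\<^sup>+s. k t s * g t \<partial>\<nu>) \<le> C * g t" for t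
    by (subst nn_integral_multc) (auto intro: mult_right_mono C)
  then have "(\<integral>\<^sup>+t. (\<integral>\<^sup>+s. k t s * g t \<partial>\<nu>) \<partial>lborel) \<le> (\<integral>\<^sup>+t. C * g t \<partial>lborel)" by (rule nn_integral_mono)
  also have "\<dots> = C * (\<integral>\<^sup>+t. g t \<partial>lborel)" using g by (intro nn_integral_cmult) simp
  finally show ?thesis .
qed

lemma kernel_Cauchy_Schwarz:
  fixes k :: "real \<Rightarrow> real \<Rightarrow> real" and f :: "real \<Rightarrow> real \<Rightarrow> ennreal"
  assumes k[measurable]: "(\<lambda>(t, s). k t s) \<in> borel_measurable (lborel \<Otimes>\<^sub>M \<nu>)" and k0: "\<And>t s. 0 \<le> k t s"
    and f[measurable]: "(\<lambda>(t, s). f t s) \<in> borel_measurable (lborel \<Otimes>\<^sub>M \<nu>)"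
    and C: "\<And>t. (\<integral>\<^sup>+s. k t s \<partial>\<nu>) \<le> C"
  shows "(\<integral>\<^sup>+t. (\<integral>\<^sup>+s. k t s * f t s \<partial>\<nu>)\<^sup>2 \<partial>lborel) \<le> C * (\<integral>\<^sup>+t. (\<integral>\<^sup>+s. k t s * (f t s)\<^sup>2 \<partial>\<nu>) \<partial>lborel)"
proof -
  have "(\<lambda>s. k t s) \<in> borel_measurable \<nu>" "(\<lambda>s. f t s) \<in> borel_measurable \<nu>" for t
    using measurable_compose[OF measurable_Pair1'[of t lborel \<nu>] k] measurable_compose[OF measurable_Pair1'[of t lborel \<nu>] f]
    by simp_all
  from order_trans[OF Cauchy_Schwarz_weighted[OF this k0] mult_right_mono[OF C]]
  have "(\<integral>\<^sup>+t. (\<integral>\<^sup>+s. k t s * f t s \<partial>\<nu>)\<^sup>2 \<partial>lborel) \<le> (\<integral>\<^sup>+t. C * (\<integral>\<^sup>+s. k t s * (f t s)\<^sup>2 \<partial>\<nu>) \<partial>lborel)"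
    by (intro nn_integral_mono) simp
  also have "\<dots> = C * (\<integral>\<^sup>+t. (\<integral>\<^sup>+s. k t s * (f t s)\<^sup>2 \<partial>\<nu>) \<partial>lborel)"
    by (rule nn_integral_cmult) measurable
  finally show ?thesis .
qed

text \<open>Schur's test. Cauchy--Schwarz spends one mass bound, and after the shift the square
  depends on the outer variable only, so the other bound can be used. For the backward operator the
  order is \<open>M\<^sub>0\<close>, then \<open>M\<close>; for the forward operator it is
  reversed.\<close>

lemma kernel_L2:
  fixes k :: "real \<Rightarrow> real \<Rightarrow> real" and z :: "real \<Rightarrow> ennreal"
  assumes k[measurable]: "(\<lambda>(t, s). k t s) \<in> borel_measurable (lborel \<Otimes>\<^sub>M \<nu>)" and k0: "\<And>t s. 0 \<le> k t s"
    and z[measurable]: "z \<in> borel_measurable borel"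
    and M0: "\<And>t. (\<integral>\<^sup>+s. k t s \<partial>\<nu>) \<le> M\<^sub>0" and M: "\<And>u. (\<integral>\<^sup>+s. k (u + s) s \<partial>\<nu>) \<le> M"
  shows kernel_L2_backward: "(\<integral>\<^sup>+t. (\<integral>\<^sup>+s. k t s * z (t - s) \<partial>\<nu>)\<^sup>2 \<partial>lborel) \<le> M\<^sub>0 * M * (\<integral>\<^sup>+u. (z u)\<^sup>2 \<partial>lborel)"
    and kernel_L2_forward: "(\<integral>\<^sup>+u. (\<integral>\<^sup>+s. k (u + s) s * z (u + s) \<partial>\<nu>)\<^sup>2 \<partial>lborel) \<le> M\<^sub>0 * M * (\<integral>\<^sup>+t. (z t)\<^sup>2 \<partial>lborel)"
proof -
  note ks = measurable_shift[OF k]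
  have z2: "(\<lambda>u. (z u)\<^sup>2) \<in> borel_measurable borel" by measurable
  have m: "(\<lambda>(t, s). z (t - s)) \<in> borel_measurable (lborel \<Otimes>\<^sub>M \<nu>)" "(\<lambda>(u, s). z (u + s)) \<in> borel_measurable (lborel \<Otimes>\<^sub>M \<nu>)"
    "(\<lambda>(t, s). k t s * (z (t - s))\<^sup>2) \<in> borel_measurable (lborel \<Otimes>\<^sub>M \<nu>)" "(\<lambda>(t, s). k t s * (z t)\<^sup>2) \<in> borel_measurable (lborel \<Otimes>\<^sub>M \<nu>)"
    by measurable
  have "(\<integral>\<^sup>+t. (\<integral>\<^sup>+s. k t s * z (t - s) \<partial>\<nu>)\<^sup>2 \<partial>lborel) \<le> M\<^sub>0 * (\<integral>\<^sup>+t. (\<integral>\<^sup>+s. k t s * (z (t - s))\<^sup>2 \<partial>\<nu>) \<partial>lborel)"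
    by (rule kernel_Cauchy_Schwarz[OF k k0 m(1) M0])
  also have "\<dots> = M\<^sub>0 * (\<integral>\<^sup>+u. (\<integral>\<^sup>+s. k (u + s) s * (z u)\<^sup>2 \<partial>\<nu>) \<partial>lborel)"
    using nn_integral_shift[OF m(3)] by simp
  also have "\<dots> \<le> M\<^sub>0 * (M * (\<integral>\<^sup>+u. (z u)\<^sup>2 \<partial>lborel))" by (intro mult_left_mono kernel_weight[OF ks z2 M]) simp
  finally show "(\<integral>\<^sup>+t. (\<integral>\<^sup>+s. k t s * z (t - s) \<partial>\<nu>)\<^sup>2 \<partial>lborel) \<le> M\<^sub>0 * M * (\<integral>\<^sup>+u. (z u)\<^sup>2 \<partial>lborel)"
    by (simp add: mult.assoc)
  have "(\<integral>\<^sup>+u. (\<integral>\<^sup>+s. k (u + s) s * z (u + s) \<partial>\<nu>)\<^sup>2 \<partial>lborel) \<le> M * (\<integral>\<^sup>+u. (\<integral>\<^sup>+s. k (u + s) s * (z (u + s))\<^sup>2 \<partial>\<nu>) \<partial>lborel)"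
    by (rule kernel_Cauchy_Schwarz[OF ks k0 m(2) M])
  also have "\<dots> = M * (\<integral>\<^sup>+t. (\<integral>\<^sup>+s. k t s * (z t)\<^sup>2 \<partial>\<nu>) \<partial>lborel)"
    using nn_integral_shift[OF m(4)] by simp
  also have "\<dots> \<le> M * (M\<^sub>0 * (\<integral>\<^sup>+t. (z t)\<^sup>2 \<partial>lborel))" by (intro mult_left_mono kernel_weight[OF k z2 M0]) simp
  finally show "(\<integral>\<^sup>+u. (\<integral>\<^sup>+s. k (u + s) s * z (u + s) \<partial>\<nu>)\<^sup>2 \<partial>lborel) \<le> M\<^sub>0 * M * (\<integral>\<^sup>+t. (z t)\<^sup>2 \<partial>lborel)"
    by (simp add: mult.assoc mult.left_commute)
qed

text \<open>Both sides are double integrals of the same function \<phi>, written in the coordinates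
  \<open>(t, s)\<close> and \<open>(u, s)\<close> with \<open>t = u + s\<close>. The
  \<open>L^2\<close> bounds make \<phi> absolutely integrable, which justifies the two exchanges of
  integrals around the translation.\<close>

lemma kernel_duality:
  fixes \<kappa> :: "real \<Rightarrow> real \<Rightarrow> 'e::{real_inner, banach, second_countable_topology} \<Rightarrow>\<^sub>L
      'f::{real_inner, banach, second_countable_topology}"
  assumes \<kappa>: "\<And>e. (\<lambda>(t, s). blinfun_apply (\<kappa> t s) e) \<in> borel_measurable (lborel \<Otimes>\<^sub>M \<nu>)"
    and z[measurable]: "z \<in> borel_measurable borel" and q[measurable]: "q \<in> borel_measurable borel"
    and z2: "L2_sq lborel z < \<infinity>"
    and q2: "L2_sq lborel q < \<infinity>"
    and M0: "\<And>t. (\<integral>\<^sup>+s. norm (\<kappa> t s) \<partial>\<nu>) \<le> M\<^sub>0" and M: "\<And>u. (\<integral>\<^sup>+s. norm (\<kappa> (u + s) s) \<partial>\<nu>) \<le> M"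
    and fin: "M\<^sub>0 < \<infinity>" "M < \<infinity>"
  shows "integrable lborel (\<lambda>t. inner (\<integral>s. blinfun_apply (\<kappa> t s) (z (t - s)) \<partial>\<nu>) (q t))"
    and "integrable lborel (\<lambda>u. inner (z u) (\<integral>s. adjoint (blinfun_apply (\<kappa> (u + s) s)) (q (u + s)) \<partial>\<nu>))"
    and "(\<integral>t. inner (\<integral>s. blinfun_apply (\<kappa> t s) (z (t - s)) \<partial>\<nu>) (q t) \<partial>lborel) =
      (\<integral>u. inner (z u) (\<integral>s. adjoint (blinfun_apply (\<kappa> (u + s) s)) (q (u + s)) \<partial>\<nu>) \<partial>lborel)"
proof -
  let ?r = "\<lambda>t s. blinfun_apply (\<kappa> t s) (z (t - s))" and ?R = "\<lambda>t. \<integral>s. blinfun_apply (\<kappa> t s) (z (t - s)) \<partial>\<nu>"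
  let ?a = "\<lambda>u s. adjoint (blinfun_apply (\<kappa> (u + s) s)) (q (u + s))"
  let ?A = "\<lambda>u. \<integral>s. adjoint (blinfun_apply (\<kappa> (u + s) s)) (q (u + s)) \<partial>\<nu>"
  let ?L = "lborel \<Otimes>\<^sub>M \<nu>"
  have nk[measurable]: "(\<lambda>(t, s). norm (\<kappa> t s)) \<in> borel_measurable ?L"
    using borel_measurable_norm_blinfun[of "\<lambda>(t, s). \<kappa> t s" ?L] \<kappa> by (simp add: case_prod_unfold)
  have mz[measurable]: "(\<lambda>(t, s). ?r t s) \<in> borel_measurable ?L"
    using borel_measurable_blinfun_apply_Caratheodory[of "\<lambda>(t, s). \<kappa> t s" ?L "\<lambda>(t, s). z (t - s)"] \<kappa>
    by (simp add: case_prod_unfold)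
  have mq0: "(\<lambda>(t, s). adjoint (blinfun_apply (\<kappa> t s)) (q t)) \<in> borel_measurable ?L"
    using borel_measurable_adjoint[of "\<lambda>(t, s). \<kappa> t s" ?L "\<lambda>(t, s). q t"] \<kappa>
    by (simp add: case_prod_unfold)
  note mq[measurable] = measurable_shift[OF mq0]
  note sk[measurable] = measurable_shift[OF nk]
  have sec: "(\<lambda>s. f t s) \<in> borel_measurable \<nu>" if "(\<lambda>(t, s). f t s) \<in> borel_measurable ?L"
    for f :: "real \<Rightarrow> real \<Rightarrow> 'z::topological_space" and t
    using measurable_compose[OF measurable_Pair1'[of t lborel \<nu>] that] by simp
  note [measurable] = sec[OF mz] sec[OF mq] sec[OF nk] sec[OF sk]
  define zn where "zn u = ennreal (norm (z u))" for u
  define qn where "qn u = ennreal (norm (q u))" for u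
  have [measurable]: "zn \<in> borel_measurable borel" "qn \<in> borel_measurable borel" unfolding zn_def qn_def by measurable
  let ?z = "\<lambda>t. \<integral>\<^sup>+s. norm (\<kappa> t s) * zn (t - s) \<partial>\<nu>" and ?q = "\<lambda>u. \<integral>\<^sup>+s. norm (\<kappa> (u + s) s) * qn (u + s) \<partial>\<nu>"
  have zn2: "(\<integral>\<^sup>+u. (zn u)\<^sup>2 \<partial>lborel) < \<infinity>" and qn2: "(\<integral>\<^sup>+u. (qn u)\<^sup>2 \<partial>lborel) < \<infinity>"
    using z2 q2 by (simp_all add: zn_def qn_def ennreal_power)
  \<comment> \<open>Finiteness of the dominating integrals at almost every time gives convergence of
    the vector-valued integrals there.\<close>
  have AEfin: "AE t in lborel. h t < \<infinity>"
    if "h \<in> borel_measurable lborel" "(\<integral>\<^sup>+t. (h t)\<^sup>2 \<partial>lborel) < \<infinity>" for h :: "real \<Rightarrow> ennreal"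
  proof -
    have "AE t in lborel. (h t)\<^sup>2 \<noteq> \<infinity>"
      using that by (intro nn_integral_PInf_AE) auto
    then show ?thesis by eventually_elim (auto simp: less_top power2_eq_square ennreal_mult_eq_top_iff)
  qed
  have z_L2: "(\<integral>\<^sup>+t. (?z t)\<^sup>2 \<partial>lborel) < \<infinity>"
  proof (rule le_less_trans)
    show "(\<integral>\<^sup>+t. (?z t)\<^sup>2 \<partial>lborel) \<le> M\<^sub>0 * M * (\<integral>\<^sup>+u. (zn u)\<^sup>2 \<partial>lborel)"
      by (intro kernel_L2_backward nk M0 M) auto
  qed (use fin zn2 in \<open>simp add: ennreal_mult_less_top\<close>)
  have zm: "?z \<in> borel_measurable lborel" by measurable
  have intz: "AE t in lborel. integrable \<nu> (\<lambda>s. ?r t s)"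
  proof -
    have "AE t in lborel. ?z t < \<infinity>" using zm z_L2 by (rule AEfin)
    then show ?thesis
    proof eventually_elim
      case (elim t)
      have "(\<integral>\<^sup>+s. norm (?r t s) \<partial>\<nu>) \<le> ?z t"
        by (intro nn_integral_mono) (auto simp: zn_def ennreal_mult''[symmetric] intro!: ennreal_leI norm_blinfun)
      with elim show ?case by (intro integrableI_bounded) auto
    qed
  qed
  have intq: "AE u in lborel. integrable \<nu> (\<lambda>s. ?a u s)"
  proof -
    have "(\<integral>\<^sup>+u. (?q u)\<^sup>2 \<partial>lborel) \<le> M\<^sub>0 * M * (\<integral>\<^sup>+u. (qn u)\<^sup>2 \<partial>lborel)"
      by (intro kernel_L2_forward nk M0 M) auto
    also have "\<dots> < \<infinity>" using fin qn2 by (simp add: ennreal_mult_less_top)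
    finally have "AE u in lborel. ?q u < \<infinity>"
      by (intro AEfin) measurable
    then show ?thesis
    proof eventually_elim
      case (elim u)
      have "(\<integral>\<^sup>+s. norm (?a u s) \<partial>\<nu>) \<le>
          ?q u"
        by (intro nn_integral_mono) (auto simp: qn_def ennreal_mult''[symmetric] intro!: ennreal_leI norm_adjoint_le)
      with elim show ?case by (intro integrableI_bounded) auto
    qed
  qed
  define \<phi> where "\<phi> t s = inner (?r t s) (q t)" for t s
  have \<phi>m[measurable]: "(\<lambda>(t, s). \<phi> t s) \<in> borel_measurable ?L" unfolding \<phi>_def by measurable
  note \<phi>s[measurable] = measurable_shift[OF \<phi>m]
  have \<phi>_adj: "\<phi> (u + s) s = inner (z u) (?a u s)" for u s
    by (simp add: \<phi>_def adjoint_inner[OF blinfun.bounded_linear_right])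
  let ?f = "\<lambda>t. \<integral>\<^sup>+s. norm (\<phi> t s) \<partial>\<nu>"
  have fin_\<phi>: "(\<integral>\<^sup>+t. ?f t \<partial>lborel) < \<infinity>"
  proof -
    have "(\<integral>\<^sup>+t. ?f t \<partial>lborel) \<le> (\<integral>\<^sup>+t. (?z t)\<^sup>2 + (qn t)\<^sup>2 \<partial>lborel)"
    proof (rule nn_integral_mono)
      fix t
      have "?f t \<le> (\<integral>\<^sup>+s. norm (\<kappa> t s) * zn (t - s) * qn t \<partial>\<nu>)"
      proof (rule nn_integral_mono)
        fix s
        have "norm (\<phi> t s) \<le> norm (?r t s) * norm (q t)"
          unfolding \<phi>_def using Cauchy_Schwarz_ineq2 by simp
        also have "\<dots> \<le> norm (\<kappa> t s) * norm (z (t - s)) * norm (q t)" by (intro mult_right_mono norm_blinfun) auto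
        finally show "ennreal (norm (\<phi> t s)) \<le> norm (\<kappa> t s) * zn (t - s) * qn t"
          by (simp add: zn_def qn_def ennreal_mult[symmetric] ennreal_leI)
      qed
      also have "\<dots> = ?z t * qn t" by (rule nn_integral_multc) measurable
      also have "\<dots> \<le> (?z t)\<^sup>2 + (qn t)\<^sup>2"
        by (rule ennreal_mult_le_squares)
      finally show "?f t \<le> (?z t)\<^sup>2 + (qn t)\<^sup>2" .
    qed
    also have "\<dots> = (\<integral>\<^sup>+t. (?z t)\<^sup>2 \<partial>lborel) + (\<integral>\<^sup>+t. (qn t)\<^sup>2 \<partial>lborel)"
      using zm by (intro nn_integral_add) auto
    also have "\<dots> < \<infinity>" using z_L2 qn2 by simp
    finally show ?thesis .
  qed
  have i\<phi>: "integrable ?L (\<lambda>(t, s). \<phi> t s)"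
  proof (rule integrableI_bounded[OF \<phi>m])
    have "(\<integral>\<^sup>+p. norm (case p of (t, s) \<Rightarrow> \<phi> t s) \<partial>?L) = (\<integral>\<^sup>+t. ?f t \<partial>lborel)"
      using nn_integral_fst[of "\<lambda>p. ennreal (norm (case p of (t, s) \<Rightarrow> \<phi> t s))" lborel] \<phi>m by simp
    then show "(\<integral>\<^sup>+p. norm (case p of (t, s) \<Rightarrow> \<phi> t s) \<partial>?L) < \<infinity>" using fin_\<phi> by simp
  qed
  have i\<phi>s: "integrable ?L (\<lambda>(u, s). \<phi> (u + s) s)"
  proof (rule integrableI_bounded[OF \<phi>s])
    have "(\<integral>\<^sup>+p. norm (case p of (u, s) \<Rightarrow> \<phi> (u + s) s) \<partial>?L) = (\<integral>\<^sup>+u. (\<integral>\<^sup>+s. norm (\<phi> (u + s) s) \<partial>\<nu>) \<partial>lborel)"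
      using nn_integral_fst[of "\<lambda>p. ennreal (norm (case p of (u, s) \<Rightarrow> \<phi> (u + s) s))" lborel] \<phi>s by simp
    also have "\<dots> = (\<integral>\<^sup>+t. ?f t \<partial>lborel)"
      by (rule nn_integral_shift[symmetric]) measurable
    finally show "(\<integral>\<^sup>+p. norm (case p of (u, s) \<Rightarrow> \<phi> (u + s) s) \<partial>?L) < \<infinity>" using fin_\<phi> by simp
  qed
  \<comment> \<open>The inner product is pulled out of the integral only where that integral
    converges, hence almost everywhere.\<close>
  have eqz: "AE t in lborel. (\<integral>s. \<phi> t s \<partial>\<nu>) = inner (?R t) (q t)"
    using intz by eventually_elim (simp add: \<phi>_def integral_inner_left)
  have eqq: "AE u in lborel. (\<integral>s. \<phi> (u + s) s \<partial>\<nu>) =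
      inner (z u) (?A u)"
    using intq by eventually_elim (simp add: \<phi>_adj integral_inner_right)
  have [measurable]: "(\<lambda>t. ?R t) \<in> borel_measurable lborel"
    "(\<lambda>u. ?A u) \<in> borel_measurable lborel"
    "(\<lambda>t. \<integral>s. \<phi> t s \<partial>\<nu>) \<in> borel_measurable lborel" "(\<lambda>u. \<integral>s. \<phi> (u + s) s \<partial>\<nu>) \<in> borel_measurable lborel"
    by (rule borel_measurable_lebesgue_integral mz mq \<phi>m \<phi>s)+
  have [measurable]: "z \<in> borel_measurable lborel" "q \<in> borel_measurable lborel" using z q by simp_all
  show "integrable lborel (\<lambda>t. inner (?R t) (q t))"
    by (rule integrable_cong_AE_imp[OF lborel_\<nu>.integrable_fst[OF i\<phi>] _ eqz]) measurable
  show "integrable lborel (\<lambda>u. inner (z u) (?A u))"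
    by (rule integrable_cong_AE_imp[OF lborel_\<nu>.integrable_fst[OF i\<phi>s] _ eqq]) measurable
  have "(\<integral>t. inner (?R t) (q t) \<partial>lborel) = (\<integral>t. (\<integral>s. \<phi> t s \<partial>\<nu>) \<partial>lborel)"
    using eqz by (intro integral_cong_AE) auto
  also have "\<dots> = (\<integral>s. (\<integral>t. \<phi> t s \<partial>lborel) \<partial>\<nu>)" by (rule lborel_\<nu>.Fubini_integral[OF i\<phi>, symmetric])
  also have "\<dots> = (\<integral>s. (\<integral>u. \<phi> (u + s) s \<partial>lborel) \<partial>\<nu>)"
  proof (rule Bochner_Integration.integral_cong[OF refl])
    fix s
    show "(\<integral>t. \<phi> t s \<partial>lborel) = (\<integral>u. \<phi> (u + s) s \<partial>lborel)"
      using lborel_integral_real_affine[of 1 "\<lambda>t. \<phi> t s" s] by (simp add: add.commute)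
  qed
  also have "\<dots> = (\<integral>u. (\<integral>s. \<phi> (u + s) s \<partial>\<nu>) \<partial>lborel)" by (rule lborel_\<nu>.Fubini_integral[OF i\<phi>s])
  also have "\<dots> = (\<integral>u. inner (z u) (?A u) \<partial>lborel)"
    using eqq by (intro integral_cong_AE) auto
  finally show "(\<integral>t. inner (?R t) (q t) \<partial>lborel) =
      (\<integral>u. inner (z u) (?A u) \<partial>lborel)" .
qed

declare measurable_id_\<nu> [measurable del]

end

section \<open>The delay operator and its adjoint\<close>

text \<open>This covers functions that are not integrable, as their Bochner integral has the default
  value \<open>0\<close>.\<close>

lemma norm_integral_le_nn_integral:
  "ennreal (norm (\<integral>x. f x \<partial>N)) \<le> (\<integral>\<^sup>+x. norm (f x) \<partial>N)"
  using integral_norm_bound_ennreal[of N f] by (cases "integrable N f") (auto simp: not_integrable_integral_eq)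

context finite_signed_measure_space
begin

text \<open>The densities of the two parts with respect to the total variation are the indicators of
  complementary sets, which add up to \<open>1\<close>.\<close>

lemma variation_measures:
  shows finite_upper: "finite_measure upperV"
    and finite_lower: "finite_measure lowerV"
    and finite_total: "finite_measure totalV"
    and sets_upper: "sets upperV = sets S"
    and sets_lower: "sets lowerV = sets S"
    and sets_total: "sets totalV = sets S"
    and nn_integral_total: "f \<in> borel_measurable S \<Longrightarrow> (\<integral>\<^sup>+x. f x \<partial>totalV) =
      (\<integral>\<^sup>+x. f x \<partial>upperV) + (\<integral>\<^sup>+x. f x \<partial>lowerV)"
proof -
  obtain D where D: "D \<in> sets S" and
    fin: "finite_measure totalV" and st: "sets totalV = sets S" and
    up: "upperV = density totalV (indicator D)" and
    lo: "lowerV = density totalV (indicator (space S - D))"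
    by (rule Jordan_decomposition)
  let ?N = "totalV"
  interpret N: finite_measure ?N by fact
  have sp: "space ?N = space S" using sets_eq_imp_space_eq[OF st] .
  have dens: "finite_measure (density ?N (indicator E))" if "E \<in> sets S" for E
  proof (rule finite_measureI)
    have "emeasure (density ?N (indicator E)) (space (density ?N (indicator E))) = (\<integral>\<^sup>+x. indicator E x * indicator (space ?N) x \<partial>?N)"
      using that st by (subst emeasure_density) auto
    also have "\<dots> \<le> (\<integral>\<^sup>+x. 1 \<partial>?N)" by (intro nn_integral_mono) (auto simp: indicator_def)
    also have "\<dots> < \<infinity>" by (simp add: less_top[symmetric])
    finally show "emeasure (density ?N (indicator E)) (space (density ?N (indicator E))) \<noteq> \<infinity>" by simp
  qed
  have D': "space S - D \<in> sets S" using D by auto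
  show "finite_measure upperV" "finite_measure lowerV"
    unfolding up lo using dens D D' by auto
  show "finite_measure ?N" "sets upperV = sets S" "sets lowerV = sets S" "sets ?N = sets S"
    using fin by (simp_all add: up lo st)
  assume f: "f \<in> borel_measurable S"
  then have fN: "f \<in> borel_measurable ?N" by (simp add: measurable_cong_sets[OF st refl])
  have ind: "(indicator E :: 'a \<Rightarrow> ennreal) \<in> borel_measurable ?N" if "E \<in> sets S" for E
    using that st by (intro borel_measurable_indicator) simp
  have "(\<integral>\<^sup>+x. f x \<partial>upperV) + (\<integral>\<^sup>+x. f x \<partial>lowerV) =
      (\<integral>\<^sup>+x. indicator D x * f x \<partial>?N) + (\<integral>\<^sup>+x. indicator (space S - D) x * f x \<partial>?N)"
    unfolding up lo using ind[OF D] ind[OF D'] fN by (simp add: nn_integral_density)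
  also have "\<dots> = (\<integral>\<^sup>+x. indicator D x * f x + indicator (space S - D) x * f x \<partial>?N)"
    using ind[OF D] ind[OF D'] fN by (intro nn_integral_add[symmetric]) auto
  also have "\<dots> = (\<integral>\<^sup>+x. f x \<partial>?N)"
    by (intro nn_integral_cong) (auto simp: indicator_def sp)
  finally show "(\<integral>\<^sup>+x. f x \<partial>?N) = (\<integral>\<^sup>+x. f x \<partial>upperV) + (\<integral>\<^sup>+x. f x \<partial>lowerV)"
    by simp
qed

lemma signed_integral_cong:
  assumes "\<And>x. x \<in> space S \<Longrightarrow> f x = g x"
  shows "signed_integral S \<alpha> f = signed_integral S \<alpha> g"
  unfolding signed_integral_def
  using assms sets_eq_imp_space_eq[OF sets_upper] sets_eq_imp_space_eq[OF sets_lower]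
  by (intro arg_cong2[where f="(-)"] Bochner_Integration.integral_cong) auto

lemma norm_signed_integral_le:
  assumes "f \<in> borel_measurable S"
  shows "ennreal (norm (signed_integral S \<alpha> f)) \<le> (\<integral>\<^sup>+x. norm (f x) \<partial>totalV)"
proof -
  have "ennreal (norm (signed_integral S \<alpha> f)) \<le>
      ennreal (norm (\<integral>x. f x \<partial>upperV) + norm (\<integral>x. f x \<partial>lowerV))"
    unfolding signed_integral_def by (intro ennreal_leI norm_triangle_ineq4)
  also have "\<dots> = ennreal (norm (\<integral>x. f x \<partial>upperV)) + ennreal (norm (\<integral>x. f x \<partial>lowerV))"
    by (rule ennreal_plus) auto
  also have "\<dots> \<le> (\<integral>\<^sup>+x. norm (f x) \<partial>upperV) + (\<integral>\<^sup>+x. norm (f x) \<partial>lowerV)"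
    by (intro add_mono norm_integral_le_nn_integral)
  also have "\<dots> = (\<integral>\<^sup>+x. norm (f x) \<partial>totalV)"
    using assms by (intro nn_integral_total[symmetric]) simp
  finally show ?thesis .
qed

end

section \<open>Joint measurability and integrability of processes on a time interval\<close>

lemma measurable_mask:
  fixes f :: "real \<Rightarrow> 'w \<Rightarrow> 'b::{real_normed_vector, second_countable_topology}"
  assumes f: "(\<lambda>(t, w). f t w) \<in> borel_measurable (restrict_space borel A \<Otimes>\<^sub>M P)" and A: "A \<in> sets borel"
  shows "(\<lambda>(t, w). if t \<in> A then f t w else 0) \<in> borel_measurable (borel \<Otimes>\<^sub>M P)"
proof -
  have "{x \<in> space (borel \<Otimes>\<^sub>M P). fst x \<in> A} \<in> sets (borel \<Otimes>\<^sub>M P)" using A by measurable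
  moreover have "(\<lambda>p. f (fst p) (snd p)) \<in> borel_measurable (restrict_space (borel \<Otimes>\<^sub>M P) {p. fst p \<in> A})"
  proof -
    have "(\<lambda>p. (fst p, snd p)) \<in> restrict_space (borel \<Otimes>\<^sub>M P) {p. fst p \<in> A} \<rightarrow>\<^sub>M restrict_space borel A \<Otimes>\<^sub>M P"
      by (intro measurable_Pair measurable_restrict_space2 measurable_restrict_space1 measurable_fst measurable_snd)
        (auto simp: space_restrict_space)
    from measurable_compose[OF this f] show ?thesis by (simp add: case_prod_unfold)
  qed
  ultimately have "(\<lambda>p. if fst p \<in> A then f (fst p) (snd p) else 0) \<in> borel_measurable (borel \<Otimes>\<^sub>M P)"
    by (subst measurable_If_restrict_space_iff) auto
  then show ?thesis by (simp add: case_prod_unfold)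
qed

context usual_filtered_prob_space
begin

lemma measurable_ident_F: "(\<lambda>w. w) \<in> P \<rightarrow>\<^sub>M F t"
  by (rule measurable_from_subalg[OF subalgebra_F measurable_ident_sets[OF refl]])

text \<open>\<open>T\<close> is the last time of \<open>I\<close>, so the progressive condition at
  \<open>T\<close> already covers the whole interval.\<close>

lemma progressive_mask:
  fixes X :: "real \<Rightarrow> 'w \<Rightarrow> 'b::{real_normed_vector, second_countable_topology}"
  assumes X: "progressive F I X" and T: "T \<in> I" "I \<subseteq> {..T}" and I: "I \<in> sets borel"
  shows "(\<lambda>(s, w). X s w) \<in> borel_measurable (restrict_space borel I \<Otimes>\<^sub>M P)"
    and "(\<lambda>(s, w). if s \<in> I then X s w else 0) \<in> borel_measurable (borel \<Otimes>\<^sub>M P)"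
proof -
  have "I \<inter> {..T} = I" using T by auto
  then have "(\<lambda>(s, w). X s w) \<in> borel_measurable (restrict_space borel I \<Otimes>\<^sub>M F T)"
    using X T by (auto simp: progressive_def)
  moreover have "(\<lambda>p. (fst p, snd p)) \<in> restrict_space borel I \<Otimes>\<^sub>M P \<rightarrow>\<^sub>M restrict_space borel I \<Otimes>\<^sub>M F T"
    by (intro measurable_Pair measurable_fst measurable_compose[OF measurable_snd measurable_ident_F])
  ultimately show *: "(\<lambda>(s, w). X s w) \<in> borel_measurable (restrict_space borel I \<Otimes>\<^sub>M P)"
    using measurable_compose by force
  show "(\<lambda>(s, w). if s \<in> I then X s w else 0) \<in> borel_measurable (borel \<Otimes>\<^sub>M P)"
    by (rule measurable_mask[OF * I])
qed

sublocale lborel_P: pair_sigma_finite "lborel :: real measure" P ..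

lemma nn_integral_swap:
  fixes f :: "real \<Rightarrow> 'w \<Rightarrow> ennreal"
  assumes "jointly_measurable f"
  shows "(\<integral>\<^sup>+w. (\<integral>\<^sup>+t. f t w \<partial>lborel) \<partial>P) = (\<integral>\<^sup>+t. (\<integral>\<^sup>+w. f t w \<partial>P) \<partial>lborel)"
    and "(\<integral>\<^sup>+p. f (fst p) (snd p) \<partial>dtP) = (\<integral>\<^sup>+w. (\<integral>\<^sup>+t. f t w \<partial>lborel) \<partial>P)"
proof -
  have m: "(\<lambda>p. f (fst p) (snd p)) \<in> borel_measurable dtP"
    using assms by (simp add: case_prod_unfold)
  show "(\<integral>\<^sup>+w. (\<integral>\<^sup>+t. f t w \<partial>lborel) \<partial>P) = (\<integral>\<^sup>+t. (\<integral>\<^sup>+w. f t w \<partial>P) \<partial>lborel)"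
    using lborel_P.Fubini[OF m] by simp
  show "(\<integral>\<^sup>+p. f (fst p) (snd p) \<partial>dtP) = (\<integral>\<^sup>+w. (\<integral>\<^sup>+t. f t w \<partial>lborel) \<partial>P)"
    using lborel_P.nn_integral_snd[OF m] by simp
qed

lemma process_section:
  fixes f :: "real \<Rightarrow> 'w \<Rightarrow> 'b::topological_space"
  assumes "jointly_measurable f"
  shows "f t \<in> borel_measurable P" "w \<in> space P \<Longrightarrow> (\<lambda>t. f t w) \<in> borel_measurable lborel"
  using measurable_compose[OF measurable_Pair1'[of t lborel P] assms]
    measurable_compose[OF measurable_Pair2'[of w P lborel] assms] by simp_all

lemma integrable_inner_process:
  fixes f g :: "real \<Rightarrow> 'w \<Rightarrow> 'b::{real_inner, second_countable_topology}"
  assumes [measurable]: "jointly_measurable f" "jointly_measurable g"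
    and f2: "L2_process f < \<infinity>" and g2: "L2_process g < \<infinity>"
  shows "integrable dtP (\<lambda>(t, w). inner (f t w) (g t w))"
proof -
  have sq: "integrable dtP (\<lambda>p. (norm (h (fst p) (snd p)))\<^sup>2)"
    if [measurable]: "jointly_measurable h" and h2: "L2_process h < \<infinity>" for h :: "real \<Rightarrow> 'w \<Rightarrow> 'b"
  proof (rule integrableI_bounded)
    have [measurable]: "(\<lambda>p. h (fst p) (snd p)) \<in> borel_measurable dtP"
      using that(1) by (simp add: case_prod_unfold)
    show "(\<lambda>p. (norm (h (fst p) (snd p)))\<^sup>2) \<in> borel_measurable dtP" by measurable
    have "(\<integral>\<^sup>+p. ennreal ((norm (h (fst p) (snd p)))\<^sup>2) \<partial>dtP) = L2_process h"
      by (rule nn_integral_swap(2)) measurable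
    then show "(\<integral>\<^sup>+p. ennreal (norm ((norm (h (fst p) (snd p)))\<^sup>2)) \<partial>dtP) < \<infinity>"
      using h2 by simp
  qed
  have "integrable dtP (\<lambda>p. (norm (f (fst p) (snd p)))\<^sup>2 + (norm (g (fst p) (snd p)))\<^sup>2)"
    using sq[OF assms(1) f2] sq[OF assms(2) g2] by (rule Bochner_Integration.integrable_add)
  then show ?thesis
  proof (rule Bochner_Integration.integrable_bound)
    show "(\<lambda>(t, w). inner (f t w) (g t w)) \<in> borel_measurable dtP" by measurable
    have "\<bar>inner x y\<bar> \<le> (norm x)\<^sup>2 + (norm y)\<^sup>2" for x y :: 'b
    proof -
      have "0 \<le> norm x * norm y" by simp
      then show ?thesis using Cauchy_Schwarz_ineq2[of x y] sum_squares_bound[of "norm x" "norm y"] by linarith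
    qed
    then show "AE p in lborel \<Otimes>\<^sub>M P. norm (case p of (t, w) \<Rightarrow> inner (f t w) (g t w)) \<le>
        norm ((norm (f (fst p) (snd p)))\<^sup>2 + (norm (g (fst p) (snd p)))\<^sup>2)"
      by (auto simp: case_prod_unfold)
  qed
qed

text \<open>The support in a set of finite measure matters: the norm is paired with the square
  integrable indicator of \<open>{0..T}\<close>.\<close>

lemma integrable_process_L2:
  fixes f :: "real \<Rightarrow> 'w \<Rightarrow> 'b::{banach, second_countable_topology}"
  assumes f: "jointly_measurable f"
    and f2: "L2_process f < \<infinity>"
    and supp: "\<And>t w. t \<notin> {0..T} \<Longrightarrow> f t w = 0"
  shows "integrable dtP (\<lambda>(t, w). f t w)"
proof -
  have i: "integrable dtP (\<lambda>(t, w). inner (indicator {0..T} t :: real) (norm (f t w)))"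
  proof (rule integrable_inner_process)
    have "L2_sq lborel (\<lambda>t. indicator {0..T} t :: real) = (\<integral>\<^sup>+t. indicator {0..T} t \<partial>lborel)"
      by (intro nn_integral_cong) (auto simp: indicator_def)
    then show "(\<integral>\<^sup>+w. L2_sq lborel (\<lambda>t. indicator {0..T} t :: real) \<partial>P) < \<infinity>"
      by (simp add: emeasure_space_1 emeasure_lborel_Icc_eq)
  qed (use f f2 in \<open>auto simp: case_prod_unfold\<close>)
  show ?thesis
  proof (rule Bochner_Integration.integrable_bound[OF i f], rule AE_I2)
    fix p :: "real \<times> 'w"
    show "norm (case p of (t, w) \<Rightarrow> f t w) \<le> norm (case p of (t, w) \<Rightarrow> inner (indicator {0..T} t :: real) (norm (f t w)))"
      using supp[of "fst p" "snd p"] by (auto simp: case_prod_unfold indicator_def)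
  qed
qed

lemma optional_projection_L2:
  fixes Y V :: "real \<Rightarrow> 'w \<Rightarrow> 'b::{real_inner, banach, second_countable_topology}"
  assumes T: "0 \<le> T" and YV: "opt_proj T Y V"
    and Y: "jointly_measurable Y"
  shows "L2_process_on {0..T} V \<le> L2_process_on {0..T} Y"
proof -
  have ce: "AE t in lborel. t \<in> {0..T} \<longrightarrow> is_cond_exp P (F t) (Y t) (V t)"
    using YV by (auto simp: is_optional_projection_def)
  \<comment> \<open>The values of \<open>V\<close> outside the interval are arbitrary; masking makes
    the process jointly measurable on the whole line.\<close>
  define V' where "V' t w = (if t \<in> {0..T} then V t w else 0)" for t w
  have "progressive F {0..T} V" using YV optional_progressive by (auto simp: is_optional_projection_def)
  from progressive_mask(2)[OF this, of T] T
  have [measurable]: "jointly_measurable V'" by (simp add: V'_def)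
  note [measurable] = Y
  have "L2_process_on {0..T} V =
      (\<integral>\<^sup>+w. (\<integral>\<^sup>+t. ennreal ((norm (V' t w))\<^sup>2) * indicator {0..T} t \<partial>lborel) \<partial>P)"
    by (intro nn_integral_cong) (auto simp: V'_def indicator_def)
  also have "\<dots> = (\<integral>\<^sup>+t. (\<integral>\<^sup>+w. ennreal ((norm (V' t w))\<^sup>2) * indicator {0..T} t \<partial>P) \<partial>lborel)"
    by (rule nn_integral_swap) measurable
  also have "\<dots> \<le> (\<integral>\<^sup>+t. (\<integral>\<^sup>+w. ennreal ((norm (Y t w))\<^sup>2) * indicator {0..T} t \<partial>P) \<partial>lborel)"
  proof (rule nn_integral_mono_AE, use ce in eventually_elim)
    case (elim t)
    then show ?case
      using is_cond_exp_L2[OF prob_space_axioms subalgebra_F, of t "Y t" "V t"]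
      by (auto simp: V'_def indicator_def)
  qed
  also have "\<dots> = L2_process_on {0..T} Y"
    by (rule nn_integral_swap(1)[symmetric]) measurable
  finally show ?thesis .
qed

end

section \<open>The delay operator and the anticipating integral as processes on the whole
  line\<close>

locale delay_setting = usual_filtered_prob_space P F for P :: "'w measure" and F +
  fixes T :: real and \<alpha> :: "real set \<Rightarrow> real" and M\<^sub>0 M :: ennreal
    and K :: "real \<Rightarrow> real \<Rightarrow> 'w \<Rightarrow>
              'e::{real_inner, banach, second_countable_topology} \<Rightarrow>\<^sub>L
              'f::{real_inner, banach, second_countable_topology}"
    and Z :: "real \<Rightarrow> 'w \<Rightarrow> 'e" and Q :: "real \<Rightarrow> 'w \<Rightarrow> 'f"
  assumes T_pos: "T > 0"
    and \<alpha>: "finite_signed_measure half_line \<alpha>"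
    and K_measurable: "\<And>e. (\<lambda>(w, t, \<theta>). blinfun_apply (K t \<theta> w) e)
           \<in> borel_measurable (P \<Otimes>\<^sub>M (restrict_space borel {0..T} \<Otimes>\<^sub>M half_line))"
    and K_adapted: "\<And>t \<theta> e. t \<in> {0..T} \<Longrightarrow> \<theta> \<ge> 0 \<Longrightarrow>
           (\<lambda>w. blinfun_apply (K t \<theta> w) e) \<in> borel_measurable (F t)"
    and M0_fin: "M\<^sub>0 < \<infinity>" and M_fin: "M < \<infinity>"
    and M0_bound: "AE w in P.
           (SUP t\<in>{0..T}. \<integral>\<^sup>+\<theta>. ennreal (norm (K t \<theta> w)) \<partial>total_variation half_line \<alpha>) \<le> M\<^sub>0"
    and M_bound: "AE w in P.
           (SUP u\<in>{..T}. \<integral>\<^sup>+\<theta>. ennreal (norm (K (u + \<theta>) \<theta> w)) * indicator {0..T} (u + \<theta>)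
              \<partial>total_variation half_line \<alpha>) \<le> M"
    and Z: "Z \<in> M2 P F {..T}" and Q: "Q \<in> M2 P F {0..T}"
    and Z_zero: "\<And>t. t \<le> 0 \<Longrightarrow> AE w in P. Z t w = 0"
begin

sublocale signed: finite_signed_measure_space half_line \<alpha>
  by standard (rule \<alpha>)

abbreviation "pos \<equiv> signed.upperV"
abbreviation "neg \<equiv> signed.lowerV"
abbreviation "tot \<equiv> signed.totalV"

sublocale pos: delay_kernel_measure pos
  using finite_measure.axioms(1)[OF signed.finite_upper] signed.sets_upper
  by (intro delay_kernel_measure.intro delay_kernel_measure_axioms.intro)

sublocale neg: delay_kernel_measure neg
  using finite_measure.axioms(1)[OF signed.finite_lower] signed.sets_lower
  by (intro delay_kernel_measure.intro delay_kernel_measure_axioms.intro)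

sublocale tot: delay_kernel_measure tot
  using finite_measure.axioms(1)[OF signed.finite_total] signed.sets_total
  by (intro delay_kernel_measure.intro delay_kernel_measure_axioms.intro)

text \<open>Extending \<open>K\<close>, \<open>Z\<close> and \<open>Q\<close> by zero makes all time integrals range over the whole line.\<close>

definition K\<^sub>0 :: "real \<Rightarrow> real \<Rightarrow> 'w \<Rightarrow> 'e \<Rightarrow>\<^sub>L 'f" where
  "K\<^sub>0 t \<theta> w = (if t \<in> {0..T} then K t \<theta> w else 0)"

definition Z\<^sub>0 :: "real \<Rightarrow> 'w \<Rightarrow> 'e" where
  "Z\<^sub>0 t w = (if t \<in> {..T} then Z t w else 0)"

definition Q\<^sub>0 :: "real \<Rightarrow> 'w \<Rightarrow> 'f" where
  "Q\<^sub>0 t w = (if t \<in> {0..T} then Q t w else 0)"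

definition R :: "real \<Rightarrow> 'w \<Rightarrow> 'f" where
  "R t w = signed_integral half_line \<alpha> (\<lambda>\<theta>. blinfun_apply (K\<^sub>0 t \<theta> w) (Z\<^sub>0 (t - \<theta>) w))"

definition Y :: "real \<Rightarrow> 'w \<Rightarrow> 'e" where
  "Y t w = signed_integral half_line \<alpha> (\<lambda>\<theta>. adjoint (blinfun_apply (K\<^sub>0 (t + \<theta>) \<theta> w)) (Q\<^sub>0 (t + \<theta>) w))"

lemma delay_op_eq: "t \<in> {0..T} \<Longrightarrow> delay_op \<alpha> K Z t w = R t w"
  unfolding delay_op_def R_def
  by (rule signed.signed_integral_cong) (auto simp: K\<^sub>0_def Z\<^sub>0_def space_restrict_space)

text \<open>The equation holds at every real \<open>t\<close>: where \<open>t + \<theta>\<close>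
  leaves the interval, both integrands vanish, because the adjoint of the zero operator is
  zero.\<close>

lemma anticipating_adjoint_eq: "anticipating_adjoint \<alpha> T K Q t w = Y t w"
  unfolding anticipating_adjoint_def Y_def
  by (rule signed.signed_integral_cong) (auto simp: K\<^sub>0_def Q\<^sub>0_def zero_blinfun.rep_eq indicator_def)

lemma K0_joint: "(\<lambda>(w, t, \<theta>). blinfun_apply (K\<^sub>0 t \<theta> w) e) \<in> borel_measurable (P \<Otimes>\<^sub>M (borel \<Otimes>\<^sub>M half_line))"
proof -
  let ?M = "P \<Otimes>\<^sub>M (borel \<Otimes>\<^sub>M half_line) :: ('w \<times> real \<times> real) measure"
  let ?f = "\<lambda>x. blinfun_apply (K (fst (snd x)) (snd (snd x)) (fst x)) e"
  have "{x \<in> space ?M. fst (snd x) \<in> {0..T}} \<in> sets ?M" by measurable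
  moreover have "?f
      \<in> borel_measurable (restrict_space ?M {x. fst (snd x) \<in> {0..T}})"
  proof -
    have "(\<lambda>x. (fst x, fst (snd x), snd (snd x))) \<in> restrict_space ?M {x. fst (snd x) \<in> {0..T}} \<rightarrow>\<^sub>M
        P \<Otimes>\<^sub>M (restrict_space borel {0..T} \<Otimes>\<^sub>M half_line)"
      by (intro measurable_Pair measurable_restrict_space2[of _ _ "{0..T}"] measurable_restrict_space1)
        (auto simp: space_restrict_space)
    from measurable_compose[OF this K_measurable] show ?thesis by (simp add: case_prod_unfold)
  qed
  ultimately have "(\<lambda>x. if fst (snd x) \<in> {0..T} then ?f x else 0)
      \<in> borel_measurable ?M"
    by (subst measurable_If_restrict_space_iff) auto
  moreover have "(\<lambda>(w, t, \<theta>). blinfun_apply (K\<^sub>0 t \<theta> w) e) =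
      (\<lambda>x. if fst (snd x) \<in> {0..T} then ?f x else 0)"
    by (auto simp: K\<^sub>0_def fun_eq_iff)
  ultimately show ?thesis by simp
qed

text \<open>Arbitrary coordinate maps are allowed, so that the rule applies alike to product spaces,
  fixed paths, fixed times and shifted times.\<close>

lemma measurable_K0:
  assumes "a \<in> N \<rightarrow>\<^sub>M P" "b \<in> borel_measurable N" "c \<in> N \<rightarrow>\<^sub>M half_line"
  shows "(\<lambda>x. blinfun_apply (K\<^sub>0 (b x) (c x) (a x)) e) \<in> borel_measurable N"
proof -
  have "(\<lambda>x. (a x, b x, c x)) \<in> N \<rightarrow>\<^sub>M P \<Otimes>\<^sub>M (borel \<Otimes>\<^sub>M half_line)" using assms by measurable
  from measurable_compose[OF this K0_joint] show ?thesis by simp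
qed

lemma measurable_norm_K0:
  assumes "a \<in> N \<rightarrow>\<^sub>M P" "b \<in> borel_measurable N" "c \<in> N \<rightarrow>\<^sub>M half_line"
  shows "(\<lambda>x. norm (K\<^sub>0 (b x) (c x) (a x))) \<in> borel_measurable N"
  by (rule borel_measurable_norm_blinfun[OF measurable_K0[OF assms]])

lemma measurable_K0_apply:
  assumes "a \<in> N \<rightarrow>\<^sub>M P" "b \<in> borel_measurable N" "c \<in> N \<rightarrow>\<^sub>M half_line" "z \<in> borel_measurable N"
  shows "(\<lambda>x. blinfun_apply (K\<^sub>0 (b x) (c x) (a x)) (z x)) \<in> borel_measurable N"
  by (rule borel_measurable_blinfun_apply_Caratheodory[OF measurable_K0[OF assms(1-3)] assms(4)])

lemma measurable_K0_adjoint: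
  assumes "a \<in> N \<rightarrow>\<^sub>M P" "b \<in> borel_measurable N" "c \<in> N \<rightarrow>\<^sub>M half_line" "q \<in> borel_measurable N"
  shows "(\<lambda>x. adjoint (blinfun_apply (K\<^sub>0 (b x) (c x) (a x))) (q x)) \<in> borel_measurable N"
  by (rule borel_measurable_adjoint[OF measurable_K0[OF assms(1-3)] assms(4)])

lemma Z_progressive: "progressive F {..T} Z" and Q_progressive: "progressive F {0..T} Q"
  using Z Q by (auto simp: M2_def)

lemma Z0_joint: "(\<lambda>(t, w). Z\<^sub>0 t w) \<in> borel_measurable (borel \<Otimes>\<^sub>M P)"
  unfolding Z\<^sub>0_def by (rule progressive_mask(2)[OF Z_progressive, of T]) auto

lemma Q0_joint: "(\<lambda>(t, w). Q\<^sub>0 t w) \<in> borel_measurable (borel \<Otimes>\<^sub>M P)"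
  unfolding Q\<^sub>0_def by (rule progressive_mask(2)[OF Q_progressive, of T]) (use T_pos in auto)

lemma measurable_Z0:
  assumes "b \<in> borel_measurable N" "a \<in> N \<rightarrow>\<^sub>M P"
  shows "(\<lambda>x. Z\<^sub>0 (b x) (a x)) \<in> borel_measurable N"
  using measurable_compose[OF measurable_Pair[OF assms] Z0_joint] by simp

lemma measurable_Q0:
  assumes "b \<in> borel_measurable N" "a \<in> N \<rightarrow>\<^sub>M P"
  shows "(\<lambda>x. Q\<^sub>0 (b x) (a x)) \<in> borel_measurable N"
  using measurable_compose[OF measurable_Pair[OF assms] Q0_joint] by simp

lemma measurable_half_line: "f \<in> N \<rightarrow>\<^sub>M half_line \<Longrightarrow> f \<in> borel_measurable N"
  by (simp add: measurable_restrict_space2_iff)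

lemma measurable_signed_integral:
  fixes f :: "'x \<Rightarrow> real \<Rightarrow> 'b::{banach, second_countable_topology}"
  assumes "(\<lambda>(x, \<theta>). f x \<theta>) \<in> borel_measurable (N \<Otimes>\<^sub>M half_line)"
  shows "(\<lambda>x. signed_integral half_line \<alpha> (f x)) \<in> borel_measurable N"
proof -
  have "(\<lambda>(x, \<theta>). f x \<theta>) \<in> borel_measurable (N \<Otimes>\<^sub>M pos)" "(\<lambda>(x, \<theta>). f x \<theta>) \<in> borel_measurable (N \<Otimes>\<^sub>M neg)"
    using assms by (simp_all add: pos.measurable_pair_\<nu> neg.measurable_pair_\<nu>)
  then show ?thesis
    unfolding signed_integral_def
    by (intro borel_measurable_diff pos.borel_measurable_lebesgue_integral neg.borel_measurable_lebesgue_integral)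
qed

lemma measurable_KZ:
  assumes "a \<in> N \<rightarrow>\<^sub>M P" "b \<in> borel_measurable N" "c \<in> N \<rightarrow>\<^sub>M half_line"
  shows "(\<lambda>x. blinfun_apply (K\<^sub>0 (b x) (c x) (a x)) (Z\<^sub>0 (b x - c x) (a x))) \<in> borel_measurable N"
    and "(\<lambda>x. ennreal (norm (K\<^sub>0 (b x) (c x) (a x))) * ennreal (norm (Z\<^sub>0 (b x - c x) (a x)))) \<in> borel_measurable N"
proof -
  have Z: "(\<lambda>x. Z\<^sub>0 (b x - c x) (a x)) \<in> borel_measurable N"
    using assms measurable_half_line[OF assms(3)] by (intro measurable_Z0 borel_measurable_diff)
  show "(\<lambda>x. blinfun_apply (K\<^sub>0 (b x) (c x) (a x)) (Z\<^sub>0 (b x - c x) (a x))) \<in> borel_measurable N"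
    by (rule measurable_K0_apply[OF assms Z])
  show "(\<lambda>x. ennreal (norm (K\<^sub>0 (b x) (c x) (a x))) * ennreal (norm (Z\<^sub>0 (b x - c x) (a x)))) \<in> borel_measurable N"
    using measurable_norm_K0[OF assms] Z by measurable
qed

lemma measurable_KQ:
  assumes "a \<in> N \<rightarrow>\<^sub>M P" "b \<in> borel_measurable N" "c \<in> N \<rightarrow>\<^sub>M half_line"
  shows "(\<lambda>x. adjoint (blinfun_apply (K\<^sub>0 (b x + c x) (c x) (a x))) (Q\<^sub>0 (b x + c x) (a x))) \<in> borel_measurable N"
proof -
  have "(\<lambda>x. b x + c x) \<in> borel_measurable N"
    using assms(2) measurable_half_line[OF assms(3)] by (rule borel_measurable_add)
  with assms show ?thesis by (intro measurable_K0_adjoint measurable_Q0)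
qed

lemma R_joint: "jointly_measurable R"
proof -
  have "(\<lambda>p. R (fst p) (snd p)) \<in> borel_measurable dtP"
    unfolding R_def
    by (rule measurable_signed_integral, unfold case_prod_unfold, rule measurable_KZ) measurable
  then show ?thesis by (simp add: case_prod_unfold)
qed

lemma Y_joint: "jointly_measurable Y"
proof -
  have "(\<lambda>p. Y (fst p) (snd p)) \<in> borel_measurable dtP"
    unfolding Y_def
    by (rule measurable_signed_integral, unfold case_prod_unfold, rule measurable_KQ) measurable
  then show ?thesis by (simp add: case_prod_unfold)
qed

lemma Z0_joint_lborel: "jointly_measurable Z\<^sub>0"
  and Q0_joint_lborel: "jointly_measurable Q\<^sub>0"
  using Z0_joint Q0_joint
  by (simp_all add: measurable_cong_sets[OF sets_pair_measure_cong[OF sets_lborel refl] refl])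

section \<open>Pathwise bounds and pathwise duality\<close>

lemma path_K0:
  assumes "w \<in> space P" "sets \<nu> = sets half_line"
  shows "(\<lambda>(t, \<theta>). blinfun_apply (K\<^sub>0 t \<theta> w) e) \<in> borel_measurable (lborel \<Otimes>\<^sub>M \<nu>)"
    and "(\<lambda>(t, \<theta>). norm (K\<^sub>0 t \<theta> w)) \<in> borel_measurable (lborel \<Otimes>\<^sub>M \<nu>)"
proof -
  let ?N = "lborel \<Otimes>\<^sub>M half_line"
  have m: "(\<lambda>x. w) \<in> ?N \<rightarrow>\<^sub>M P" "fst \<in> borel_measurable ?N" "snd \<in> ?N \<rightarrow>\<^sub>M half_line"
    using assms by measurable
  have c: "measurable ?N N' = measurable (lborel \<Otimes>\<^sub>M \<nu>) N'" for N' :: "'z measure"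
    using assms(2) by (intro measurable_cong_sets sets_pair_measure_cong) auto
  show "(\<lambda>(t, \<theta>). blinfun_apply (K\<^sub>0 t \<theta> w) e) \<in> borel_measurable (lborel \<Otimes>\<^sub>M \<nu>)"
    "(\<lambda>(t, \<theta>). norm (K\<^sub>0 t \<theta> w)) \<in> borel_measurable (lborel \<Otimes>\<^sub>M \<nu>)"
    using measurable_K0[OF m] measurable_norm_K0[OF m] unfolding c by (simp_all add: case_prod_unfold)
qed

lemma path_Z0: "w \<in> space P \<Longrightarrow> (\<lambda>t. Z\<^sub>0 t w) \<in> borel_measurable borel"
  and path_Q0: "w \<in> space P \<Longrightarrow> (\<lambda>t. Q\<^sub>0 t w) \<in> borel_measurable borel"
  by (intro measurable_Z0 measurable_Q0 measurable_const; simp)+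

lemma norm_Z0: "L2_process Z\<^sub>0 < \<infinity>"
proof -
  have "L2_process Z\<^sub>0 =
      L2_process_on {..T} Z"
    by (intro nn_integral_cong) (auto simp: Z\<^sub>0_def indicator_def)
  then show ?thesis using Z by (simp add: M2_def)
qed

lemma norm_Q0: "L2_process Q\<^sub>0 =
    L2_process_on {0..T} Q"
  by (intro nn_integral_cong) (auto simp: Q\<^sub>0_def indicator_def)

lemma norm_Q0_finite: "L2_process Q\<^sub>0 < \<infinity>"
  using Q unfolding norm_Q0 by (simp add: M2_def)

text \<open>The suprema in the hypotheses stand inside the almost sure event, so one null set serves
  all times. For \<open>u > T\<close> the extended kernel vanishes along the whole diagonal.\<close>

lemma AE_kernel_bounds:
  "AE w in P. (\<forall>t. (\<integral>\<^sup>+\<theta>. norm (K\<^sub>0 t \<theta> w) \<partial>tot) \<le> M\<^sub>0) \<and> (\<forall>u. (\<integral>\<^sup>+\<theta>. norm (K\<^sub>0 (u + \<theta>) \<theta> w) \<partial>tot) \<le> M)"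
  using M0_bound M_bound
proof eventually_elim
  case (elim w)
  show ?case
  proof (intro conjI allI)
    fix t
    show "(\<integral>\<^sup>+\<theta>. norm (K\<^sub>0 t \<theta> w) \<partial>tot) \<le> M\<^sub>0"
      using elim(1) by (cases "t \<in> {0..T}") (auto simp: K\<^sub>0_def SUP_le_iff)
  next
    fix u
    show "(\<integral>\<^sup>+\<theta>. norm (K\<^sub>0 (u + \<theta>) \<theta> w) \<partial>tot) \<le> M"
    proof (cases "u \<le> T")
      case True
      have "(\<integral>\<^sup>+\<theta>. norm (K\<^sub>0 (u + \<theta>) \<theta> w) \<partial>tot) =
          (\<integral>\<^sup>+\<theta>. ennreal (norm (K (u + \<theta>) \<theta> w)) * indicator {0..T} (u + \<theta>) \<partial>tot)"
        by (intro nn_integral_cong) (auto simp: K\<^sub>0_def indicator_def)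
      also have "\<dots> \<le> M" using elim(2) True by (auto simp: SUP_le_iff)
      finally show ?thesis .
    next
      case False
      have "(\<integral>\<^sup>+\<theta>. norm (K\<^sub>0 (u + \<theta>) \<theta> w) \<partial>tot) = (\<integral>\<^sup>+\<theta>. 0 \<partial>tot)"
        using False by (intro nn_integral_cong) (auto simp: K\<^sub>0_def tot.space_\<nu>)
      then show ?thesis by simp
    qed
  qed
qed

text \<open>The absolute majorant of \<open>R\<close>. The norm of \<open>R\<close> cannot certify
  convergence of the integral that defines it, since a divergent integral has a default value;
  finiteness of \<open>G\<close> can.\<close>

definition G :: "real \<Rightarrow> 'w \<Rightarrow> ennreal" where
  "G t w = (\<integral>\<^sup>+\<theta>. norm (K\<^sub>0 t \<theta> w) * ennreal (norm (Z\<^sub>0 (t - \<theta>) w)) \<partial>tot)"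

lemma AE_G_L2: "AE w in P. (\<integral>\<^sup>+t. (G t w)\<^sup>2 \<partial>lborel) \<le> M\<^sub>0 * M * L2_sq lborel (\<lambda>t. Z\<^sub>0 t w)"
  using AE_kernel_bounds AE_space
proof eventually_elim
  case (elim w)
  note [measurable] = path_Z0[OF elim(2)]
  have "(\<integral>\<^sup>+t. (G t w)\<^sup>2 \<partial>lborel) \<le> M\<^sub>0 * M * (\<integral>\<^sup>+t. (ennreal (norm (Z\<^sub>0 t w)))\<^sup>2 \<partial>lborel)"
    unfolding G_def
    by (rule tot.kernel_L2_backward[where z="\<lambda>t. ennreal (norm (Z\<^sub>0 t w))"])
      (use elim path_K0(2)[OF elim(2) tot.sets_\<nu>] in auto)
  then show ?case by (simp add: ennreal_power)
qed

lemma AE_Y_L2: "AE w in P. L2_sq lborel (\<lambda>t. Y t w) \<le> M\<^sub>0 * M * L2_sq lborel (\<lambda>t. Q\<^sub>0 t w)"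
  using AE_kernel_bounds AE_space
proof eventually_elim
  case (elim w)
  note [measurable] = path_Q0[OF elim(2)]
  let ?H = "\<lambda>t. \<integral>\<^sup>+\<theta>. norm (K\<^sub>0 (t + \<theta>) \<theta> w) * ennreal (norm (Q\<^sub>0 (t + \<theta>) w)) \<partial>tot"
  have "L2_sq lborel (\<lambda>t. Y t w) \<le> (\<integral>\<^sup>+t. (?H t)\<^sup>2 \<partial>lborel)"
  proof (rule nn_integral_mono)
    fix t
    have "ennreal (norm (Y t w)) \<le> (\<integral>\<^sup>+\<theta>. norm (adjoint (blinfun_apply (K\<^sub>0 (t + \<theta>) \<theta> w)) (Q\<^sub>0 (t + \<theta>) w)) \<partial>tot)"
      unfolding Y_def by (rule signed.norm_signed_integral_le, rule measurable_KQ) (use elim in auto)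
    also have "\<dots> \<le> ?H t"
      by (intro nn_integral_mono) (auto simp: ennreal_mult''[symmetric] intro!: ennreal_leI norm_adjoint_le)
    finally have "(ennreal (norm (Y t w)))\<^sup>2 \<le> (?H t)\<^sup>2" by (rule power_mono) simp
    then show "ennreal ((norm (Y t w))\<^sup>2) \<le> (?H t)\<^sup>2" by (simp add: ennreal_power)
  qed
  also have "\<dots> \<le> M\<^sub>0 * M * (\<integral>\<^sup>+t. (ennreal (norm (Q\<^sub>0 t w)))\<^sup>2 \<partial>lborel)"
    by (rule tot.kernel_L2_forward[where z="\<lambda>t. ennreal (norm (Q\<^sub>0 t w))"])
      (use elim path_K0(2)[OF elim(2) tot.sets_\<nu>] in auto)
  finally show ?case by (simp add: ennreal_power)
qed

lemma R_norm_le: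
  assumes "w \<in> space P"
  shows "ennreal (norm (R t w)) \<le> G t w"
proof -
  have "ennreal (norm (R t w)) \<le> (\<integral>\<^sup>+\<theta>. norm (blinfun_apply (K\<^sub>0 t \<theta> w) (Z\<^sub>0 (t - \<theta>) w)) \<partial>tot)"
    unfolding R_def by (rule signed.norm_signed_integral_le, rule measurable_KZ) (use assms in auto)
  also have "\<dots> \<le> G t w"
    unfolding G_def by (intro nn_integral_mono) (auto simp: ennreal_mult''[symmetric] intro!: ennreal_leI norm_blinfun)
  finally show ?thesis .
qed

text \<open>The two parts of \<alpha> are dominated by the total variation and inherit its kernel
  bounds. Integrability for each part is needed as well, so that the integrals of the differences
  can be split.\<close>

lemma AE_duality:
  "AE w in P. (\<integral>t. inner (R t w) (Q\<^sub>0 t w) \<partial>lborel) = (\<integral>u. inner (Z\<^sub>0 u w) (Y u w) \<partial>lborel)"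
proof -
  have [measurable]: "(\<lambda>x. Z\<^sub>0 (snd x) (fst x)) \<in> borel_measurable (P \<Otimes>\<^sub>M lborel)"
    "(\<lambda>x. Q\<^sub>0 (snd x) (fst x)) \<in> borel_measurable (P \<Otimes>\<^sub>M lborel)"
    by (intro measurable_Z0 measurable_Q0; simp)+
  have "(\<lambda>w. \<integral>\<^sup>+t. ennreal ((norm (Z\<^sub>0 t w))\<^sup>2) \<partial>lborel) \<in> borel_measurable P"
    "(\<lambda>w. \<integral>\<^sup>+t. ennreal ((norm (Q\<^sub>0 t w))\<^sup>2) \<partial>lborel) \<in> borel_measurable P"
    by measurable
  from nn_integral_PInf_AE[OF this(1)] nn_integral_PInf_AE[OF this(2)] norm_Z0 norm_Q0_finite
  have "AE w in P. L2_sq lborel (\<lambda>t. Z\<^sub>0 t w) \<noteq> \<infinity>"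
    "AE w in P. L2_sq lborel (\<lambda>t. Q\<^sub>0 t w) \<noteq> \<infinity>"
    by simp_all
  with AE_kernel_bounds AE_space show ?thesis
  proof eventually_elim
    case (elim w)
    have le: "(\<integral>\<^sup>+\<theta>. f \<theta> \<partial>pos) \<le> (\<integral>\<^sup>+\<theta>. f \<theta> \<partial>tot)" "(\<integral>\<^sup>+\<theta>. f \<theta> \<partial>neg) \<le> (\<integral>\<^sup>+\<theta>. f \<theta> \<partial>tot)"
      if "f \<in> borel_measurable half_line" for f
      using signed.nn_integral_total[OF that] by auto
    have m: "(\<lambda>\<theta>. w) \<in> half_line \<rightarrow>\<^sub>M P" "(\<lambda>\<theta>. \<theta>) \<in> half_line \<rightarrow>\<^sub>M half_line" using elim by auto
    have s: "(\<lambda>\<theta>. t + \<theta>) \<in> borel_measurable half_line" for t using measurable_half_line[OF m(2)] by simp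
    have k: "(\<lambda>\<theta>. ennreal (norm (K\<^sub>0 t \<theta> w))) \<in> borel_measurable half_line"
      "(\<lambda>\<theta>. ennreal (norm (K\<^sub>0 (t + \<theta>) \<theta> w))) \<in> borel_measurable half_line" for t
      using measurable_norm_K0[OF m(1) _ m(2), of "\<lambda>_. t"] measurable_norm_K0[OF m(1) s m(2)] by auto
    have bd: "(\<integral>\<^sup>+\<theta>. norm (K\<^sub>0 t \<theta> w) \<partial>pos) \<le> M\<^sub>0" "(\<integral>\<^sup>+\<theta>. norm (K\<^sub>0 t \<theta> w) \<partial>neg) \<le> M\<^sub>0"
      "(\<integral>\<^sup>+\<theta>. norm (K\<^sub>0 (t + \<theta>) \<theta> w) \<partial>pos) \<le> M" "(\<integral>\<^sup>+\<theta>. norm (K\<^sub>0 (t + \<theta>) \<theta> w) \<partial>neg) \<le> M" for t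
      using le[OF k(1)[of t]] le[OF k(2)[of t]] elim(1) order_trans by blast+
    have z2: "L2_sq lborel (\<lambda>t. Z\<^sub>0 t w) < \<infinity>" "L2_sq lborel (\<lambda>t. Q\<^sub>0 t w) < \<infinity>"
      using elim by (auto simp: less_top)
    note pos = pos.kernel_duality[OF path_K0(1)[OF elim(2) pos.sets_\<nu>] path_Z0[OF elim(2)] path_Q0[OF elim(2)] z2 bd(1) bd(3) M0_fin M_fin]
    note neg = neg.kernel_duality[OF path_K0(1)[OF elim(2) neg.sets_\<nu>] path_Z0[OF elim(2)] path_Q0[OF elim(2)] z2 bd(2) bd(4) M0_fin M_fin]
    show ?case
      unfolding R_def Y_def signed_integral_def inner_diff_left inner_diff_right
      using pos neg by simp
  qed
qed

lemma G_joint: "jointly_measurable G"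
proof -
  have "(\<lambda>(x, \<theta>). ennreal (norm (K\<^sub>0 (fst x) \<theta> (snd x))) * ennreal (norm (Z\<^sub>0 (fst x - \<theta>) (snd x))))
      \<in> borel_measurable (dtP \<Otimes>\<^sub>M half_line)"
    unfolding case_prod_unfold by (rule measurable_KZ) measurable
  then have "(\<lambda>p. G (fst p) (snd p)) \<in> borel_measurable dtP"
    unfolding G_def
    by (intro tot.borel_measurable_nn_integral)
      (simp add: tot.measurable_pair_\<nu>)
  then show ?thesis by (simp add: case_prod_unfold)
qed

lemma L2_scaled_bound:
  fixes f :: "'w \<Rightarrow> ennreal" and g :: "real \<Rightarrow> 'w \<Rightarrow> 'b::{real_normed_vector, second_countable_topology}"
  assumes le: "AE w in P. f w \<le> M\<^sub>0 * M * L2_sq lborel (\<lambda>t. g t w)"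
    and g: "(\<lambda>(t, w). g t w) \<in> borel_measurable (borel \<Otimes>\<^sub>M P)"
  shows "(\<integral>\<^sup>+w. f w \<partial>P) \<le> M\<^sub>0 * M * L2_process g"
proof -
  have "(\<lambda>x. (snd x, fst x)) \<in> P \<Otimes>\<^sub>M lborel \<rightarrow>\<^sub>M borel \<Otimes>\<^sub>M P" by measurable
  from measurable_compose[OF this g]
  have [measurable]: "(\<lambda>x. g (snd x) (fst x)) \<in> borel_measurable (P \<Otimes>\<^sub>M lborel)" by simp
  have "(\<integral>\<^sup>+w. f w \<partial>P) \<le> (\<integral>\<^sup>+w. M\<^sub>0 * M * L2_sq lborel (\<lambda>t. g t w) \<partial>P)"
    using le by (rule nn_integral_mono_AE)
  also have "\<dots> = M\<^sub>0 * M * L2_process g"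
    by (rule nn_integral_cmult) measurable
  finally show ?thesis .
qed

lemma G_L2: "(\<integral>\<^sup>+w. (\<integral>\<^sup>+t. (G t w)\<^sup>2 \<partial>lborel) \<partial>P) < \<infinity>"
proof -
  have "(\<integral>\<^sup>+w. (\<integral>\<^sup>+t. (G t w)\<^sup>2 \<partial>lborel) \<partial>P) \<le> M\<^sub>0 * M * L2_process Z\<^sub>0"
    by (rule L2_scaled_bound[OF AE_G_L2 Z0_joint])
  also have "\<dots> < \<infinity>" using M0_fin M_fin norm_Z0 by (simp add: ennreal_mult_less_top)
  finally show ?thesis .
qed

lemma R_L2: "L2_process R < \<infinity>"
proof -
  have "L2_process R \<le> (\<integral>\<^sup>+w. (\<integral>\<^sup>+t. (G t w)\<^sup>2 \<partial>lborel) \<partial>P)"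
  proof (intro nn_integral_mono)
    fix t w assume "w \<in> space P"
    from power_mono[OF R_norm_le[OF this, of t], of 2]
    show "ennreal ((norm (R t w))\<^sup>2) \<le> (G t w)\<^sup>2" by (simp add: ennreal_power)
  qed
  with G_L2 show ?thesis by (rule le_less_trans[rotated])
qed

text \<open>The left side runs over the whole line, including negative times.\<close>

lemma Y_L2: "L2_process Y \<le>
    M\<^sub>0 * M * L2_process_on {0..T} Q"
  using L2_scaled_bound[OF AE_Y_L2 Q0_joint] unfolding norm_Q0 .

lemma Y_L2_finite: "L2_process Y < \<infinity>"
proof -
  have "M\<^sub>0 * M * L2_process_on {0..T} Q < \<infinity>"
    using M0_fin M_fin Q by (simp add: M2_def ennreal_mult_less_top)
  with Y_L2 show ?thesis by (rule le_less_trans)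
qed

section \<open>Adaptedness of the delay operator\<close>

lemma Z0_adapted:
  assumes "s \<le> t" "s \<le> T"
  shows "Z\<^sub>0 s \<in> borel_measurable (F t)"
proof -
  have "Z s \<in> borel_measurable (F s)" using progressive_adapted[OF Z_progressive, of s] assms by simp
  then have "Z s \<in> borel_measurable (F t)" by (rule measurable_F_mono[OF assms(1)])
  moreover have "Z\<^sub>0 s = Z s" using assms by (simp add: Z\<^sub>0_def fun_eq_iff)
  ultimately show ?thesis by simp
qed

text \<open>The exceptional times are those at which \<open>G t\<close> is not square integrable
  over \<open>P\<close>. At all other times of the interval, the integrand is integrable jointly in
  delay and path, as \<open>integral_adapted\<close> requires.\<close>

lemma AE_R_adapted: "AE t in lborel. t \<in> {0..T} \<longrightarrow> R t \<in> borel_measurable (F t)"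
proof -
  note [measurable] = G_joint
  have "(\<integral>\<^sup>+t. (\<integral>\<^sup>+w. (G t w)\<^sup>2 \<partial>P) \<partial>lborel) = (\<integral>\<^sup>+w. (\<integral>\<^sup>+t. (G t w)\<^sup>2 \<partial>lborel) \<partial>P)"
    by (rule nn_integral_swap(1)[symmetric]) measurable
  with G_L2 have "(\<integral>\<^sup>+t. (\<integral>\<^sup>+w. (G t w)\<^sup>2 \<partial>P) \<partial>lborel) \<noteq> \<infinity>" by simp
  then have "AE t in lborel. (\<integral>\<^sup>+w. (G t w)\<^sup>2 \<partial>P) \<noteq> \<infinity>"
    by (intro nn_integral_PInf_AE) measurable
  then show ?thesis
  proof eventually_elim
    case (elim t)
    show ?case
    proof
      assume t: "t \<in> {0..T}"
      have Gt[measurable]: "G t \<in> borel_measurable P" by (rule process_section(1)[OF G_joint])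
      \<comment> \<open>On a probability space this turns a finite second moment into a finite first
        moment.\<close>
      have "x \<le> 1 + x\<^sup>2" for x :: ennreal
        using ennreal_mult_le_squares[of 1 x] by simp
      then have "(\<integral>\<^sup>+w. G t w \<partial>P) \<le> (\<integral>\<^sup>+w. 1 + (G t w)\<^sup>2 \<partial>P)" by (rule nn_integral_mono)
      also have "\<dots> = 1 + (\<integral>\<^sup>+w. (G t w)\<^sup>2 \<partial>P)"
        by (subst nn_integral_add) (auto simp: emeasure_space_1)
      also have "\<dots> < \<infinity>" using elim by (simp add: less_top)
      finally have G1: "(\<integral>\<^sup>+w. G t w \<partial>P) < \<infinity>" .
      let ?X = "\<lambda>\<theta> w. blinfun_apply (K\<^sub>0 t \<theta> w) (Z\<^sub>0 (t - \<theta>) w)"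
      \<comment> \<open>Stated for a general measure below the total variation, so that
        \<open>G\<close> dominates for both parts of \<alpha>.\<close>
      have part: "(\<lambda>w. \<integral>\<theta>. ?X \<theta> w \<partial>\<nu>) \<in> borel_measurable (F t)"
        if \<nu>: "delay_kernel_measure \<nu>"
          and le: "\<And>f. f \<in> borel_measurable half_line \<Longrightarrow> (\<integral>\<^sup>+\<theta>. f \<theta> \<partial>\<nu>) \<le> (\<integral>\<^sup>+\<theta>. f \<theta> \<partial>tot)" for \<nu>
      proof (rule integral_adapted)
        interpret \<nu>: delay_kernel_measure \<nu> by fact
        interpret \<nu>P: pair_sigma_finite \<nu> P ..
        show "sigma_finite_measure \<nu>" by unfold_locales
        have "(\<lambda>(\<theta>, w). ?X \<theta> w) \<in> borel_measurable (half_line \<Otimes>\<^sub>M P)"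
          unfolding case_prod_unfold by (rule measurable_KZ) auto
        then have X: "(\<lambda>(\<theta>, w). ?X \<theta> w) \<in> borel_measurable (\<nu> \<Otimes>\<^sub>M P)"
          by (simp add: \<nu>.measurable_pair_\<nu>)
        show "integrable (\<nu> \<Otimes>\<^sub>M P) (\<lambda>(\<theta>, w). ?X \<theta> w)"
        proof (rule integrableI_bounded[OF X])
          have "(\<lambda>p. ennreal (norm (case p of (\<theta>, w) \<Rightarrow> ?X \<theta> w))) \<in> borel_measurable (\<nu> \<Otimes>\<^sub>M P)" using X by simp
          from \<nu>P.nn_integral_snd[OF this]
          have "(\<integral>\<^sup>+p. norm (case p of (\<theta>, w) \<Rightarrow> ?X \<theta> w) \<partial>(\<nu> \<Otimes>\<^sub>M P)) = (\<integral>\<^sup>+w. (\<integral>\<^sup>+\<theta>. norm (?X \<theta> w) \<partial>\<nu>) \<partial>P)"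
            by simp
          also have "\<dots> \<le> (\<integral>\<^sup>+w. G t w \<partial>P)"
          proof (rule nn_integral_mono)
            fix w assume w: "w \<in> space P"
            have "(\<lambda>\<theta>. ?X \<theta> w) \<in> borel_measurable half_line" by (rule measurable_KZ) (use w in auto)
            then have "(\<lambda>\<theta>. ennreal (norm (?X \<theta> w))) \<in> borel_measurable half_line" by simp
            then have "(\<integral>\<^sup>+\<theta>. norm (?X \<theta> w) \<partial>\<nu>) \<le> (\<integral>\<^sup>+\<theta>. norm (?X \<theta> w) \<partial>tot)" by (rule le)
            also have "\<dots> \<le> G t w"
              unfolding G_def
              by (intro nn_integral_mono) (auto simp: ennreal_mult''[symmetric] intro!: ennreal_leI norm_blinfun)
            finally show "(\<integral>\<^sup>+\<theta>. norm (?X \<theta> w) \<partial>\<nu>) \<le> G t w" .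
          qed
          finally show "(\<integral>\<^sup>+p. norm (case p of (\<theta>, w) \<Rightarrow> ?X \<theta> w) \<partial>(\<nu> \<Otimes>\<^sub>M P)) < \<infinity>" using G1 by simp
        qed
        fix \<theta> assume "\<theta> \<in> space \<nu>"
        then have \<theta>: "0 \<le> \<theta>" by (simp add: \<nu>.space_\<nu>)
        show "?X \<theta> \<in> borel_measurable (F t)"
        proof (rule borel_measurable_blinfun_apply_Caratheodory)
          show "(\<lambda>w. blinfun_apply (K\<^sub>0 t \<theta> w) e) \<in> borel_measurable (F t)" for e
            using K_adapted[OF t \<theta>] t by (simp add: K\<^sub>0_def)
          \<comment> \<open>The delay is nonnegative, so only the past of \<open>Z\<close> up to
            time \<open>t\<close> occurs.\<close>
          show "(\<lambda>w. Z\<^sub>0 (t - \<theta>) w) \<in> borel_measurable (F t)"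
            using Z0_adapted[of "t - \<theta>" t] \<theta> t by simp
        qed
      qed
      have "(\<lambda>w. R t w) \<in> borel_measurable (F t)"
        unfolding R_def signed_integral_def
        by (intro borel_measurable_diff part pos.delay_kernel_measure_axioms neg.delay_kernel_measure_axioms)
          (auto simp: signed.nn_integral_total)
      then show "R t \<in> borel_measurable (F t)" by simp
    qed
  qed
qed

lemma measurable_restrict_process:
  assumes "(\<lambda>(t, w). f t w) \<in> dtP \<rightarrow>\<^sub>M N"
  shows "(\<lambda>(t, w). f t w) \<in> restrict_space lborel A \<Otimes>\<^sub>M P \<rightarrow>\<^sub>M N"
proof -
  have "(\<lambda>p. (fst p, snd p)) \<in> restrict_space lborel A \<Otimes>\<^sub>M P \<rightarrow>\<^sub>M lborel \<Otimes>\<^sub>M P"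
    by (intro measurable_Pair measurable_snd measurable_compose[OF measurable_fst] measurable_restrict_space1) simp
  from measurable_compose[OF this assms] show ?thesis by (simp add: case_prod_unfold)
qed

lemma delay_op_represents_M2: "represents_M2 P F {0..T} (delay_op \<alpha> K Z)"
proof -
  let ?I = "restrict_space lborel {0..T} :: real measure"
  interpret I: pair_sigma_finite ?I P
    by (intro pair_sigma_finite.intro sigma_finite_measure_restrict_space sigma_finite_measure_axioms
        lborel.sigma_finite_measure_axioms) simp
  have R_m: "(\<lambda>(t, w). R t w) \<in> borel_measurable (?I \<Otimes>\<^sub>M P)"
    by (rule measurable_restrict_process[OF R_joint])
  have eqR: "delay_op \<alpha> K Z (fst p) (snd p) = R (fst p) (snd p)" if "p \<in> space (?I \<Otimes>\<^sub>M P)" for p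
    using that by (intro delay_op_eq) (auto simp: space_pair_measure space_restrict_space)
  have D_m: "(\<lambda>(t, w). delay_op \<alpha> K Z t w) \<in> borel_measurable (?I \<Otimes>\<^sub>M P)"
    using R_m eqR by (subst measurable_cong[where g="\<lambda>(t, w). R t w"]) (auto simp: case_prod_unfold)
  \<comment> \<open>The support in the bounded interval yields integrability of \<open>R\<close>
    from its \<open>L^2\<close> bound.\<close>
  have "R t w = 0" if "t \<notin> {0..T}" for t w
    using that by (auto simp: R_def K\<^sub>0_def signed_integral_def zero_blinfun.rep_eq)
  then have iR: "integrable dtP (\<lambda>(t, w). R t w)"
    by (intro integrable_process_L2[OF R_joint R_L2]) auto
  obtain V where V: "opt_proj T R V"
    using optional_projection_exists[OF iR, of T] by auto
  have prog: "progressive F {0..T} V" using V optional_progressive by (auto simp: is_optional_projection_def)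
  have "L2_process_on {0..T} V \<le>
      L2_process_on {0..T} R"
    using T_pos by (intro optional_projection_L2 V R_joint) auto
  also have "\<dots> \<le> L2_process R"
    by (intro nn_integral_mono) (auto simp: indicator_def)
  also have "\<dots> < \<infinity>" by (rule R_L2)
  finally have V_M2: "V \<in> M2 P F {0..T}" using prog by (simp add: M2_def)
  have V_m: "(\<lambda>(t, w). V t w) \<in> borel_measurable (?I \<Otimes>\<^sub>M P)"
    using progressive_mask(1)[OF prog, of T] T_pos
    by (simp add: measurable_cong_sets[OF sets_pair_measure_cong[OF sets_restrict_space_cong[OF sets_lborel] refl] refl])
  have ce: "AE t in lborel. t \<in> {0..T} \<longrightarrow> is_cond_exp P (F t) (R t) (V t)"
    using V by (auto simp: is_optional_projection_def)
  have "AE t in lborel. t \<in> {0..T} \<longrightarrow> (AE w in P. R t w = V t w)"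
    using ce AE_R_adapted
  proof eventually_elim
    case (elim t)
    show ?case
    proof
      assume "t \<in> {0..T}"
      with elim have c: "is_cond_exp P (F t) (R t) (V t)" and a: "R t \<in> borel_measurable (F t)" by auto
      have "is_cond_exp P (F t) (R t) (R t)" using c a by (intro is_cond_exp_self) (auto simp: is_cond_exp_def)
      from is_cond_exp_AE_unique[OF prob_space_axioms subalgebra_F this c] show "AE w in P. R t w = V t w" .
    qed
  qed
  then have "AE t in ?I. AE w in P. R t w = V t w"
    by (subst AE_restrict_space_iff) auto
  then have "AE t in ?I. AE w in P. delay_op \<alpha> K Z t w = V t w"
    using AE_space by eventually_elim (simp add: delay_op_eq space_restrict_space)
  \<comment> \<open>Almost sure equality at almost every time becomes equality almost everywhere on
    the product, because the coincidence set is measurable there.\<close>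
  moreover have "{p \<in> space (?I \<Otimes>\<^sub>M P). (\<lambda>(t, w). delay_op \<alpha> K Z t w) p = (\<lambda>(t, w). V t w) p} \<in> sets (?I \<Otimes>\<^sub>M P)"
    using D_m V_m by measurable
  ultimately have "AE p in ?I \<Otimes>\<^sub>M P. (\<lambda>(t, w). delay_op \<alpha> K Z t w) p = (\<lambda>(t, w). V t w) p"
    by (intro I.AE_pair_measure) auto
  then show ?thesis
    using D_m V_M2 by (auto simp: represents_M2_def case_prod_unfold)
qed

lemma anticipating_adjoint_eq_Y: "anticipating_adjoint \<alpha> T K Q = Y"
  by (simp add: fun_eq_iff anticipating_adjoint_eq)

lemma adjoint_projection_exists: "\<exists>AQ. opt_proj T (anticipating_adjoint \<alpha> T K Q) AQ"
proof -
  \<comment> \<open>\<open>Y\<close> need not vanish at negative times. Cutting it to the bounded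
    interval makes it integrable and does not affect the projection on
    \<open>{0..T}\<close>.\<close>
  define Y' where "Y' t w = (if t \<in> {0..T} then Y t w else 0)" for t w
  have [measurable]: "(\<lambda>p. Y (fst p) (snd p)) \<in> borel_measurable dtP"
    using Y_joint by (simp add: case_prod_unfold)
  have m: "jointly_measurable Y'"
    unfolding Y'_def case_prod_unfold by measurable
  have "L2_process Y' \<le> L2_process Y"
    by (intro nn_integral_mono) (auto simp: Y'_def)
  then have "integrable dtP (\<lambda>(t, w). Y' t w)"
    using Y_L2_finite by (intro integrable_process_L2[OF m]) (auto simp: Y'_def)
  from optional_projection_exists[OF this, of T] obtain V where "opt_proj T Y' V" by auto
  then have "opt_proj T Y V"
    by (rule optional_projection_cong) (simp add: Y'_def)
  then show ?thesis unfolding anticipating_adjoint_eq_Y by blast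
qed

text \<open>The hypothesis on \<open>Z\<close> has an exceptional event for each time; exchanging
  the quantifiers by Fubini leaves, for almost every path, a null set of times.\<close>

lemma Z0_nonpos: "AE w in P. AE u in lborel. u \<le> 0 \<longrightarrow> Z\<^sub>0 u w = 0"
proof -
  have [measurable]: "(\<lambda>p. Z\<^sub>0 (fst p) (snd p)) \<in> borel_measurable dtP"
    using Z0_joint_lborel by (simp add: case_prod_unfold)
  have "{p \<in> space dtP. fst p \<le> 0 \<longrightarrow> Z\<^sub>0 (fst p) (snd p) = 0} \<in> sets dtP"
    by measurable
  moreover have "AE w in P. u \<le> 0 \<longrightarrow> Z\<^sub>0 u w = 0" for u
    using Z_zero[of u] by (cases "u \<le> 0") (auto simp: Z\<^sub>0_def elim: eventually_mono)
  ultimately show ?thesis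
    using lborel_P.AE_commute[of "\<lambda>u w. u \<le> 0 \<longrightarrow> Z\<^sub>0 u w = 0"] by simp
qed

section \<open>Properties of an arbitrary optional projection of the anticipating adjoint\<close>

context
  fixes AQ assumes AQ: "opt_proj T (anticipating_adjoint \<alpha> T K Q) AQ"
begin

lemma AQ_Y: "opt_proj T Y AQ"
  using AQ by (simp add: anticipating_adjoint_eq_Y)

lemma AQ_progressive: "progressive F {0..T} AQ"
  using AQ_Y optional_progressive by (auto simp: is_optional_projection_def)

lemma AQ_bound: "L2_process_on {0..T} AQ
    \<le> M\<^sub>0 * M * L2_process_on {0..T} Q"
proof -
  have "L2_process_on {0..T} AQ \<le>
      L2_process_on {0..T} Y"
    using T_pos by (intro optional_projection_L2 AQ_Y Y_joint) auto
  also have "\<dots> \<le> L2_process Y"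
    by (intro nn_integral_mono) (auto simp: indicator_def)
  also note Y_L2
  finally show ?thesis .
qed

lemma AQ_M2: "AQ \<in> M2 P F {0..T}"
proof -
  have "M\<^sub>0 * M * L2_process_on {0..T} Q < \<infinity>"
    using M0_fin M_fin Q by (simp add: M2_def ennreal_mult_less_top)
  from le_less_trans[OF AQ_bound this] AQ_progressive show ?thesis by (simp add: M2_def)
qed

text \<open>The projection acts at fixed times while the duality holds along fixed paths, so the
  order of integration is exchanged before and after conditioning. \<open>A\<close> and
  \<open>B\<close> cut the projection and \<open>Y\<close> to the interval, so that Fubini can be
  used on the whole line.\<close>

lemma duality:
  "(LINT w|P. (LINT t:{0..T}|lborel. inner (delay_op \<alpha> K Z t w) (Q t w))) =
   (LINT w|P. (LINT t:{0..T}|lborel. inner (Z t w) (AQ t w)))"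
proof -
  define A where "A t w = (if t \<in> {0..T} then AQ t w else 0)" for t w
  define B where "B t w = (if t \<in> {0..T} then Y t w else 0)" for t w
  have Am: "jointly_measurable A"
    using progressive_mask(2)[OF AQ_progressive, of T] T_pos
    by (simp add: A_def measurable_cong_sets[OF sets_pair_measure_cong[OF sets_lborel refl] refl])
  have [measurable]: "(\<lambda>p. Y (fst p) (snd p)) \<in> borel_measurable dtP"
    using Y_joint by (simp add: case_prod_unfold)
  have Bm: "jointly_measurable B"
    unfolding B_def case_prod_unfold by measurable
  have B2: "L2_process B < \<infinity>"
  proof (rule le_less_trans[OF _ Y_L2_finite])
    show "L2_process B \<le> L2_process Y"
      by (intro nn_integral_mono) (auto simp: B_def)
  qed
  have A2: "L2_process A < \<infinity>"
  proof -
    have "L2_process A =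
        L2_process_on {0..T} AQ"
      by (intro nn_integral_cong) (auto simp: A_def indicator_def)
    then show ?thesis using AQ_M2 by (simp add: M2_def)
  qed
  have iZA: "integrable dtP (\<lambda>(t, w). inner (Z\<^sub>0 t w) (A t w))"
    by (rule integrable_inner_process[OF Z0_joint_lborel Am norm_Z0 A2])
  have iZB: "integrable dtP (\<lambda>(t, w). inner (Z\<^sub>0 t w) (B t w))"
    by (rule integrable_inner_process[OF Z0_joint_lborel Bm norm_Z0 B2])
  have iRQ: "integrable dtP (\<lambda>(t, w). inner (R t w) (Q\<^sub>0 t w))"
    by (rule integrable_inner_process[OF R_joint Q0_joint_lborel R_L2 norm_Q0_finite])
  have "(LINT w|P. (LINT t:{0..T}|lborel. inner (delay_op \<alpha> K Z t w) (Q t w))) =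
      (LINT w|P. (LINT t|lborel. inner (R t w) (Q\<^sub>0 t w)))"
    unfolding set_lebesgue_integral_def
    by (intro Bochner_Integration.integral_cong refl) (auto simp: indicator_def Q\<^sub>0_def delay_op_eq)
  \<comment> \<open>The pathwise duality yields \<open>Y\<close> at all times. Passing to
    \<open>B\<close> loses nothing, since the extended \<open>Z\<close> vanishes after
    \<open>T\<close> and, up to null sets, at all times up to \<open>0\<close>.\<close>
  also have "\<dots> = (LINT w|P. (LINT t|lborel. inner (Z\<^sub>0 t w) (B t w)))"
  proof (rule integral_cong_AE)
    show "(\<lambda>w. LINT t|lborel. inner (R t w) (Q\<^sub>0 t w)) \<in> borel_measurable P"
      using lborel_P.integrable_snd[OF iRQ] by auto
    show "(\<lambda>w. LINT t|lborel. inner (Z\<^sub>0 t w) (B t w)) \<in> borel_measurable P"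
      using lborel_P.integrable_snd[OF iZB] by auto
    show "AE w in P. (LINT t|lborel. inner (R t w) (Q\<^sub>0 t w)) = (LINT t|lborel. inner (Z\<^sub>0 t w) (B t w))"
      using AE_duality Z0_nonpos AE_space
    proof eventually_elim
      case (elim w)
      have [measurable]: "(\<lambda>t. Z\<^sub>0 t w) \<in> borel_measurable lborel" "(\<lambda>t. Y t w) \<in> borel_measurable lborel"
        "(\<lambda>t. B t w) \<in> borel_measurable lborel"
        using process_section(2)[OF Z0_joint_lborel elim(3)] process_section(2)[OF Y_joint elim(3)]
          process_section(2)[OF Bm elim(3)] by auto
      have "(LINT t|lborel. inner (Z\<^sub>0 t w) (Y t w)) = (LINT t|lborel. inner (Z\<^sub>0 t w) (B t w))"
      proof (rule integral_cong_AE)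
        show "AE t in lborel. inner (Z\<^sub>0 t w) (Y t w) = inner (Z\<^sub>0 t w) (B t w)"
          using elim(2)
        proof eventually_elim
          case (elim t)
          then show ?case by (cases "t \<le> 0"; cases "t \<le> T") (auto simp: B_def Z\<^sub>0_def)
        qed
      qed measurable
      with elim show ?case by simp
    qed
  qed
  also have "\<dots> = (LINT t|lborel. (LINT w|P. inner (Z\<^sub>0 t w) (B t w)))"
    by (rule lborel_P.Fubini_integral[OF iZB])
  \<comment> \<open>At almost every time both \<open>Z\<close> and \<open>Y\<close> are square
    integrable over \<open>P\<close>, so the conditional expectation may be paired with the adapted
    \<open>Z\<close>.\<close>
  also have "\<dots> = (LINT t|lborel. (LINT w|P. inner (Z\<^sub>0 t w) (A t w)))"
  proof (rule integral_cong_AE)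
    show "(\<lambda>t. LINT w|P. inner (Z\<^sub>0 t w) (B t w)) \<in> borel_measurable lborel"
      using lborel_P.integrable_fst[OF iZB] by auto
    show "(\<lambda>t. LINT w|P. inner (Z\<^sub>0 t w) (A t w)) \<in> borel_measurable lborel"
      using lborel_P.integrable_fst[OF iZA] by auto
    have sq: "AE t in lborel. integrable P (\<lambda>w. (norm (h t w))\<^sup>2)"
      if h: "jointly_measurable h"
        and h2: "L2_process h < \<infinity>" for h :: "real \<Rightarrow> 'w \<Rightarrow> 'e"
      using lborel_P.AE_integrable_fst'[OF integrable_inner_process[OF h h h2 h2]]
      by eventually_elim (simp add: power2_norm_eq_inner)
    have ce: "AE t in lborel. t \<in> {0..T} \<longrightarrow> is_cond_exp P (F t) (Y t) (AQ t)"
      using AQ_Y by (auto simp: is_optional_projection_def)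
    show "AE t in lborel. (LINT w|P. inner (Z\<^sub>0 t w) (B t w)) = (LINT w|P. inner (Z\<^sub>0 t w) (A t w))"
      using sq[OF Z0_joint_lborel norm_Z0] sq[OF Y_joint Y_L2_finite] ce
    proof eventually_elim
      case (elim t)
      show ?case
      proof (cases "t \<in> {0..T}")
        case True
        from elim(3) True have c: "is_cond_exp P (F t) (Y t) (AQ t)" by simp
        have "Z\<^sub>0 t \<in> borel_measurable (F t)" using Z0_adapted[of t t] True by simp
        from is_cond_exp_inner_L2[OF prob_space_axioms subalgebra_F c this elim(2) elim(1)]
        show ?thesis using True by (simp add: A_def B_def inner_commute)
      next
        case False
        then have "A t = (\<lambda>_. 0)" "B t = (\<lambda>_. 0)" by (auto simp: A_def B_def fun_eq_iff)
        then show ?thesis by simp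
      qed
    qed
  qed
  also have "\<dots> = (LINT w|P. (LINT t|lborel. inner (Z\<^sub>0 t w) (A t w)))"
    by (rule lborel_P.Fubini_integral[OF iZA, symmetric])
  also have "\<dots> = (LINT w|P. (LINT t:{0..T}|lborel. inner (Z t w) (AQ t w)))"
    unfolding set_lebesgue_integral_def
    by (intro Bochner_Integration.integral_cong refl) (auto simp: indicator_def A_def Z\<^sub>0_def)
  finally show ?thesis .
qed

end

end

text \<open>The adjoint is determined only up to null sets of time and path. The claims about it are
  therefore made for every optional projection, with existence as a separate conjunct that keeps
  them from being vacuous.\<close>

theorem proposition3p11:
  fixes P :: "'w measure" and F :: "real \<Rightarrow> 'w measure"
    and T :: real and \<alpha> :: "real set \<Rightarrow> real" and M\<^sub>0 M :: ennreal
    and K :: "real \<Rightarrow> real \<Rightarrow> 'w \<Rightarrow>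
              'e::{real_inner, banach, second_countable_topology} \<Rightarrow>\<^sub>L
              'f::{real_inner, banach, second_countable_topology}"
    and Z :: "real \<Rightarrow> 'w \<Rightarrow> 'e" and Q :: "real \<Rightarrow> 'w \<Rightarrow> 'f"
  assumes "usual_filtered_prob_space P F"
    and "T > 0"
    and "finite_signed_measure half_line \<alpha>"
    and K_measurable: "\<And>e. (\<lambda>(\<omega>, t, \<theta>). blinfun_apply (K t \<theta> \<omega>) e)
           \<in> borel_measurable (P \<Otimes>\<^sub>M (restrict_space borel {0..T} \<Otimes>\<^sub>M half_line))"
    and K_adapted: "\<And>t \<theta> e. t \<in> {0..T} \<Longrightarrow> \<theta> \<ge> 0 \<Longrightarrow>
           (\<lambda>\<omega>. blinfun_apply (K t \<theta> \<omega>) e) \<in> borel_measurable (F t)"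
    and "M\<^sub>0 < \<infinity>" and "M < \<infinity>"
    and "AE \<omega> in P.
           (SUP t\<in>{0..T}. \<integral>\<^sup>+\<theta>. ennreal (norm (K t \<theta> \<omega>)) \<partial>total_variation half_line \<alpha>) \<le> M\<^sub>0"
    and "AE \<omega> in P.
           (SUP u\<in>{..T}. \<integral>\<^sup>+\<theta>. ennreal (norm (K (u + \<theta>) \<theta> \<omega>)) * indicator {0..T} (u + \<theta>)
              \<partial>total_variation half_line \<alpha>) \<le> M"
    and "Z \<in> M2 P F {..T}" and "Q \<in> M2 P F {0..T}"
    and Z_zero: "\<And>t. t \<le> 0 \<Longrightarrow> AE \<omega> in P. Z t \<omega> = 0"
  shows "represents_M2 P F {0..T} (delay_op \<alpha> K Z) \<and>
    (\<exists>AQ. is_optional_projection P F {0..T} (anticipating_adjoint \<alpha> T K Q) AQ) \<and>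
    (\<forall>AQ. is_optional_projection P F {0..T} (anticipating_adjoint \<alpha> T K Q) AQ \<longrightarrow>
       AQ \<in> M2 P F {0..T} \<and>
       (LINT \<omega>|P. (LINT t:{0..T}|lborel. inner (delay_op \<alpha> K Z t \<omega>) (Q t \<omega>))) =
       (LINT \<omega>|P. (LINT t:{0..T}|lborel. inner (Z t \<omega>) (AQ t \<omega>))) \<and>
       (\<integral>\<^sup>+\<omega>. (\<integral>\<^sup>+t\<in>{0..T}. ennreal ((norm (AQ t \<omega>))\<^sup>2) \<partial>lborel) \<partial>P)
         \<le> M\<^sub>0 * M * (\<integral>\<^sup>+\<omega>. (\<integral>\<^sup>+t\<in>{0..T}. ennreal ((norm (Q t \<omega>))\<^sup>2) \<partial>lborel) \<partial>P))"
proof -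
  interpret delay_setting P F T \<alpha> M\<^sub>0 M K Z Q
    using assms by (intro delay_setting.intro delay_setting_axioms.intro)
  show ?thesis
    using delay_op_represents_M2 adjoint_projection_exists AQ_M2 duality AQ_bound by blast
qed

end
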